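(* There is a polynomial-time $2.523$-approximation algorithm for Flexible Graph Connectivity (FGC): for every instance $I$ it outputs a feasible solution of weight at most $2.523\cdot \mathrm{OPT}(I)$.
   Context: An instance $I=(G,w,\overline F)$ of Flexible Graph Connectivity (FGC) consists of a connected undirected loopless graph $G=(V,E)$ (parallel edges allowed), non-negative edge weights $w\in\mathbb{Q}_{\ge 0}^E$, and a set $\overline F\subseteq E$ of safe edges; $F:=E\setminus\overline F$ is the set of unsafe edges. A set $S\subseteq E$ is feasible if the graph $(V,S\setminus\{f\})$ is connected for every $f\in F$. The task is to find a feasible $S$ of minimum weight $w(S)=\sum_{e\in S}w(e)$; $\mathrm{OPT}(I)$ denotes this minimum weight. *)

theory Defs
  imports Complex_Main "HOL-Library.Log_Nat" "HOL-Computational_Algebra.Polynomial"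
begin

section \<open>Flexible Graph Connectivity\<close>

text \<open>
  Edges are abstract names whose end vertices are given by a function, so that parallel
  edges are allowed; an edge is undirected because its ends form a set.
\<close>

record ('v, 'e) fgc =
  verts  :: "'v set"
  edges  :: "'e set"
  ends   :: "'e \<Rightarrow> 'v set"
  weight :: "'e \<Rightarrow> rat"
  safe   :: "'e set"

definition unsafe :: "('v, 'e) fgc \<Rightarrow> 'e set" where
  "unsafe I = edges I - safe I"

definition adjacency :: "('v, 'e) fgc \<Rightarrow> 'e set \<Rightarrow> ('v \<times> 'v) set" where
  "adjacency I S = {(u, v). \<exists>e\<in>S. ends I e = {u, v}}"

text \<open>Connectedness of the spanning subgraph with edge set \<open>S\<close>.\<close>

definition connected_by :: "('v, 'e) fgc \<Rightarrow> 'e set \<Rightarrow> bool" where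
  "connected_by I S \<longleftrightarrow> (\<forall>u\<in>verts I. \<forall>v\<in>verts I. (u, v) \<in> (adjacency I S)\<^sup>*)"

text \<open>Requiring two distinct ends excludes loops.\<close>

definition fgc_instance :: "('v, 'e) fgc \<Rightarrow> bool" where
  "fgc_instance I \<longleftrightarrow>
     finite (verts I) \<and> verts I \<noteq> {} \<and> finite (edges I) \<and>
     (\<forall>e\<in>edges I. ends I e \<subseteq> verts I \<and> card (ends I e) = 2) \<and>
     connected_by I (edges I) \<and>
     (\<forall>e\<in>edges I. 0 \<le> weight I e) \<and>
     safe I \<subseteq> edges I"

definition feasible :: "('v, 'e) fgc \<Rightarrow> 'e set \<Rightarrow> bool" where
  "feasible I S \<longleftrightarrow> S \<subseteq> edges I \<and> (\<forall>f\<in>unsafe I. connected_by I (S - {f}))"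

definition total_weight :: "('v, 'e) fgc \<Rightarrow> 'e set \<Rightarrow> rat" where
  "total_weight I S = (\<Sum>e\<in>S. weight I e)"

text \<open>
  Meaningful only if a feasible set exists: an instance whose graph has an unsafe bridge
  has none, and then \<open>OPT\<close> is an unspecified number.
\<close>

definition OPT :: "('v, 'e) fgc \<Rightarrow> rat" where
  "OPT I = Min (total_weight I ` {S. feasible I S})"


section \<open>Model of computation\<close>

text \<open>
  Algorithms are programs of a strict first-order functional language with recursion.
  Its values are binary trees with integers at the leaves. The size of a value is the
  length of its description with integers in binary. Every evaluation step that produces a
  value is charged one unit plus the size of that value, as in the logarithmic cost measure
  of random access machines. In particular every value that occurs in a run is no larger
  than the cost of the run, and every primitive is computable in time polynomial in the
  sizes of its arguments, so polynomial cost coincides with polynomial time on Turing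
  machines.
\<close>

datatype val = Num int | Cell val val

fun vsize :: "val \<Rightarrow> nat" where
  "vsize (Num i) = 1 + floorlog 2 (nat \<bar>i\<bar>)"
| "vsize (Cell a b) = 1 + vsize a + vsize b"

datatype unop = Head | Tail | IsCell

datatype binop = Cons | Add | Sub | Mul | Div | Less

text \<open>Ill-typed applications of primitives yield \<open>Num 0\<close>.\<close>

fun unop_val :: "unop \<Rightarrow> val \<Rightarrow> val" where
  "unop_val Head (Cell a b) = a"
| "unop_val Tail (Cell a b) = b"
| "unop_val IsCell (Cell a b) = Num 1"
| "unop_val _ (Num i) = Num 0"

fun binop_val :: "binop \<Rightarrow> val \<Rightarrow> val \<Rightarrow> val" where
  "binop_val Cons a b = Cell a b"
| "binop_val Add (Num i) (Num j) = Num (i + j)"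
| "binop_val Sub (Num i) (Num j) = Num (i - j)"
| "binop_val Mul (Num i) (Num j) = Num (i * j)"
| "binop_val Div (Num i) (Num j) = Num (i div j)"
| "binop_val Less (Num i) (Num j) = Num (if i < j then 1 else 0)"
| "binop_val _ _ _ = Num 0"

text \<open>
  Variables are de Bruijn indices into the list of values of the enclosing local
  definitions, innermost first, followed by the parameters of the current function. A program
  is the list of its function bodies, to which \<open>Call\<close> refers by position.
\<close>

datatype expr =
    Const int
  | Var nat
  | Unary unop expr
  | Binary binop expr expr
  | Ite expr expr expr
  | LetIn expr expr
  | Call nat "expr list"

type_synonym program = "expr list"

text \<open>
  \<open>eval P \<rho> e v t\<close>: in the program \<open>P\<close> and environment \<open>\<rho>\<close>, the expression \<open>e\<close>
  evaluates to \<open>v\<close> with cost \<open>t\<close>. Non-terminating evaluations and those with unbound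
  variables or functions have no value.
\<close>

inductive eval :: "program \<Rightarrow> val list \<Rightarrow> expr \<Rightarrow> val \<Rightarrow> nat \<Rightarrow> bool"
  and evals :: "program \<Rightarrow> val list \<Rightarrow> expr list \<Rightarrow> val list \<Rightarrow> nat \<Rightarrow> bool"
  for P :: program
where
  eval_Const: "eval P \<rho> (Const i) (Num i) (Suc (vsize (Num i)))"
| eval_Var: "i < length \<rho> \<Longrightarrow> eval P \<rho> (Var i) (\<rho> ! i) (Suc (vsize (\<rho> ! i)))"
| eval_Unary: "eval P \<rho> e a s \<Longrightarrow>
    eval P \<rho> (Unary f e) (unop_val f a) (Suc (s + vsize (unop_val f a)))"
| eval_Binary: "eval P \<rho> e1 a s1 \<Longrightarrow> eval P \<rho> e2 b s2 \<Longrightarrow>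
    eval P \<rho> (Binary f e1 e2) (binop_val f a b) (Suc (s1 + s2 + vsize (binop_val f a b)))"
| eval_IteTrue: "eval P \<rho> e a s1 \<Longrightarrow> a \<noteq> Num 0 \<Longrightarrow> eval P \<rho> e1 v s2 \<Longrightarrow>
    eval P \<rho> (Ite e e1 e2) v (Suc (s1 + s2 + vsize v))"
| eval_IteFalse: "eval P \<rho> e a s1 \<Longrightarrow> a = Num 0 \<Longrightarrow> eval P \<rho> e2 v s2 \<Longrightarrow>
    eval P \<rho> (Ite e e1 e2) v (Suc (s1 + s2 + vsize v))"
| eval_LetIn: "eval P \<rho> e1 a s1 \<Longrightarrow> eval P (a # \<rho>) e2 v s2 \<Longrightarrow>
    eval P \<rho> (LetIn e1 e2) v (Suc (s1 + s2 + vsize v))"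
| eval_Call: "evals P \<rho> es as s1 \<Longrightarrow> i < length P \<Longrightarrow> eval P as (P ! i) v s2 \<Longrightarrow>
    eval P \<rho> (Call i es) v (Suc (s1 + s2 + vsize v))"
| evals_Nil: "evals P \<rho> [] [] 0"
| evals_Cons: "eval P \<rho> e v s1 \<Longrightarrow> evals P \<rho> es vs s2 \<Longrightarrow>
    evals P \<rho> (e # es) (v # vs) (s1 + s2)"

inductive_cases eval_elims:
  "eval P \<rho> (Const i) v t"
  "eval P \<rho> (Var i) v t"
  "eval P \<rho> (Unary f e) v t"
  "eval P \<rho> (Binary f e1 e2) v t"
  "eval P \<rho> (Ite e e1 e2) v t"
  "eval P \<rho> (LetIn e1 e2) v t"
  "eval P \<rho> (Call i es) v t"
  "evals P \<rho> [] vs t"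
  "evals P \<rho> (e # es) vs t"

lemma eval_deterministic:
  "eval P \<rho> e v t \<Longrightarrow> eval P \<rho> e v' t' \<Longrightarrow> v' = v \<and> t' = t"
  "evals P \<rho> es vs t \<Longrightarrow> evals P \<rho> es vs' t' \<Longrightarrow> vs' = vs \<and> t' = t"
proof (induction arbitrary: v' t' and vs' t' rule: eval_evals.inducts)
  case eval_Const
  then show ?case by (elim eval_elims) simp
next
  case eval_Var
  then show ?case by (elim eval_elims) simp
next
  case (eval_Unary \<rho> e a s f)
  from eval_Unary.prems show ?case by (elim eval_elims) (use eval_Unary in blast)+
next
  case (eval_Binary \<rho> e1 a s1 e2 b s2 f)
  from eval_Binary.prems show ?case by (elim eval_elims) (use eval_Binary in blast)+
next
  case (eval_IteTrue \<rho> e a s1 e1 v s2 e2)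
  from eval_IteTrue.prems show ?case
    by (elim eval_elims) (use eval_IteTrue in blast)+
next
  case (eval_IteFalse \<rho> e a s1 e2 v s2 e1)
  from eval_IteFalse.prems show ?case
    by (elim eval_elims) (use eval_IteFalse in blast)+
next
  case (eval_LetIn \<rho> e1 a s1 e2 v s2)
  from eval_LetIn.prems show ?case by (elim eval_elims) (use eval_LetIn in blast)+
next
  case (eval_Call \<rho> es as s1 i v s2)
  from eval_Call.prems show ?case by (elim eval_elims) (use eval_Call in blast)+
next
  case evals_Nil
  then show ?case by (elim eval_elims) simp
next
  case (evals_Cons \<rho> e v s1 es vs s2)
  from evals_Cons.prems show ?case by (elim eval_elims) (use evals_Cons in blast)+
qed

text \<open>The first function of a program is its entry point.\<close>

definition runs :: "program \<Rightarrow> val \<Rightarrow> val \<Rightarrow> nat \<Rightarrow> bool" where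
  "runs P x y t \<longleftrightarrow> P \<noteq> [] \<and> eval P [x] (hd P) y t"

definition poly_time_on :: "val set \<Rightarrow> program \<Rightarrow> bool" where
  "poly_time_on X P \<longleftrightarrow>
     (\<exists>p :: nat poly. \<forall>x\<in>X. \<exists>y t. runs P x y t \<and> t \<le> poly p (vsize x))"


section \<open>Encoding of instances and solutions\<close>

text \<open>
  Instances given to a program have natural numbers as names of vertices and edges. An
  instance is encoded as the list of its vertices together with the list of its edges, each
  with its name, its two ends, numerator and denominator of its weight, and whether it is
  safe.
\<close>

fun enc_list :: "val list \<Rightarrow> val" where
  "enc_list [] = Num 0"
| "enc_list (x # xs) = Cell x (enc_list xs)"

definition enc_nats :: "nat list \<Rightarrow> val" where
  "enc_nats ns = enc_list (map (\<lambda>n. Num (int n)) ns)"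

definition enc_edge :: "(nat, nat) fgc \<Rightarrow> nat \<Rightarrow> val" where
  "enc_edge I e = enc_list
     [Num (int e),
      Num (int (Min (ends I e))),
      Num (int (Max (ends I e))),
      Num (fst (quotient_of (weight I e))),
      Num (snd (quotient_of (weight I e))),
      Num (if e \<in> safe I then 1 else 0)]"

definition enc_fgc :: "(nat, nat) fgc \<Rightarrow> val" where
  "enc_fgc I =
     Cell (enc_nats (sorted_list_of_set (verts I)))
          (enc_list (map (enc_edge I) (sorted_list_of_set (edges I))))"

end

theory Submission
  imports Defs "HOL-Library.Function_Algebras"
begin

text \<open>
  The ratio obtained is 2. Fix a root \<open>r\<close>. Direct every edge both ways and take two copies of
  the resulting digraph. Call a set of copied arcs good if it is a forest in each copy, if no
  arc enters \<open>r\<close> and at most two enter any other vertex, and if an arc of an unsafe edge is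
  used in at most one copy. Good sets are the common independent sets of a graphic matroid and
  a partition-like matroid. If a good set has the maximal size \<open>2 * (n - 1)\<close>, then every vertex
  set \<open>Z\<close> avoiding \<open>r\<close> is entered by two of its arcs, since \<open>2 * card Z\<close> arcs point into \<open>Z\<close> and the
  forests contain at most \<open>2 * (card Z - 1)\<close> arcs inside \<open>Z\<close>. Hence every cut contains a safe
  edge or two edges, and the underlying edges form a feasible set. Conversely, an ear
  decomposition of a feasible set \<open>S\<close> yields a good set of that size which uses every edge of
  \<open>S\<close> at most once per copy, so it costs at most twice the weight of \<open>S\<close>. It remains to find a
  good set of size \<open>2 * (n - 1)\<close> of minimum weight, by weighted matroid intersection.

  Feasibility is vacuous if there is no unsafe edge. Then \<open>OPT I = 0\<close>, and the algorithm has to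
  return the empty set instead of a spanning tree.
\<close>

section \<open>Polynomial-time functions\<close>

text \<open>The in-degree bound two is imposed on both copies together. A bound of one in each copy
  would describe two arborescences, but then the class of arcs entering \<open>v\<close> within one
  copy and the class of the two copies of an unsafe arc overlap without being nested, and such
  constraints need not form a matroid. With the joint bound all classes are nested, the second
  system is a laminar matroid, and two matroids suffice. The price is that a good set of full size
  need not consist of two arborescences, so feasibility has to come from counting across cuts.

  The intersection algorithm sees the original weight only: it looks for cheapest and, among these,
  shortest walks in the exchange graph. Its optimality is certified by splitting the weight into one
  part per matroid. The splittings live in the proof alone, so it does not matter that adjusting
  them in unit steps may take exponentially many rounds. Scaling the rational weights by a common
  denominator makes the splittings integral, which the unit steps rely on.\<close>

lemma poly_nat_mono: "x \<le> y \<Longrightarrow> poly (p :: nat poly) x \<le> poly p y"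
  by (induction p) (auto intro!: add_mono mult_le_mono)

lemma eval_vsize: "eval P \<rho> e v t \<Longrightarrow> vsize v \<le> t"
  by (erule eval.cases) auto

lemma floorlog_0 [simp]: "floorlog 2 0 = 0"
  by (simp add: floorlog_def)

lemma floorlog_1 [simp]: "floorlog 2 (Suc 0) = 1"
  by (simp add: floorlog_def)

lemma abs_div_le: "\<bar>i div j\<bar> \<le> \<bar>i :: int\<bar>"
proof -
  have pos: "\<bar>i div j\<bar> \<le> \<bar>i\<bar>" if "0 < j" for i j :: int
    using that by (smt (verit) div_by_1 pos_imp_zdiv_neg_iff zdiv_mono2 zdiv_mono2_neg)
  consider "0 < j" | "j = 0" | "0 < - j" by linarith
  then show ?thesis
    using pos[of j i] pos[of "- j" "- i"] by cases auto
qed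

text \<open>Products add up bit lengths, a sum of numbers below \<open>2 ^ a\<close> and
  \<open>2 ^ b\<close> is below \<open>2 ^ (a + b + 1)\<close>, and floor division does not increase
  the absolute value. Equality is attained by \<open>Cons\<close>.\<close>

lemma vsize_binop: "vsize (binop_val f a b) \<le> vsize a + vsize b + 1"
proof (cases "\<exists>i j. a = Num i \<and> b = Num j \<and> f \<noteq> Cons")
  case True
  then obtain i j where ab: "a = Num i" "b = Num j" "f \<noteq> Cons" by blast
  define x where "x = nat \<bar>i\<bar>"
  define y where "y = nat \<bar>j\<bar>"
  have floorlog_le: "floorlog 2 z \<le> k" if "z < 2 ^ k" for z k :: nat
    using that by (simp add: floorlog_leI)
  have xy: "x < 2 ^ floorlog 2 x" "y < 2 ^ floorlog 2 y"
    by (auto intro!: floorlog_leD)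
  have prod: "x * y < 2 ^ (floorlog 2 x + floorlog 2 y)"
    using mult_strict_mono[OF xy] by (simp add: power_add)
  have "(1::nat) \<le> 2 ^ floorlog 2 x" "(1::nat) \<le> 2 ^ floorlog 2 y" by simp_all
  then obtain A B where AB: "(2::nat) ^ floorlog 2 x = Suc A" "(2::nat) ^ floorlog 2 y = Suc B"
    by (metis Suc_le_D One_nat_def)
  have sum: "x + y < 2 ^ (floorlog 2 x + floorlog 2 y + 1)"
    using xy unfolding power_add AB by simp
  have addsub: "nat \<bar>i + j\<bar> \<le> x + y" "nat \<bar>i - j\<bar> \<le> x + y"
    by (simp_all add: x_def y_def)
  have mult: "nat \<bar>i * j\<bar> = x * y"
    by (simp add: x_def y_def abs_mult nat_mult_distrib)
  have div: "nat \<bar>i div j\<bar> \<le> x"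
    using abs_div_le[of i j] by (simp add: x_def)
  have sizes: "vsize a = 1 + floorlog 2 x" "vsize b = 1 + floorlog 2 y"
    by (simp_all add: ab x_def y_def)
  have le: "floorlog 2 (nat \<bar>i + j\<bar>) \<le> floorlog 2 x + floorlog 2 y + 1"
    "floorlog 2 (nat \<bar>i - j\<bar>) \<le> floorlog 2 x + floorlog 2 y + 1"
    "floorlog 2 (nat \<bar>i * j\<bar>) \<le> floorlog 2 x + floorlog 2 y"
    "floorlog 2 (nat \<bar>i div j\<bar>) \<le> floorlog 2 x"
    using floorlog_le[OF prod] floorlog_le[OF le_less_trans[OF addsub(1) sum]]
      floorlog_le[OF le_less_trans[OF addsub(2) sum]] floorlog_mono[OF div, of 2]
    by (simp_all only: mult)
  show ?thesis
    unfolding sizes using ab(3) le by (cases f) (simp_all add: ab(1,2))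
next
  case False
  then show ?thesis
    by (cases f; cases a; cases b) auto
qed

lemma vsize_unop: "vsize (unop_val f a) \<le> vsize a + 2"
  by (cases f; cases a) auto

text \<open>
  Everything is a function of a single value, several arguments being packed with
  \<open>Cell\<close>. Quantifying over the position \<open>m\<close> at which the code is linked makes the notion
  closed under composition.
\<close>

definition link :: "nat \<Rightarrow> program \<Rightarrow> (val \<Rightarrow> val) \<Rightarrow> expr \<Rightarrow> nat poly \<Rightarrow> bool" where
  "link m Q f e p \<longleftrightarrow> (\<forall>P R x. length P = m \<longrightarrow>
     (\<exists>t. eval (P @ Q @ R) [x] e (f x) t \<and> t \<le> poly p (vsize x)))"

definition pt :: "(val \<Rightarrow> val) \<Rightarrow> bool" where
  "pt f \<longleftrightarrow> (\<forall>m. \<exists>Q e p. link m Q f e p)"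

lemma linkD:
  assumes "link m Q f e p" "length P = m"
  obtains t where "eval (P @ Q @ R) [x] e (f x) t" "t \<le> poly p (vsize x)"
  using assms unfolding link_def by blast

text \<open>Code placed after \<open>Q\<close> is absorbed by the arbitrary suffix \<open>R\<close>,
  and in \<open>link_right\<close> code placed before by the prefix \<open>P\<close>. The spare
  summand in the bound lets several functions share one block of code and one polynomial.\<close>

lemma link_left: "link m Q f e p \<Longrightarrow> link m (Q @ Q') f e (p + p')"
  by (fastforce simp: link_def intro: trans_le_add1)

lemma link_right: "link (m + length Q) Q' f e p \<Longrightarrow> link m (Q @ Q') f e (p' + p)"
  unfolding link_def
proof (intro allI impI)
  fix P R :: program and x
  assume *: "\<forall>P R x. length P = m + length Q \<longrightarrow>
     (\<exists>t. eval (P @ Q' @ R) [x] e (f x) t \<and> t \<le> poly p (vsize x))" and "length P = m"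
  then obtain t where "eval ((P @ Q) @ Q' @ R) [x] e (f x) t" "t \<le> poly p (vsize x)"
    by (metis length_append)
  then show "\<exists>t. eval (P @ (Q @ Q') @ R) [x] e (f x) t \<and> t \<le> poly (p' + p) (vsize x)"
    by (intro exI[of _ t]) auto
qed

lemma pt_link2:
  assumes "pt f" "pt g"
  shows "\<exists>Q e1 e2 p. link m Q f e1 p \<and> link m Q g e2 p"
proof -
  obtain Q1 e1 p1 where 1: "link m Q1 f e1 p1" using assms(1) pt_def by blast
  obtain Q2 e2 p2 where 2: "link (m + length Q1) Q2 g e2 p2" using assms(2) pt_def by blast
  show ?thesis using link_left[OF 1] link_right[OF 2] by blast
qed

lemma pt_link3:
  assumes "pt f" "pt g" "pt h"
  shows "\<exists>Q e1 e2 e3 p. link m Q f e1 p \<and> link m Q g e2 p \<and> link m Q h e3 p"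
proof -
  obtain Q1 e1 e2 p1 where 1: "link m Q1 f e1 p1" "link m Q1 g e2 p1"
    using pt_link2[OF assms(1,2)] by blast
  obtain Q2 e3 p2 where 2: "link (m + length Q1) Q2 h e3 p2" using assms(3) pt_def by blast
  show ?thesis using link_left[OF 1(1)] link_left[OF 1(2)] link_right[OF 2] by blast
qed

text \<open>Every step is charged the size of the value it produces, so a time bound is also a bound
  on the output size. Composition and iteration depend on this.\<close>

lemma pt_vsize: "pt f \<Longrightarrow> \<exists>p. \<forall>x. vsize (f x) \<le> poly p (vsize x)"
proof -
  assume "pt f"
  then obtain Q e p where "link 0 Q f e p" unfolding pt_def by blast
  then have "\<forall>x. vsize (f x) \<le> poly p (vsize x)"
    unfolding link_def using eval_vsize by (metis append_Nil le_trans list.size(3))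
  then show ?thesis by blast
qed

lemma pt_id: "pt (\<lambda>x. x)"
  unfolding pt_def link_def
proof (intro allI exI impI)
  fix m and P R :: program and x :: val
  have "eval (P @ [] @ R) [x] (Var 0) x (Suc (vsize x))"
    using eval_Var[of 0 "[x]"] by simp
  then show "eval (P @ [] @ R) [x] (Var 0) x (Suc (vsize x)) \<and> Suc (vsize x) \<le> poly [:1, 1:] (vsize x)"
    by simp
qed

lemma pt_num: "pt (\<lambda>x. Num i)"
  unfolding pt_def link_def
proof (intro allI exI impI)
  fix m and P R :: program and x :: val
  show "eval (P @ [] @ R) [x] (Const i) (Num i) (Suc (vsize (Num i))) \<and>
    Suc (vsize (Num i)) \<le> poly [:Suc (vsize (Num i)):] (vsize x)"
    using eval_Const by simp
qed

lemma pt_unop: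
  assumes "pt f"
  shows "pt (\<lambda>x. unop_val u (f x))"
  unfolding pt_def
proof
  fix m
  obtain Q e p where l: "link m Q f e p" using assms pt_def by blast
  have "link m Q (\<lambda>x. unop_val u (f x)) (Unary u e) (p + p + [:3:])"
    unfolding link_def
  proof (intro allI impI)
    fix P R :: program and x :: val
    assume "length P = m"
    with l obtain t where t: "eval (P @ Q @ R) [x] e (f x) t" "t \<le> poly p (vsize x)"
      by (rule linkD)
    show "\<exists>t. eval (P @ Q @ R) [x] (Unary u e) (unop_val u (f x)) t \<and> t \<le> poly (p + p + [:3:]) (vsize x)"
      using eval_Unary[OF t(1), of u] t(2) eval_vsize[OF t(1)] vsize_unop[of u "f x"]
      by (intro exI conjI) (assumption, simp)
  qed
  then show "\<exists>Q e p. link m Q (\<lambda>x. unop_val u (f x)) e p" by blast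
qed

lemma pt_binop:
  assumes "pt f" "pt g"
  shows "pt (\<lambda>x. binop_val b (f x) (g x))"
  unfolding pt_def
proof
  fix m
  obtain Q e1 e2 p where l: "link m Q f e1 p" "link m Q g e2 p" using pt_link2[OF assms] by blast
  have "link m Q (\<lambda>x. binop_val b (f x) (g x)) (Binary b e1 e2) (p + p + p + p + [:2:])"
    unfolding link_def
  proof (intro allI impI)
    fix P R :: program and x :: val
    assume P: "length P = m"
    from linkD[OF l(1) P] obtain t where t: "eval (P @ Q @ R) [x] e1 (f x) t" "t \<le> poly p (vsize x)" .
    from linkD[OF l(2) P] obtain t' where t': "eval (P @ Q @ R) [x] e2 (g x) t'" "t' \<le> poly p (vsize x)" .
    show "\<exists>t. eval (P @ Q @ R) [x] (Binary b e1 e2) (binop_val b (f x) (g x)) t \<and>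
        t \<le> poly (p + p + p + p + [:2:]) (vsize x)"
      using eval_Binary[OF t(1) t'(1), of b] t(2) t'(2) eval_vsize[OF t(1)] eval_vsize[OF t'(1)]
        vsize_binop[of b "f x" "g x"]
      by (intro exI conjI) (assumption, simp)
  qed
  then show "\<exists>Q e p. link m Q (\<lambda>x. binop_val b (f x) (g x)) e p" by blast
qed

lemma pt_ite:
  assumes "pt c" "pt f" "pt g"
  shows "pt (\<lambda>x. if c x \<noteq> Num 0 then f x else g x)"
  unfolding pt_def
proof
  fix m
  let ?h = "\<lambda>x. if c x \<noteq> Num 0 then f x else g x"
  obtain Q e1 e2 e3 p where l: "link m Q c e1 p" "link m Q f e2 p" "link m Q g e3 p"
    using pt_link3[OF assms] by blast
  have "link m Q ?h (Ite e1 e2 e3) (p + p + p + [:1:])"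
    unfolding link_def
  proof (intro allI impI)
    fix P R :: program and x :: val
    assume P: "length P = m"
    from linkD[OF l(1) P] obtain t where t: "eval (P @ Q @ R) [x] e1 (c x) t" "t \<le> poly p (vsize x)" .
    from linkD[OF l(2) P] obtain t' where t': "eval (P @ Q @ R) [x] e2 (f x) t'" "t' \<le> poly p (vsize x)" .
    from linkD[OF l(3) P] obtain t'' where t'': "eval (P @ Q @ R) [x] e3 (g x) t''" "t'' \<le> poly p (vsize x)" .
    show "\<exists>t. eval (P @ Q @ R) [x] (Ite e1 e2 e3) (?h x) t \<and> t \<le> poly (p + p + p + [:1:]) (vsize x)"
    proof (cases "c x = Num 0")
      case True
      then show ?thesis
        using eval_IteFalse[OF t(1) True t''(1), of e2] t(2) t''(2) eval_vsize[OF t''(1)]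
        by (intro exI conjI) (simp, simp)
    next
      case False
      then show ?thesis
        using eval_IteTrue[OF t(1) False t'(1), of e3] t(2) t'(2) eval_vsize[OF t'(1)]
        by (intro exI conjI) (simp, simp)
    qed
  qed
  then show "\<exists>Q e p. link m Q ?h e p" by blast
qed

text \<open>The body \<open>e1\<close> of \<open>f\<close> becomes a function of its own, because it
  is only known to work in an environment consisting of its argument. A local definition would keep
  \<open>x\<close> in the environment.\<close>

lemma pt_comp:
  assumes "pt f" "pt g"
  shows "pt (\<lambda>x. f (g x))"
  unfolding pt_def
proof
  fix m
  obtain Q e1 e2 p where l: "link m Q f e1 p" "link m Q g e2 p" using pt_link2[OF assms] by blast
  let ?q = "pcompose p p"
  have "link m (Q @ [e1]) (\<lambda>x. f (g x)) (Call (m + length Q) [e2]) (p + ?q + ?q + [:1:])"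
    unfolding link_def
  proof (intro allI impI)
    fix P R :: program and x :: val
    assume P: "length P = m"
    from linkD[OF l(2) P] obtain t where t: "eval (P @ Q @ ([e1] @ R)) [x] e2 (g x) t" "t \<le> poly p (vsize x)" .
    from linkD[OF l(1) P] obtain t' where t': "eval (P @ Q @ ([e1] @ R)) [g x] e1 (f (g x)) t'"
        "t' \<le> poly p (vsize (g x))" .
    have t'': "t' \<le> poly ?q (vsize x)"
      unfolding poly_pcompose using t'(2) poly_nat_mono[OF le_trans[OF eval_vsize[OF t(1)] t(2)], of p]
      by (rule le_trans)
    have nth: "(P @ Q @ [e1] @ R) ! (m + length Q) = e1"
      using P by (simp add: nth_append)
    have es: "evals (P @ Q @ [e1] @ R) [x] [e2] [g x] (t + 0)"
      by (intro evals_Cons evals_Nil t(1))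
    have "eval (P @ Q @ [e1] @ R) [x] (Call (m + length Q) [e2]) (f (g x)) (Suc (t + 0 + t' + vsize (f (g x))))"
      by (rule eval_Call[OF es]) (use P t'(1) nth in auto)
    then show "\<exists>t. eval (P @ (Q @ [e1]) @ R) [x] (Call (m + length Q) [e2]) (f (g x)) t \<and>
        t \<le> poly (p + ?q + ?q + [:1:]) (vsize x)"
      using t(2) t'' eval_vsize[OF t'(1)]
      by (intro exI conjI) (simp, simp)
  qed
  then show "\<exists>Q e p. link m Q (\<lambda>x. f (g x)) e p" by blast
qed

section \<open>Iteration over lists\<close>

abbreviation hd_val :: "val \<Rightarrow> val" where "hd_val \<equiv> unop_val Head"
abbreviation tl_val :: "val \<Rightarrow> val" where "tl_val \<equiv> unop_val Tail"

fun dec_list :: "val \<Rightarrow> val list" where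
  "dec_list (Cell a b) = a # dec_list b"
| "dec_list (Num i) = []"

lemma dec_enc_list [simp]: "dec_list (enc_list xs) = xs"
  by (induction xs) auto

lemma pt_Cell: "pt f \<Longrightarrow> pt g \<Longrightarrow> pt (\<lambda>x. Cell (f x) (g x))"
  using pt_binop[of f g Cons] by simp

lemma pt_hd: "pt f \<Longrightarrow> pt (\<lambda>x. hd_val (f x))"
  and pt_tl: "pt f \<Longrightarrow> pt (\<lambda>x. tl_val (f x))"
  by (erule pt_unop)+

text \<open>A loop made of two functions: position \<open>js\<close> holds the step, position
  \<open>j\<close> the recursion over the list. \<open>B\<close> bounds the accumulators of all
  suffixes and thereby the arguments of the step. The factor \<open>vsize xs\<close> bounds the
  number of rounds including the final one, and the constants 100 generously cover packing and
  unpacking in a round.\<close>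

lemma foldr_eval:
  assumes S: "\<And>x. \<exists>t. eval P [x] eS (S x) t \<and> t \<le> poly p (vsize x)"
    and js: "js < length P" "P ! js = eS"
    and j: "j < length P"
    and body: "P ! j = Ite (Unary IsCell (Unary Head (Var 0)))
       (Call js [Binary Cons (Unary Head (Unary Head (Var 0)))
          (Binary Cons (Call j [Binary Cons (Unary Tail (Unary Head (Var 0))) (Unary Tail (Var 0))])
             (Unary Tail (Unary Tail (Var 0))))])
       (Unary Head (Unary Tail (Var 0)))"
    and B: "\<And>zs ys. dec_list xs = zs @ ys \<Longrightarrow>
      vsize (foldr (\<lambda>x r. S (Cell x (Cell r c))) ys a) \<le> B"
  shows "\<exists>t. eval P [Cell xs (Cell a c)] (P ! j) (foldr (\<lambda>x r. S (Cell x (Cell r c))) (dec_list xs) a) t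
     \<and> t \<le> vsize xs * (poly p (2 + vsize xs + B + vsize c) +
           100 + 100 * (vsize xs + vsize a + B + vsize c))"
  using B
proof (induction xs)
  case (Num i)
  let ?v = "Cell (Num i) (Cell a c)"
  have v: "eval P [?v] (Var 0) ?v (Suc (vsize ?v))" using eval_Var[of 0 "[?v]"] by simp
  note h = eval_Unary[OF v, of Head, simplified]
  note t = eval_Unary[OF v, of Tail, simplified]
  note c = eval_Unary[OF h, of IsCell, simplified]
  note a = eval_Unary[OF t, of Head, simplified]
  have F: "foldr (\<lambda>x r. S (Cell x (Cell r c))) (dec_list (Num i)) a = a" by simp
  show ?case
    unfolding F body by (intro exI conjI, rule eval_IteFalse[OF c refl a], simp)
next
  case (Cell x xs)
  let ?F = "\<lambda>ys. foldr (\<lambda>x r. S (Cell x (Cell r c))) ys a"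
  let ?v = "Cell (Cell x xs) (Cell a c)"
  let ?K = "\<lambda>n. poly p (2 + n + B + vsize c) + 100 + 100 * (n + vsize a + B + vsize c)"
  have sub: "vsize (?F ys) \<le> B" if "dec_list xs = zs @ ys" for zs ys
    using Cell.prems[of "x # zs" ys] that by simp
  have "\<exists>t. eval P [Cell xs (Cell a c)] (P ! j) (?F (dec_list xs)) t \<and> t \<le> vsize xs * ?K (vsize xs)"
    by (rule Cell.IH(2)) (rule sub)
  then obtain s where
    s: "eval P [Cell xs (Cell a c)] (P ! j) (?F (dec_list xs)) s" "s \<le> vsize xs * ?K (vsize xs)"
    by blast
  let ?r = "?F (dec_list xs)"
  let ?w = "Cell x (Cell ?r c)"
  obtain s' where s': "eval P [?w] eS (S ?w) s'" "s' \<le> poly p (vsize ?w)" using S by blast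
  have B1: "vsize ?r \<le> B" "vsize (S ?w) \<le> B"
    using Cell.prems[of "[x]" "dec_list xs"] Cell.prems[of "[]" "x # dec_list xs"] by simp_all
  have v: "eval P [?v] (Var 0) ?v (Suc (vsize ?v))" using eval_Var[of 0 "[?v]"] by simp
  note h = eval_Unary[OF v, of Head, simplified]
  note t = eval_Unary[OF v, of Tail, simplified]
  note c = eval_Unary[OF h, of IsCell, simplified]
  note hh = eval_Unary[OF h, of Head, simplified]
  note th = eval_Unary[OF h, of Tail, simplified]
  note tt = eval_Unary[OF t, of Tail, simplified]
  note arg = eval_Binary[OF th t, of Cons, simplified]
  note rec = eval_Call[OF evals_Cons[OF arg evals_Nil] j s(1)]
  note arg2 = eval_Binary[OF hh eval_Binary[OF rec tt, of Cons, simplified], of Cons, simplified]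
  have call: "eval P [?w] (P ! js) (S ?w) s'" using s' js by simp
  note call2 = eval_Call[OF evals_Cons[OF arg2 evals_Nil] js(1) call]
  have pm: "poly p (vsize ?w) \<le> poly p (2 + vsize (Cell x xs) + B + vsize c)"
    by (rule poly_nat_mono) (use B1 in simp)
  have pm2: "vsize xs * ?K (vsize xs) \<le> vsize xs * ?K (vsize (Cell x xs))"
    by (intro mult_le_mono order_refl add_mono poly_nat_mono) auto
  have pm3: "vsize (Cell x xs) * ?K (vsize (Cell x xs)) \<ge>
     vsize xs * ?K (vsize (Cell x xs)) + ?K (vsize (Cell x xs))"
    by (simp add: algebra_simps)
  let ?L = "poly p (2 + vsize (Cell x xs) + B + vsize c)"
  have "\<exists>t. eval P [?v] (P ! j) (S ?w) t \<and> t \<le> s + ?L + 100 + 100 * (vsize (Cell x xs) + vsize a + B + vsize c)"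
    unfolding body
    by (intro exI conjI, rule eval_IteTrue[OF c _ call2], simp, use B1 pm s'(2) in simp)
  then obtain t where "eval P [?v] (P ! j) (S ?w) t"
    and t: "t \<le> s + ?L + 100 + 100 * (vsize (Cell x xs) + vsize a + B + vsize c)" by blast
  then have "eval P [?v] (P ! j) (?F (dec_list (Cell x xs))) t" by simp
  moreover have "t \<le> vsize (Cell x xs) * ?K (vsize (Cell x xs))"
    using t s(2) pm2 pm3 by linarith
  ultimately show ?case by blast
qed

lemma pt_foldr_bounded:
  assumes S: "pt (\<lambda>t. S (hd_val t) (hd_val (tl_val t)) (tl_val (tl_val t)))"
    and L: "pt L" and A: "pt A"
    and bounded: "\<exists>pB. \<forall>c zs ys. dec_list (L c) = zs @ ys \<longrightarrow>
      vsize (foldr (\<lambda>x r. S x r c) ys (A c)) \<le> poly pB (vsize c)"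
  shows "pt (\<lambda>c. foldr (\<lambda>x r. S x r c) (dec_list (L c)) (A c))"
  unfolding pt_def
proof
  fix m
  let ?S = "\<lambda>t. S (hd_val t) (hd_val (tl_val t)) (tl_val (tl_val t))"
  let ?f = "\<lambda>c. foldr (\<lambda>x r. S x r c) (dec_list (L c)) (A c)"
  obtain pB where pB: "\<And>c zs ys. dec_list (L c) = zs @ ys \<Longrightarrow>
      vsize (foldr (\<lambda>x r. S x r c) ys (A c)) \<le> poly pB (vsize c)"
    using bounded by blast
  obtain Q eS eL eA p where l: "link m Q ?S eS p" "link m Q L eL p" "link m Q A eA p"
    using pt_link3[OF S L A] by blast
  define js where "js = m + length Q"
  define body where "body = Ite (Unary IsCell (Unary Head (Var 0)))
       (Call js [Binary Cons (Unary Head (Unary Head (Var 0)))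
          (Binary Cons (Call (Suc js) [Binary Cons (Unary Tail (Unary Head (Var 0))) (Unary Tail (Var 0))])
             (Unary Tail (Unary Tail (Var 0))))])
       (Unary Head (Unary Tail (Var 0)))"
  define e where "e = Call (Suc js) [Binary Cons eL (Binary Cons eA (Var 0))]"
  \<comment> \<open>\<open>q\<close> bounds the size of the packed argument of one step: list
    element, accumulator and context, plus two cells.\<close>
  define q where "q = [:2, 1:] + p + pB"
  define q' where "q' = p * (pcompose p q + [:100:] + [:100:] * (p + p + pB + [:0, 1:]))
    + (p + p + p + p + p + p + p + p) + pB + [:20, 20:]"
  have "link m (Q @ [eS, body]) ?f e q'"
    unfolding link_def
  proof (intro allI impI)
    fix P R :: program and c :: val
    assume P: "length P = m"
    define PP where "PP = P @ Q @ [eS, body] @ R"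
    from linkD[OF l(2) P, of "[eS, body] @ R"] obtain t2 where t2: "eval PP [c] eL (L c) t2" "t2 \<le> poly p (vsize c)"
      unfolding PP_def by blast
    from linkD[OF l(3) P, of "[eS, body] @ R"] obtain t3 where t3: "eval PP [c] eA (A c) t3" "t3 \<le> poly p (vsize c)"
      unfolding PP_def by blast
    have js: "js < length PP" "PP ! js = eS" "Suc js < length PP" "PP ! (Suc js) = body"
      using P by (auto simp: PP_def js_def nth_append)
    have "\<exists>t. eval PP [x] eS (?S x) t \<and> t \<le> poly p (vsize x)" for x
      using linkD[OF l(1) P, of "[eS, body] @ R"] unfolding PP_def by metis
    note fe = foldr_eval[where S = ?S, OF this js(1,2,3) trans[OF js(4) body_def], of "L c" c "A c" "poly pB (vsize c)"]
    obtain t where t: "eval PP [Cell (L c) (Cell (A c) c)] (PP ! Suc js) (?f c) t"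
      "t \<le> vsize (L c) * (poly p (2 + vsize (L c) + poly pB (vsize c) + vsize c) +
           100 + 100 * (vsize (L c) + vsize (A c) + poly pB (vsize c) + vsize c))"
      using fe pB by auto
    have v: "eval PP [c] (Var 0) c (Suc (vsize c))" using eval_Var[of 0 "[c]"] by simp
    note arg = eval_Binary[OF t2(1) eval_Binary[OF t3(1) v, of Cons], of Cons, simplified]
    note call = eval_Call[OF evals_Cons[OF arg evals_Nil] js(3), OF t(1)]
    have sz: "vsize (L c) \<le> poly p (vsize c)" "vsize (A c) \<le> poly p (vsize c)"
      "vsize (?f c) \<le> poly pB (vsize c)"
      using le_trans[OF eval_vsize[OF t2(1)] t2(2)] le_trans[OF eval_vsize[OF t3(1)] t3(2)]
        pB[of c "[]" "dec_list (L c)"] by simp_all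
    have "t \<le> poly p (vsize c) * (poly p (poly q (vsize c)) +
           100 + 100 * (poly p (vsize c) + poly p (vsize c) + poly pB (vsize c) + vsize c))"
      by (rule le_trans[OF t(2)], intro mult_le_mono add_mono poly_nat_mono order_refl)
        (use sz in \<open>auto simp: q_def\<close>)
    then show "\<exists>t. eval (P @ (Q @ [eS, body]) @ R) [c] e (?f c) t \<and> t \<le> poly q' (vsize c)"
      using call t2(2) t3(2) sz unfolding e_def PP_def
      by (intro exI conjI) (simp, simp add: q'_def poly_pcompose)
  qed
  then show "\<exists>Q e p. link m Q ?f e p" by blast
qed

lemma dec_list_vsize: "x \<in> set (dec_list v) \<Longrightarrow> vsize x \<le> vsize v"
  by (induction v) auto

lemma dec_list_length: "length (dec_list v) \<le> vsize v"
  by (induction v) auto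

lemma enc_list_vsize: "x \<in> set xs \<Longrightarrow> vsize x \<le> vsize (enc_list xs)"
  and enc_list_length: "length xs \<le> vsize (enc_list xs)"
  using dec_list_vsize[of x "enc_list xs"] dec_list_length[of "enc_list xs"] by simp_all

text \<open>
  The following rules differ in how the size of the accumulator is bounded. Some bound is
  needed, since iterating a polynomial-time function may take exponential time.
\<close>

lemma pt_foldr:
  assumes "pt (\<lambda>t. S (hd_val t) (hd_val (tl_val t)) (tl_val (tl_val t)))"
    and "pt (\<lambda>c. enc_list (L c))" and "pt A"
    and "\<exists>pB. \<forall>c zs ys. L c = zs @ ys \<longrightarrow>
      vsize (foldr (\<lambda>x r. S x r c) ys (A c)) \<le> poly pB (vsize c)"
  shows "pt (\<lambda>c. foldr (\<lambda>x r. S x r c) (L c) (A c))"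
  using pt_foldr_bounded[of S "\<lambda>c. enc_list (L c)" A] assms by simp

text \<open>Serves iterations in which every round produces a sublist of a list that is fixed by the
  context.\<close>

lemma pt_foldr_abs:
  assumes "pt (\<lambda>t. S (hd_val t) (hd_val (tl_val t)) (tl_val (tl_val t)))"
    and "pt (\<lambda>c. enc_list (L c))" and "pt A"
    and q: "\<exists>q. \<forall>x r c. vsize (S x r c) \<le> poly q (vsize c)"
  shows "pt (\<lambda>c. foldr (\<lambda>x r. S x r c) (L c) (A c))"
proof -
  obtain p where p: "\<And>x. vsize (A x) \<le> poly p (vsize x)" using pt_vsize[OF assms(3)] by blast
  obtain q where q: "\<And>x r c. vsize (S x r c) \<le> poly q (vsize c)" using q by blast
  have "vsize (foldr (\<lambda>x r. S x r c) ys (A c)) \<le> poly (p + q) (vsize c)" for c ys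
    using q p[of c] by (cases ys) (auto intro: trans_le_add1 trans_le_add2)
  then show ?thesis using assms(1-3) by (intro pt_foldr exI[of _ "p + q"]) auto
qed

lemma pt_foldr_add:
  assumes "pt (\<lambda>t. S (hd_val t) (hd_val (tl_val t)) (tl_val (tl_val t)))"
    and L: "pt (\<lambda>c. enc_list (L c))" and "pt A"
    and q: "\<exists>q. \<forall>x r c. vsize (S x r c) \<le> vsize r + poly q (vsize x + vsize c)"
  shows "pt (\<lambda>c. foldr (\<lambda>x r. S x r c) (L c) (A c))"
proof -
  obtain p where p: "\<And>x. vsize (A x) \<le> poly p (vsize x)" using pt_vsize[OF assms(3)] by blast
  obtain l where l: "\<And>x. vsize (enc_list (L x)) \<le> poly l (vsize x)" using pt_vsize[OF L] by blast
  obtain q where q: "\<And>x r c. vsize (S x r c) \<le> vsize r + poly q (vsize x + vsize c)" using q by blast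
  let ?b = "p + l * pcompose q (l + [:0, 1:])"
  have "vsize (foldr (\<lambda>x r. S x r c) ys (A c)) \<le> poly ?b (vsize c)" if "L c = zs @ ys" for c zs ys
  proof -
    let ?q = "poly q (poly l (vsize c) + vsize c)"
    have *: "vsize x \<le> poly l (vsize c)" if "x \<in> set ys" for x
      using that enc_list_vsize[of x "L c"] l[of c] \<open>L c = zs @ ys\<close> by auto
    have "vsize (foldr (\<lambda>x r. S x r c) ys (A c)) \<le> vsize (A c) + length ys * ?q"
      using *
    proof (induction ys)
      case (Cons y ys)
      have "poly q (vsize y + vsize c) \<le> ?q"
        using Cons.prems by (intro poly_nat_mono) simp
      then show ?case
        using Cons q[of y "foldr (\<lambda>x r. S x r c) ys (A c)" c] by fastforce
    qed simp
    also have "\<dots> \<le> poly p (vsize c) + poly l (vsize c) * ?q"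
      using p[of c] l[of c] enc_list_length[of "L c"] that
      by (intro add_mono mult_le_mono order_refl) auto
    finally show ?thesis by (simp add: poly_pcompose)
  qed
  then show ?thesis using assms(1-3) by (intro pt_foldr exI[of _ ?b]) auto
qed

section \<open>Booleans, integers and list operations on values\<close>

definition bv :: "bool \<Rightarrow> val" where "bv b = Num (if b then 1 else 0)"

fun numv :: "val \<Rightarrow> int" where
  "numv (Num i) = i"
| "numv (Cell a b) = 0"

lemma bv_simps [simp]: "bv b \<noteq> Num 0 \<longleftrightarrow> b" "bv b = Num 0 \<longleftrightarrow> \<not> b"
  "vsize (bv b) \<le> 2"
  by (auto simp: bv_def)

lemma pt_if:
  assumes "pt (\<lambda>c. bv (P c))" "pt f" "pt g"
  shows "pt (\<lambda>c. if P c then f c else g c)"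
  using pt_ite[OF assms] by simp

lemma pt_list_if:
  assumes "pt (\<lambda>c. bv (P c))" "pt (\<lambda>c. enc_list (f c))" "pt (\<lambda>c. enc_list (g c))"
  shows "pt (\<lambda>c. enc_list (if P c then f c else g c))"
  using pt_if[OF assms] by (simp add: if_distrib[of enc_list])

lemma pt_int_if:
  assumes "pt (\<lambda>c. bv (P c))" "pt (\<lambda>c. Num (f c))" "pt (\<lambda>c. Num (g c))"
  shows "pt (\<lambda>c. Num (if P c then f c else g c))"
  using pt_if[OF assms] by (simp add: if_distrib[of Num])

lemma pt_bool_if:
  assumes "pt (\<lambda>c. bv (P c))" "pt (\<lambda>c. bv (f c))" "pt (\<lambda>c. bv (g c))"
  shows "pt (\<lambda>c. bv (if P c then f c else g c))"
  using pt_if[OF assms] by (simp add: if_distrib[of bv])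

lemma pt_bool: "pt (\<lambda>c. bv b)"
  by (simp add: bv_def pt_num)

lemma pt_conj: "pt (\<lambda>c. bv (P c)) \<Longrightarrow> pt (\<lambda>c. bv (Q c)) \<Longrightarrow> pt (\<lambda>c. bv (P c \<and> Q c))"
proof -
  have "(P \<and> Q) = (if P then Q else False)" for P Q by simp
  then show "pt (\<lambda>c. bv (P c)) \<Longrightarrow> pt (\<lambda>c. bv (Q c)) \<Longrightarrow> ?thesis"
    by (simp only: pt_bool_if pt_bool)
qed

lemma pt_disj: "pt (\<lambda>c. bv (P c)) \<Longrightarrow> pt (\<lambda>c. bv (Q c)) \<Longrightarrow> pt (\<lambda>c. bv (P c \<or> Q c))"
proof -
  have "(P \<or> Q) = (if P then True else Q)" for P Q by simp
  then show "pt (\<lambda>c. bv (P c)) \<Longrightarrow> pt (\<lambda>c. bv (Q c)) \<Longrightarrow> ?thesis"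
    by (simp only: pt_bool_if pt_bool)
qed

lemma pt_not: "pt (\<lambda>c. bv (P c)) \<Longrightarrow> pt (\<lambda>c. bv (\<not> P c))"
proof -
  have "(\<not> P) = (if P then False else True)" for P by simp
  then show "pt (\<lambda>c. bv (P c)) \<Longrightarrow> ?thesis"
    by (simp only: pt_bool_if pt_bool)
qed

lemma pt_less: "pt (\<lambda>c. Num (f c)) \<Longrightarrow> pt (\<lambda>c. Num (g c)) \<Longrightarrow> pt (\<lambda>c. bv (f c < g c))"
  using pt_binop[of "\<lambda>c. Num (f c)" "\<lambda>c. Num (g c)" Less] by (simp add: bv_def)

lemma pt_le: "pt (\<lambda>c. Num (f c)) \<Longrightarrow> pt (\<lambda>c. Num (g c)) \<Longrightarrow> pt (\<lambda>c. bv (f c \<le> g c))"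
  using pt_not[OF pt_less[of g f]] by (simp add: not_less)

lemma pt_eq: "pt (\<lambda>c. Num (f c)) \<Longrightarrow> pt (\<lambda>c. Num (g c)) \<Longrightarrow> pt (\<lambda>c. bv (f c = g c))"
  using pt_conj[OF pt_le[of f g] pt_le[of g f]] by (simp add: order_eq_iff)

lemma pt_numv: "pt f \<Longrightarrow> pt (\<lambda>c. Num (numv (f c)))"
proof -
  \<comment> \<open>Adding zero coerces a value to an integer: an ill-typed addition yields
    \<open>Num 0\<close>, which is the default of \<open>numv\<close>.\<close>
  have "binop_val Add v (Num 0) = Num (numv v)" for v by (cases v) auto
  then show "pt f \<Longrightarrow> ?thesis" using pt_binop[OF _ pt_num, of f Add 0] by simp
qed

lemma pt_add: "pt (\<lambda>c. Num (f c)) \<Longrightarrow> pt (\<lambda>c. Num (g c)) \<Longrightarrow> pt (\<lambda>c. Num (f c + g c))"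
  and pt_mult: "pt (\<lambda>c. Num (f c)) \<Longrightarrow> pt (\<lambda>c. Num (g c)) \<Longrightarrow> pt (\<lambda>c. Num (f c * g c))"
  and pt_div: "pt (\<lambda>c. Num (f c)) \<Longrightarrow> pt (\<lambda>c. Num (g c)) \<Longrightarrow> pt (\<lambda>c. Num (f c div g c))"
  and pt_minus: "pt (\<lambda>c. Num (g c)) \<Longrightarrow> pt (\<lambda>c. Num (- g c))"
  using pt_binop[of "\<lambda>c. Num (f c)" "\<lambda>c. Num (g c)" Add]
    pt_binop[of "\<lambda>c. Num (f c)" "\<lambda>c. Num (g c)" Mul]
    pt_binop[of "\<lambda>c. Num (f c)" "\<lambda>c. Num (g c)" Div]
    pt_binop[OF pt_num, of "\<lambda>c. Num (g c)" Sub 0] by simp_all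

lemma pt_comp2:
  assumes "pt (\<lambda>t. F (hd_val t) (tl_val t))" "pt f" "pt g"
  shows "pt (\<lambda>c. F (f c) (g c))"
  using pt_comp[OF assms(1) pt_Cell[OF assms(2,3)]] by simp

text \<open>Decoding forgets the leaf at the end of the list, so encoding again is not the identity
  and has to be computed. The result is no larger than the original, since \<open>Num 0\<close> is a
  smallest leaf.\<close>

lemma pt_list_dec:
  assumes "pt f" shows "pt (\<lambda>c. enc_list (dec_list (f c)))"
proof -
  have "enc_list xs = foldr Cell xs (Num 0)" for xs by (induction xs) auto
  moreover have "pt (\<lambda>c. foldr (\<lambda>x r. Cell x r) (dec_list (f c)) (Num 0))"
  proof (rule pt_foldr_bounded)
    have "vsize (foldr Cell ys (Num 0)) \<le> vsize v" if "dec_list v = zs @ ys" for v zs ys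
      using that
    proof (induction v arbitrary: zs ys)
      case (Cell a b)
      note IH = Cell.IH(2)
      show ?case
      proof (cases zs)
        case Nil
        then have "ys = a # dec_list b" using Cell.prems by simp
        then show ?thesis using IH[of "[]" "dec_list b"] by simp
      next
        case (Cons z zs')
        then show ?thesis using IH[of zs' ys] Cell.prems by simp
      qed
    qed simp
    then show "\<exists>pB. \<forall>c zs ys. dec_list (f c) = zs @ ys \<longrightarrow>
        vsize (foldr (\<lambda>x r. Cell x r) ys (Num 0)) \<le> poly pB (vsize c)"
      using pt_vsize[OF assms] by (meson le_trans)
  qed (intro pt_Cell pt_hd pt_tl pt_id pt_num assms)+
  ultimately show ?thesis by simp
qed

lemma pt_map:
  assumes F: "pt (\<lambda>t. F (hd_val t) (tl_val t))" and L: "pt (\<lambda>c. enc_list (L c))"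
  shows "pt (\<lambda>c. enc_list (map (\<lambda>x. F x c) (L c)))"
proof -
  obtain p where p: "\<And>x. vsize (F (hd_val x) (tl_val x)) \<le> poly p (vsize x)"
    using pt_vsize[OF F] by blast
  have "enc_list (map f xs) = foldr (\<lambda>x r. Cell (f x) r) xs (Num 0)" for f and xs :: "val list"
    by (induction xs) auto
  moreover have "pt (\<lambda>c. foldr (\<lambda>x r. Cell (F x c) r) (L c) (Num 0))"
  proof (rule pt_foldr_add)
    show "pt (\<lambda>t. Cell (F (hd_val t) (tl_val (tl_val t))) (hd_val (tl_val t)))"
      by (intro pt_Cell pt_comp2[OF F] pt_hd pt_tl pt_id)
    have "vsize (Cell (F x c) r) \<le> vsize r + poly (pcompose p [:1, 1:] + [:1:]) (vsize x + vsize c)" for x r c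
      using p[of "Cell x c"] by (simp add: poly_pcompose)
    then show "\<exists>q. \<forall>x r c. vsize (Cell (F x c) r) \<le> vsize r + poly q (vsize x + vsize c)" by blast
  qed (intro L pt_num)+
  ultimately show ?thesis by simp
qed

lemma pt_filter:
  assumes P: "pt (\<lambda>t. bv (P (hd_val t) (tl_val t)))" and L: "pt (\<lambda>c. enc_list (L c))"
  shows "pt (\<lambda>c. enc_list (filter (\<lambda>x. P x c) (L c)))"
proof -
  have "enc_list (filter P xs) = foldr (\<lambda>x r. if P x then Cell x r else r) xs (Num 0)" for P xs
    by (induction xs) auto
  moreover have "pt (\<lambda>c. foldr (\<lambda>x r. if P x c then Cell x r else r) (L c) (Num 0))"
  proof (rule pt_foldr_add)
    show "pt (\<lambda>t. if P (hd_val t) (tl_val (tl_val t)) then Cell (hd_val t) (hd_val (tl_val t))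
        else hd_val (tl_val t))"
      by (intro pt_if pt_Cell pt_comp2[OF P] pt_hd pt_tl pt_id)
    show "\<exists>q. \<forall>x r c. vsize (if P x c then Cell x r else r) \<le> vsize r + poly q (vsize x + vsize c)"
      by (rule exI[of _ "[:1, 1:]"]) auto
  qed (intro L pt_num)+
  ultimately show ?thesis by simp
qed

lemma pt_bex:
  assumes P: "pt (\<lambda>t. bv (P (hd_val t) (tl_val t)))" and L: "pt (\<lambda>c. enc_list (L c))"
  shows "pt (\<lambda>c. bv (\<exists>x\<in>set (L c). P x c))"
proof -
  have eq: "bv (\<exists>x\<in>set xs. P x) = foldr (\<lambda>x r. if P x then bv True else r) xs (bv False)" for P xs
    by (induction xs) (auto simp: bv_def)
  have "pt (\<lambda>c. foldr (\<lambda>x r. if P x c then bv True else r) (L c) (bv False))"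
  proof (rule pt_foldr_add)
    show "pt (\<lambda>t. if P (hd_val t) (tl_val (tl_val t)) then bv True else hd_val (tl_val t))"
      by (intro pt_if pt_bool pt_comp2[OF P] pt_hd pt_tl pt_id)
    show "\<exists>q. \<forall>x r c. vsize (if P x c then bv True else r) \<le> vsize r + poly q (vsize x + vsize c)"
      by (rule exI[of _ "[:2:]"]) (auto simp: bv_def)
  qed (intro L pt_bool)+
  then show ?thesis by (simp only: eq)
qed

lemma pt_ball:
  assumes P: "pt (\<lambda>t. bv (P (hd_val t) (tl_val t)))" and L: "pt (\<lambda>c. enc_list (L c))"
  shows "pt (\<lambda>c. bv (\<forall>x\<in>set (L c). P x c))"
  using pt_not[OF pt_bex[OF pt_not[OF P] L]] by simp

lemma pt_foldr_binop:
  assumes F: "pt (\<lambda>t. Num (F (hd_val t) (tl_val t)))" and L: "pt (\<lambda>c. enc_list (L c))"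
  shows "pt (\<lambda>c. foldr (\<lambda>x r. binop_val b (Num (F x c)) r) (L c) (Num i))"
proof (rule pt_foldr_add)
  obtain p where p: "\<And>x. vsize (Num (F (hd_val x) (tl_val x))) \<le> poly p (vsize x)"
    using pt_vsize[OF F] by blast
  show "pt (\<lambda>t. binop_val b (Num (F (hd_val t) (tl_val (tl_val t)))) (hd_val (tl_val t)))"
    by (intro pt_binop pt_comp2[of "\<lambda>x c. Num (F x c)", OF F] pt_hd pt_tl pt_id)
  have "vsize (binop_val b (Num (F x c)) r) \<le>
      vsize r + poly (pcompose p [:1, 1:] + [:1:]) (vsize x + vsize c)" for x r c
    using vsize_binop[of b "Num (F x c)" r] p[of "Cell x c"] by (simp add: poly_pcompose)
  then show "\<exists>q. \<forall>x r c. vsize (binop_val b (Num (F x c)) r) \<le> vsize r + poly q (vsize x + vsize c)"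
    by blast
qed (intro L pt_num)+

lemma pt_sum_list:
  assumes "pt (\<lambda>t. Num (F (hd_val t) (tl_val t)))" "pt (\<lambda>c. enc_list (L c))"
  shows "pt (\<lambda>c. Num (sum_list (map (\<lambda>x. F x c) (L c))))"
proof -
  have "foldr (\<lambda>x r. binop_val Add (Num (f x)) r) xs (Num 0) = Num (sum_list (map f xs))"
    for f and xs :: "val list" by (induction xs) auto
  then show ?thesis using pt_foldr_binop[OF assms, of Add 0] by simp
qed

lemma pt_prod_list:
  assumes "pt (\<lambda>t. Num (F (hd_val t) (tl_val t)))" "pt (\<lambda>c. enc_list (L c))"
  shows "pt (\<lambda>c. Num (prod_list (map (\<lambda>x. F x c) (L c))))"
proof -
  have "foldr (\<lambda>x r. binop_val Mul (Num (f x)) r) xs (Num 1) = Num (prod_list (map f xs))"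
    for f and xs :: "val list" by (induction xs) auto
  then show ?thesis using pt_foldr_binop[OF assms, of Mul 1] by simp
qed

lemma pt_length: "pt (\<lambda>c. enc_list (L c)) \<Longrightarrow> pt (\<lambda>c. Num (int (length (L c))))"
  using pt_sum_list[of "\<lambda>x c. 1" L, OF pt_num] by (simp add: sum_list_triv)

lemma pt_Nil: "pt (\<lambda>c. enc_list [])"
  by (simp add: pt_num)

lemma pt_Cons: "pt f \<Longrightarrow> pt (\<lambda>c. enc_list (L c)) \<Longrightarrow> pt (\<lambda>c. enc_list (f c # L c))"
  by (simp add: pt_Cell)

lemma pt_append_val:
  assumes "pt (\<lambda>c. enc_list (L c))" "pt A"
  shows "pt (\<lambda>c. foldr (\<lambda>x r. Cell x r) (L c) (A c))"
proof (rule pt_foldr_add)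
  show "\<exists>q. \<forall>x r c. vsize (Cell x r) \<le> vsize r + poly q (vsize x + vsize c)"
    by (rule exI[of _ "[:1, 1:]"]) auto
qed (intro assms pt_Cell pt_hd pt_tl pt_id)+

lemma foldr_Cell_enc_list: "foldr Cell xs (enc_list ys) = enc_list (xs @ ys)"
  by (induction xs) auto

lemma vsize_foldr_Cell: "vsize (foldr Cell xs r) \<le> vsize r + vsize (enc_list xs)"
  by (induction xs) auto

lemma pt_concat_map:
  assumes F: "pt (\<lambda>t. enc_list (F (hd_val t) (tl_val t)))" and L: "pt (\<lambda>c. enc_list (L c))"
  shows "pt (\<lambda>c. enc_list (concat (map (\<lambda>x. F x c) (L c))))"
proof -
  obtain p where p: "\<And>x. vsize (enc_list (F (hd_val x) (tl_val x))) \<le> poly p (vsize x)"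
    using pt_vsize[OF F] by blast
  have "enc_list (concat (map f xs)) = foldr (\<lambda>x r. foldr Cell (f x) r) xs (Num 0)" for f and xs :: "val list"
    by (induction xs) (auto simp flip: foldr_Cell_enc_list)
  moreover have "pt (\<lambda>c. foldr (\<lambda>x r. foldr Cell (F x c) r) (L c) (Num 0))"
  proof (rule pt_foldr_add)
    show "pt (\<lambda>t. foldr Cell (F (hd_val t) (tl_val (tl_val t))) (hd_val (tl_val t)))"
      by (intro pt_append_val pt_comp2[of "\<lambda>x c. enc_list (F x c)", OF F] pt_hd pt_tl pt_id)
    have "vsize (foldr Cell (F x c) r) \<le> vsize r + poly (pcompose p [:1, 1:]) (vsize x + vsize c)" for x r c
      using vsize_foldr_Cell[of "F x c" r] p[of "Cell x c"] by (simp add: poly_pcompose)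
    then show "\<exists>q. \<forall>x r c. vsize (foldr Cell (F x c) r) \<le> vsize r + poly q (vsize x + vsize c)" by blast
  qed (intro L pt_num)+
  ultimately show ?thesis by simp
qed

lemma pt_is_Nil:
  assumes "pt (\<lambda>c. enc_list (L c))"
  shows "pt (\<lambda>c. bv (L c = []))"
  using pt_eq[OF pt_length[OF assms] pt_num[of 0]] by simp

lemma pt_take_1:
  assumes "pt (\<lambda>c. enc_list (L c))"
  shows "pt (\<lambda>c. enc_list (take 1 (L c)))"
proof -
  have "enc_list (take 1 xs) = (if xs = [] then Num 0 else Cell (hd_val (enc_list xs)) (Num 0))" for xs
    by (cases xs) auto
  then show ?thesis
    using assms by (simp add: pt_if pt_Cell pt_num pt_is_Nil pt_hd)
qed

section \<open>Weighted matroid intersection\<close>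

locale matroid =
  fixes E :: "'a set" and indep :: "'a set \<Rightarrow> bool"
  assumes finite_E: "finite E"
    and indep_subset: "indep A \<Longrightarrow> A \<subseteq> E"
    and indep_empty: "indep {}"
    and indep_mono: "indep B \<Longrightarrow> A \<subseteq> B \<Longrightarrow> indep A"
    and indep_exchange: "indep A \<Longrightarrow> indep B \<Longrightarrow> card A < card B \<Longrightarrow> \<exists>x\<in>B - A. indep (insert x A)"
begin

lemma indep_finite: "indep A \<Longrightarrow> finite A"
  using indep_subset finite_E finite_subset by blast

lemma indep_extend:
  assumes "indep A" "indep B" "card A \<le> card B"
  shows "\<exists>C. A \<subseteq> C \<and> C \<subseteq> A \<union> B \<and> card C = card B \<and> indep C"
  using assms
proof (induction "card B - card A" arbitrary: A)
  case 0
  then show ?case by (intro exI[of _ A]) auto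
next
  case (Suc n)
  then have "card A < card B" by simp
  then obtain x where x: "x \<in> B - A" "indep (insert x A)"
    using indep_exchange[OF Suc.prems(1,2)] by blast
  have "card (insert x A) = Suc (card A)"
    using x indep_finite[OF Suc.prems(1)] by simp
  then have "\<exists>C. insert x A \<subseteq> C \<and> C \<subseteq> insert x A \<union> B \<and> card C = card B \<and> indep C"
    using Suc x by (intro Suc.hyps(1)) auto
  then show ?case using x by blast
qed

text \<open>This turns out to be the same as minimum weight among the independent sets of equal
  size. The form with single exchanges can be checked arc by arc in the exchange graph.\<close>

definition locally_optimal :: "('a \<Rightarrow> int) \<Rightarrow> 'a set \<Rightarrow> bool" where
  "locally_optimal u I \<longleftrightarrow> indep I \<and>
     (\<forall>y\<in>I. \<forall>x\<in>E - I. indep (insert x (I - {y})) \<longrightarrow> u y \<le> u x)"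

lemma locally_optimal_indep: "locally_optimal u I \<Longrightarrow> indep I"
  by (simp add: locally_optimal_def)

text \<open>Remove a heaviest \<open>y\<close> from \<open>I\<close>. Exchanging
  \<open>I - {y}\<close> with \<open>J\<close> yields an element of \<open>J\<close> at least as
  heavy as \<open>y\<close>, which is removed from \<open>J\<close>. The rest of \<open>I\<close> is
  again locally optimal: a swap of \<open>z\<close> for \<open>x\<close> in it can be enlarged by
  \<open>y\<close> or by \<open>z\<close> to a swap in \<open>I\<close>, and in the latter case the
  choice of \<open>y\<close> as heaviest helps.\<close>

lemma locally_optimal_le:
  assumes "locally_optimal u I" "indep J" "card J = card I"
  shows "sum u I \<le> sum u J"
  using assms
proof (induction "card I" arbitrary: I J)
  case 0
  then have "I = {}" "J = {}"
    using indep_finite locally_optimal_indep by auto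
  then show ?case by simp
next
  case (Suc n)
  have I: "indep I" "finite I" "I \<noteq> {}" and J: "finite J" "J \<noteq> {}"
    using Suc indep_finite locally_optimal_indep by auto
  obtain y where y: "y \<in> I" "\<And>z. z \<in> I \<Longrightarrow> u z \<le> u y"
    using I Max_in[of "u ` I"] Max_ge[of "u ` I"] by fastforce
  have cards: "card (I - {y}) = n" using y Suc.hyps(2) I by simp
  have I': "indep (I - {y})" using I(1) indep_mono by blast
  obtain x where x: "x \<in> J" "u y \<le> u x"
  proof (rule ccontr)
    assume *: "\<not> thesis"
    obtain x where x: "x \<in> J - (I - {y})" "indep (insert x (I - {y}))"
      using indep_exchange[OF I' Suc.prems(2)] cards Suc by auto
    then have "x \<noteq> y" using * that by auto
    then have "x \<in> E - I" using x indep_subset[OF Suc.prems(2)] by auto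
    then have "u y \<le> u x" using Suc.prems(1) x y unfolding locally_optimal_def by blast
    then show False using x that * by blast
  qed
  have "locally_optimal u (I - {y})"
    unfolding locally_optimal_def
  proof (intro conjI ballI impI)
    fix z x assume z: "z \<in> I - {y}" and x: "x \<in> E - (I - {y})" and ind: "indep (insert x (I - {y} - {z}))"
    show "u z \<le> u x"
    proof (cases "x = y")
      case True
      then show ?thesis using y z by auto
    next
      case False
      then have xI: "x \<in> E - I" using x by auto
      let ?A = "insert x (I - {y} - {z})"
      have "card (I - {y}) = Suc (card (I - {y} - {z}))"
        using I(2) z by (intro card.remove) auto
      then have "card ?A = n" using xI I(2) cards by simp
      then obtain w where w: "w \<in> I - ?A" "indep (insert w ?A)"
        using indep_exchange[OF ind I(1)] Suc.hyps(2) by auto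
      then have "w = y \<or> w = z" using xI by auto
      then have "insert w ?A = insert x (I - {z}) \<or> insert w ?A = insert x (I - {y})"
        using y z xI by auto
      then have "u z \<le> u x \<or> u y \<le> u x"
        using Suc.prems(1) w(2) xI y z unfolding locally_optimal_def by (metis DiffD1)
      then show ?thesis using y(2)[of z] z by auto
    qed
  qed (rule I')
  then have "sum u (I - {y}) \<le> sum u (J - {x})"
    using cards Suc x J indep_mono[of J "J - {x}"] by (intro Suc.hyps(1)) auto
  then show ?case
    using x y I J by (simp add: sum_diff1)
qed

lemma minimal_locally_optimal:
  assumes I: "indep I" and min: "\<And>J. indep J \<Longrightarrow> card J = card I \<Longrightarrow> sum u I \<le> sum u J"
  shows "locally_optimal u I"
  unfolding locally_optimal_def
proof (intro conjI ballI impI)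
  fix y x assume "y \<in> I" "x \<in> E - I" and ind: "indep (insert x (I - {y}))"
  then have *: "card (insert x (I - {y})) = card I" "sum u (insert x (I - {y})) = sum u I - u y + u x"
    using indep_finite[OF I] by (auto simp: sum_diff1 card.remove[of I y] simp del: card_Diff_insert)
  show "u y \<le> u x" using min[OF ind *(1)] *(2) by simp
qed (rule I)

text \<open>Exchange yields \<open>x\<close> in \<open>J\<close> that can be added to
  \<open>I\<close>, and \<open>J - {x}\<close> has the size of \<open>I\<close>. This is the lower
  bound that an augmentation has to attain.\<close>

lemma locally_optimal_augment_le:
  assumes I: "locally_optimal u I" and J: "indep J" "card J = Suc (card I)"
    and m: "\<And>x. x \<in> E - I \<Longrightarrow> indep (insert x I) \<Longrightarrow> m \<le> u x"
  shows "sum u I + m \<le> sum u J"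
proof -
  obtain x where x: "x \<in> J - I" "indep (insert x I)"
    using indep_exchange[OF locally_optimal_indep[OF I] J(1)] J(2) by auto
  have "sum u I \<le> sum u (J - {x})"
    using x J indep_finite[OF J(1)] indep_mono[OF J(1), of "J - {x}"]
    by (intro locally_optimal_le[OF I]) auto
  moreover have "m \<le> u x" using x m indep_subset[OF J(1)] by auto
  ultimately show ?thesis
    using x indep_finite[OF J(1)] by (simp add: sum_diff1)
qed

text \<open>If \<open>B\<close> spans \<open>C - {x}\<close>, then
  \<open>B \<union> (C - {x})\<close> has rank \<open>card B\<close> and \<open>C - {x}\<close>
  extends to a basis \<open>K\<close> of it. The larger set \<open>insert x B\<close> enlarges
  \<open>K\<close> by some element: \<open>x\<close> would complete the circuit \<open>C\<close>,
  and any other element would exceed the rank.\<close>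

lemma spanned_circuit:
  assumes B: "indep B" "indep (insert x B)" "x \<notin> B"
    and C: "x \<in> C" "\<not> indep C" "indep (C - {x})"
    and span: "\<And>z. z \<in> C - {x} \<Longrightarrow> z \<notin> B \<Longrightarrow> \<not> indep (insert z B)"
  shows False
proof -
  have rank: "card D \<le> card B" if D: "indep D" "D \<subseteq> B \<union> (C - {x})" for D
  proof (rule ccontr)
    assume "\<not> ?thesis"
    then obtain z where "z \<in> D - B" "indep (insert z B)"
      using indep_exchange[OF B(1) D(1)] by auto
    then show False using span[of z] D(2) by auto
  qed
  obtain K where K: "C - {x} \<subseteq> K" "K \<subseteq> (C - {x}) \<union> B" "card K = card B" "indep K"
    using indep_extend[OF C(3) B(1) rank] C(3) by auto
  have "card K < card (insert x B)"
    using K(3) B indep_finite by simp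
  then obtain b where b: "b \<in> insert x B - K" "indep (insert b K)"
    using indep_exchange[OF K(4) B(2)] by auto
  have "b \<noteq> x" using b(2) C K(1) indep_mono[of "insert x K" C] by auto
  then have "card (insert b K) \<le> card B"
    using b K by (intro rank) auto
  then show False using b K(3) indep_finite[OF K(4)] by simp
qed

lemma minimal_dependent:
  assumes "finite J" "\<not> indep J"
  shows "\<exists>C\<subseteq>J. \<not> indep C \<and> (\<forall>x\<in>C. indep (C - {x}))"
  using assms
proof (induction rule: finite_psubset_induct)
  case (psubset J)
  show ?case
  proof (cases "\<forall>x\<in>J. indep (J - {x})")
    case False
    then obtain x where "x \<in> J" "\<not> indep (J - {x})" by blast
    then show ?thesis using psubset.IH[of "J - {x}"] by blast
  qed (use psubset.prems in blast)
qed

text \<open>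
  Order the exchange pairs by decreasing weight and then by index. If the new set contained a
  circuit, then all elements of the circuit but the first new one would be spanned by \<open>I\<close>
  without the partner of that one.
\<close>

lemma augment:
  fixes x y :: "nat \<Rightarrow> 'a"
  assumes I: "locally_optimal u I"
    and x: "\<And>i. i \<le> s \<Longrightarrow> x i \<in> E - I" "inj_on x {..s}"
    and y: "\<And>i. i \<in> {1..s} \<Longrightarrow> y i \<in> I" "inj_on y {1..s}"
    and src: "indep (insert (x 0) I)" "\<And>z. z \<in> E - I \<Longrightarrow> indep (insert z I) \<Longrightarrow> u (x 0) \<le> u z"
    and arc: "\<And>i. i \<in> {1..s} \<Longrightarrow> indep (insert (x i) (I - {y i})) \<and> u (x i) = u (y i)"
    and no_arc: "\<And>i j. i \<in> {1..s} \<Longrightarrow> j \<in> {1..s} \<Longrightarrow> i < j \<Longrightarrow> u (x j) = u (y i) \<Longrightarrow>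
       \<not> indep (insert (x j) (I - {y i}))"
    and no_src: "\<And>j. j \<in> {1..s} \<Longrightarrow> u (x j) = u (x 0) \<Longrightarrow> \<not> indep (insert (x j) I)"
  shows "locally_optimal u ((I - y ` {1..s}) \<union> x ` {..s}) \<and>
    card ((I - y ` {1..s}) \<union> x ` {..s}) = Suc (card I)"
proof -
  let ?J = "(I - y ` {1..s}) \<union> x ` {..s}"
  have ind: "indep I" and fin: "finite I" using I locally_optimal_indep indep_finite by auto
  have opt: "u z \<le> u v" if "z \<in> I" "v \<in> E - I" "indep (insert v (I - {z}))" for z v
    using I that unfolding locally_optimal_def by blast
  have src_max: "u z \<le> u (x 0)" if "z \<in> I" for z
    using that by (intro opt x indep_mono[OF src(1)]) auto
  have yI: "y ` {1..s} \<subseteq> I" using y by auto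
  have xI: "x ` {..s} \<inter> I = {}" using x by auto
  have indep: "indep ?J"
  proof (rule ccontr)
    assume "\<not> indep ?J"
    then obtain C where C: "C \<subseteq> ?J" "\<not> indep C" "\<And>z. z \<in> C \<Longrightarrow> indep (C - {z})"
      using minimal_dependent[of ?J] fin by blast
    define D where "D = {j \<in> {..s}. x j \<in> C}"
    have D: "j \<in> D \<longleftrightarrow> j \<le> s \<and> x j \<in> C" for j by (simp add: D_def)
    have "finite D" by (simp add: D_def)
    have "D \<noteq> {}"
    proof
      assume "D = {}"
      then have "C \<subseteq> I" using C(1) D by blast
      then show False using C(2) ind indep_mono by blast
    qed
    have others: "z \<in> I - y ` {1..s} \<or> (\<exists>j\<in>D. z = x j)" if "z \<in> C" for z
    proof -
      have "z \<in> I - y ` {1..s} \<or> z \<in> x ` {..s}" using C(1) that by blast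
      then show ?thesis
      proof
        assume "z \<in> x ` {..s}"
        then obtain j where j: "j \<le> s" "z = x j" by blast
        then have "j \<in> D" using that D by simp
        then show ?thesis using j(2) by (intro disjI2 bexI[of _ j])
      qed (rule disjI1)
    qed
    show False
    proof (cases "x 0 \<in> C")
      \<comment> \<open>Here \<open>I\<close> spans all other elements of the circuit. An
        \<open>x j\<close> outside the span would be a source of weight at most
        \<open>u (x 0)\<close>, since it weighs as much as its partner in \<open>I\<close>; hence it
        would tie with \<open>x 0\<close>, against \<open>no_src\<close>.\<close>
      case True
      show False
      proof (rule spanned_circuit[of I "x 0" C])
        fix z assume z: "z \<in> C - {x 0}" "z \<notin> I"
        then obtain j where "j \<in> D" "z = x j" using others[of z] by blast
        then have "j \<le> s" "j \<noteq> 0" "z = x j" using z(1) D by (simp, metis DiffE insertI1, simp)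
        then have j: "j \<in> {1..s}" "z = x j" by simp_all
        show "\<not> indep (insert z I)"
        proof
          assume i: "indep (insert z I)"
          have "u (x j) \<le> u (x 0)" using arc[OF j(1)] src_max[OF y(1)[OF j(1)]] by simp
          moreover have "u (x 0) \<le> u (x j)" using src(2)[of z] i j x(1)[of j] by simp
          ultimately show False using no_src[OF j(1)] i j(2) by simp
        qed
      qed (use True C(2) C(3)[OF True] ind src(1) x(1)[of 0] in simp_all)
    next
      case False
      \<comment> \<open>If another new element \<open>x j\<close> of the circuit could replace
        \<open>y i\<close>, then \<open>u (y i) \<le> u (x j) \<le> M\<close> by local optimality,
        and \<open>M = u (y i)\<close>. The weights tie, so \<open>i < j\<close> by the choice of
        \<open>i\<close>, and \<open>no_arc\<close> applies.\<close>
      define M where "M = Max (u ` x ` D)"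
      define i where "i = (LEAST i. i \<in> D \<and> u (x i) = M)"
      have "M \<in> u ` x ` D" unfolding M_def using \<open>D \<noteq> {}\<close> \<open>finite D\<close> by (intro Max_in) auto
      then have ex: "\<exists>i. i \<in> D \<and> u (x i) = M" by blast
      have i: "i \<in> D" "u (x i) = M" using LeastI_ex[OF ex] unfolding i_def by auto
      have min: "i < j" if "j \<in> D" "u (x j) = M" "j \<noteq> i" for j
        using Least_le[of "\<lambda>i. i \<in> D \<and> u (x i) = M" j] that unfolding i_def by auto
      have Max: "u (x j) \<le> M" if "j \<in> D" for j unfolding M_def
        using that \<open>finite D\<close> by (intro Max_ge) auto
      have pos: "j \<in> {1..s}" if "j \<in> D" for j
        using that False D[of j] by (cases j) auto
      have i1: "i \<in> {1..s}" using pos i(1) by blast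
      show False
      proof (rule spanned_circuit[of "I - {y i}" "x i" C])
        fix z assume z: "z \<in> C - {x i}" "z \<notin> I - {y i}"
        then obtain j where j: "j \<in> D" "z = x j" "j \<noteq> i"
        proof -
          from others[of z] z consider "z \<in> I - y ` {1..s}" | j where "j \<in> D" "z = x j" by blast
          then show thesis
          proof cases
            case 1
            then have "z \<in> I - {y i}" using i1 by blast
            then show thesis using z(2) by blast
          next
            case 2
            then show thesis using that z(1) by blast
          qed
        qed
        have j1: "j \<in> {1..s}" using pos j by blast
        show "\<not> indep (insert z (I - {y i}))"
        proof
          assume ind: "indep (insert z (I - {y i}))"
          have "u (y i) \<le> u z" using ind j(2) x(1)[of j] j1 y i1 by (intro opt) auto
          then have M: "u (x j) = M" using Max[OF j(1)] arc[OF i1] i(2) j(2) by simp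
          then have "i < j" using min j by blast
          then show False using no_arc[OF i1 j1] ind M i(2) arc[OF i1] j(2) by simp
        qed
      qed (use i(1) D C(2) C(3)[of "x i"] indep_mono[OF ind Diff_subset, of "{y i}"] arc[OF i1]
          x(1)[of i] i1 in simp_all)
    qed
  qed
  have card_y: "card (I - y ` {1..s}) + s = card I"
    using card_Diff_subset[OF _ yI] card_mono[OF fin yI] card_image[OF y(2)] by simp
  have "card ?J = card (I - y ` {1..s}) + card (x ` {..s})"
    using fin xI by (intro card_Un_disjoint) auto
  then have card: "card ?J = Suc (card I)"
    using card_y card_image[OF x(2)] by simp
  have "sum u ?J = sum u (I - y ` {1..s}) + sum u (x ` {..s})"
    using fin xI by (intro sum.union_disjoint) auto
  also have "sum u (I - y ` {1..s}) = sum u I - sum u (y ` {1..s})"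
    using fin yI by (simp add: sum_diff)
  also have "sum u (y ` {1..s}) = (\<Sum>i\<in>{1..s}. u (x i))"
    unfolding sum.reindex[OF y(2)] o_def using arc by (intro sum.cong) auto
  also have "sum u (x ` {..s}) = u (x 0) + (\<Sum>i\<in>{1..s}. u (x i))"
  proof -
    have "{..s} = insert 0 {1..s}" by auto
    then have "(\<Sum>i\<in>{..s}. u (x i)) = u (x 0) + (\<Sum>i\<in>{1..s}. u (x i))" by simp
    then show ?thesis unfolding sum.reindex[OF x(2)] o_def .
  qed
  finally have sum: "sum u ?J = sum u I + u (x 0)" by simp
  \<comment> \<open>The new set weighs \<open>sum u I + u (x 0)\<close>, where
    \<open>u (x 0)\<close> is the least weight of a source. So it attains the lower bound for
    independent sets of its size.\<close>
  have "locally_optimal u ?J"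
  proof (rule minimal_locally_optimal[OF indep])
    fix J assume "indep J" "card J = card ?J"
    then show "sum u ?J \<le> sum u J"
      unfolding sum card by (intro locally_optimal_augment_le[OF I _ _ src(2)])
  qed
  then show ?thesis using card by blast
qed

end

text \<open>Walks are listed from their end to their start, as the algorithm builds them.\<close>

definition is_walk :: "('a \<Rightarrow> 'a \<Rightarrow> bool) \<Rightarrow> 'a set \<Rightarrow> 'a set \<Rightarrow> 'a list \<Rightarrow> bool" where
  "is_walk R A B p \<longleftrightarrow> p \<noteq> [] \<and> hd p \<in> B \<and> last p \<in> A \<and> successively (\<lambda>v u. R u v) p"

lemma successively_nthD:
  "successively P p \<Longrightarrow> Suc i < length p \<Longrightarrow> P (p ! i) (p ! Suc i)"
  by (induction P p arbitrary: i rule: successively.induct) (auto simp: nth_Cons split: nat.splits)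

context
  fixes R :: "'a \<Rightarrow> 'a \<Rightarrow> bool" and A B :: "'a set" and p :: "'a list"
  assumes p: "is_walk R A B p" and min: "\<And>q. is_walk R A B q \<Longrightarrow> length p \<le> length q"
begin

text \<open>Indices run against the direction of the walk, so an arc from \<open>p ! j\<close> to
  \<open>p ! i\<close> jumps ahead. Cutting out the elements in between would shorten the walk
  unless there are none.\<close>

lemma shortest_walk_no_shortcut:
  assumes "i < j" "j < length p" "R (p ! j) (p ! i)"
  shows "j = Suc i"
proof (rule ccontr)
  assume "j \<noteq> Suc i"
  let ?q = "take (Suc i) p @ drop j p"
  let ?P = "\<lambda>v u. R u v"
  have "successively ?P (take (Suc i) p @ drop (Suc i) p)" "successively ?P (take j p @ drop j p)"
    using p by (simp_all add: is_walk_def)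
  then have "successively ?P (take (Suc i) p)" "successively ?P (drop j p)"
    unfolding successively_append_iff by simp_all
  moreover have "last (take (Suc i) p) = p ! i"
    using assms by (simp add: take_Suc_conv_app_nth)
  ultimately have "successively ?P ?q"
    using assms by (simp add: successively_append_iff hd_drop_conv_nth)
  then have "is_walk R A B ?q"
    using p assms unfolding is_walk_def by (auto simp: hd_append)
  from min[OF this] show False using assms \<open>j \<noteq> Suc i\<close> by simp
qed

lemma shortest_walk_distinct: "distinct p"
  unfolding distinct_conv_nth
proof (intro allI impI)
  have no: False if ij: "i < j" "j < length p" "p ! i = p ! j" for i j
  proof -
    let ?q = "take (Suc i) p @ drop (Suc j) p"
    let ?P = "\<lambda>v u. R u v"
    have "successively ?P (take (Suc i) p @ drop (Suc i) p)" "successively ?P (take j p @ drop j p)"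
      using p by (simp_all add: is_walk_def)
    then have "successively ?P (take (Suc i) p)" "successively ?P (p ! j # drop (Suc j) p)"
      unfolding successively_append_iff using ij by (simp_all add: Cons_nth_drop_Suc)
    then have "successively ?P ?q"
      using ij by (auto simp: successively_append_iff successively_Cons take_Suc_conv_app_nth)
    moreover have "last ?q = last p"
    proof (cases "Suc j < length p")
      case False
      then have "p ! j = last p" using ij by (metis Suc_lessI diff_Suc_1 last_conv_nth list.size(3) not_less_zero)
      then show ?thesis using False ij by (simp add: take_Suc_conv_app_nth)
    qed simp
    ultimately have "is_walk R A B ?q"
      using p ij unfolding is_walk_def by (auto simp: hd_append)
    from min[OF this] show False using ij by simp
  qed
  fix i j assume "i < length p" "j < length p" "i \<noteq> j"
  then show "p ! i \<noteq> p ! j" using no[of i j] no[of j i] by (metis linorder_neqE_nat)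
qed

lemma shortest_walk_end_unique:
  assumes "0 < i" "i < length p"
  shows "p ! i \<notin> B"
proof
  assume "p ! i \<in> B"
  have "successively (\<lambda>v u. R u v) (take i p @ drop i p)"
    using p by (simp add: is_walk_def)
  then have "is_walk R A B (drop i p)"
    using p assms \<open>p ! i \<in> B\<close> unfolding is_walk_def successively_append_iff
    by (simp add: hd_drop_conv_nth)
  from min[OF this] show False using assms by simp
qed

lemma shortest_walk_start_unique:
  assumes "Suc i < length p"
  shows "p ! i \<notin> A"
proof
  assume "p ! i \<in> A"
  have "successively (\<lambda>v u. R u v) (take (Suc i) p @ drop (Suc i) p)"
    using p by (simp add: is_walk_def)
  then have "is_walk R A B (take (Suc i) p)"
    using p assms \<open>p ! i \<in> A\<close> unfolding is_walk_def successively_append_iff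
    by (auto simp: take_Suc_conv_app_nth hd_append hd_conv_nth)
  from min[OF this] show False using assms by simp
qed

end

lemma shortest_walk_exists:
  assumes "is_walk R A B p"
  obtains q where "is_walk R A B q" "\<And>q'. is_walk R A B q' \<Longrightarrow> length q \<le> length q'"
  using arg_min_nat_lemma[of "is_walk R A B" p length] assms by blast

lemma is_walk_Cons_iff:
  "is_walk R A B (v # p) \<longleftrightarrow> v \<in> B \<and> (if p = [] then v \<in> A else R (hd p) v \<and> is_walk R A UNIV p)"
  by (auto simp: is_walk_def successively_Cons)

section \<open>Exchange graph and weight splitting\<close>

locale matroid_pair = M1: matroid E indep1 + M2: matroid E indep2
  for E :: "'a set" and indep1 indep2
begin

definition src :: "'a set \<Rightarrow> 'a set" where
  "src I = {x \<in> E - I. indep1 (insert x I)}"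

definition snk :: "'a set \<Rightarrow> 'a set" where
  "snk I = {x \<in> E - I. indep2 (insert x I)}"

text \<open>Walks from \<open>src\<close> to \<open>snk\<close> alternate between elements outside
  and inside \<open>I\<close>. An inner element is paired with its predecessor by the second matroid
  and with its successor by the first.\<close>

definition arc :: "'a set \<Rightarrow> 'a \<Rightarrow> 'a \<Rightarrow> bool" where
  "arc I u v \<longleftrightarrow> (u \<in> I \<and> v \<in> E - I \<and> indep1 (insert v (I - {u}))) \<or>
     (u \<in> E - I \<and> v \<in> I \<and> indep2 (insert u (I - {v})))"

text \<open>For a walk without repetition this is the change of the weight of \<open>I\<close> when
  the walk is exchanged.\<close>

definition cost :: "('a \<Rightarrow> int) \<Rightarrow> 'a set \<Rightarrow> 'a list \<Rightarrow> int" where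
  "cost w I p = sum_list (map (\<lambda>v. if v \<in> I then - w v else w v) p)"

text \<open>Given a splitting \<open>w1 + w2\<close> of the weight, the tight sources, sinks and
  arcs are those whose optimality inequality holds with equality. They play the part of
  complementary slackness: only along them can both halves of the splitting stay optimal.\<close>

definition tight_src :: "('a \<Rightarrow> int) \<Rightarrow> 'a set \<Rightarrow> 'a set" where
  "tight_src u I = {x \<in> src I. \<forall>z\<in>src I. u x \<le> u z}"

definition tight_snk :: "('a \<Rightarrow> int) \<Rightarrow> 'a set \<Rightarrow> 'a set" where
  "tight_snk u I = {x \<in> snk I. \<forall>z\<in>snk I. u x \<le> u z}"

definition tight_arc :: "('a \<Rightarrow> int) \<Rightarrow> ('a \<Rightarrow> int) \<Rightarrow> 'a set \<Rightarrow> 'a \<Rightarrow> 'a \<Rightarrow> bool" where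
  "tight_arc w1 w2 I u v \<longleftrightarrow>
     (u \<in> I \<and> v \<in> E - I \<and> indep1 (insert v (I - {u})) \<and> w1 u = w1 v) \<or>
     (u \<in> E - I \<and> v \<in> I \<and> indep2 (insert u (I - {v})) \<and> w2 u = w2 v)"

text \<open>
  If no tight walk exists, then raising \<open>w1\<close> and lowering \<open>w2\<close> by one on the elements
  reachable by tight arcs keeps \<open>I\<close> optimal for both, since weights are integers, and
  increases the sum of the minima of \<open>w1\<close> over the sources and of \<open>w2\<close> over the sinks.
  That sum is bounded by what \<open>J\<close> costs more than \<open>I\<close>.
\<close>

lemma tight_walk_exists:
  assumes "M1.locally_optimal w1 I" "M2.locally_optimal w2 I"
    and J: "indep1 J" "indep2 J" "card J = Suc (card I)"
  shows "\<exists>v1 v2. M1.locally_optimal v1 I \<and> M2.locally_optimal v2 I \<and>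
    (\<forall>x. v1 x + v2 x = w1 x + w2 x) \<and>
    (\<exists>p. is_walk (tight_arc v1 v2 I) (tight_src v1 I) (tight_snk v2 I) p)"
  using assms(1,2)
proof (induction "nat (sum w1 J + sum w2 J - sum w1 I - sum w2 I - Min (w1 ` src I) - Min (w2 ` snk I))"
    arbitrary: w1 w2 rule: less_induct)
  case less
  let ?m1 = "Min (w1 ` src I)" and ?m2 = "Min (w2 ` snk I)"
  have fin: "finite (src I)" "finite (snk I)"
    using M1.finite_E by (auto simp: src_def snk_def)
  have "\<exists>x\<in>J - I. indep1 (insert x I)" "\<exists>x\<in>J - I. indep2 (insert x I)"
    using less.prems J M1.indep_exchange[of I J] M2.indep_exchange[of I J]
      M1.locally_optimal_indep M2.locally_optimal_indep by auto
  then have ne: "src I \<noteq> {}" "snk I \<noteq> {}"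
    using M1.indep_subset[OF J(1)] by (auto simp: src_def snk_def)
  have m1: "?m1 \<le> w1 x" if "x \<in> src I" for x using that fin by simp
  have m2: "?m2 \<le> w2 x" if "x \<in> snk I" for x using that fin by simp
  show ?case
  proof (cases "\<exists>p. is_walk (tight_arc w1 w2 I) (tight_src w1 I) (tight_snk w2 I) p")
    case True
    then show ?thesis using less.prems by blast
  next
    case False
    define R where "R = {v. \<exists>p. is_walk (tight_arc w1 w2 I) (tight_src w1 I) {v} p}"
    have R_step: "v \<in> R" if uv: "u \<in> R" "tight_arc w1 w2 I u v" for u v
    proof -
      obtain p where "is_walk (tight_arc w1 w2 I) (tight_src w1 I) {u} p" using uv(1) R_def by blast
      then have "is_walk (tight_arc w1 w2 I) (tight_src w1 I) {v} (v # p)"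
        using uv(2) by (auto simp: is_walk_def successively_Cons)
      then show ?thesis using R_def by blast
    qed
    have R_src: "v \<in> R" if "v \<in> tight_src w1 I" for v
    proof -
      have "is_walk (tight_arc w1 w2 I) (tight_src w1 I) {v} [v]" using that by (simp add: is_walk_def)
      then show ?thesis using R_def by blast
    qed
    have R_snk: "v \<notin> R" if "v \<in> tight_snk w2 I" for v
      using that False unfolding R_def is_walk_def by blast
    define v1 where "v1 = (\<lambda>x. if x \<in> R then w1 x + 1 else w1 x)"
    define v2 where "v2 = (\<lambda>x. if x \<in> R then w2 x - 1 else w2 x)"
    have sum: "v1 x + v2 x = w1 x + w2 x" for x by (simp add: v1_def v2_def)
    have opt1: "M1.locally_optimal v1 I"
      unfolding M1.locally_optimal_def
    proof (intro conjI ballI impI)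
      fix y x assume *: "y \<in> I" "x \<in> E - I" "indep1 (insert x (I - {y}))"
      then have "w1 y \<le> w1 x" using less.prems unfolding M1.locally_optimal_def by blast
      moreover have "x \<in> R" if "y \<in> R" "w1 y = w1 x"
        using R_step[OF that(1), of x] * that(2) unfolding tight_arc_def by blast
      ultimately show "v1 y \<le> v1 x" by (fastforce simp: v1_def)
    qed (use less.prems M1.locally_optimal_indep in blast)
    have opt2: "M2.locally_optimal v2 I"
      unfolding M2.locally_optimal_def
    proof (intro conjI ballI impI)
      fix y x assume *: "y \<in> I" "x \<in> E - I" "indep2 (insert x (I - {y}))"
      then have "w2 y \<le> w2 x" using less.prems unfolding M2.locally_optimal_def by blast
      moreover have "y \<in> R" if "x \<in> R" "w2 y = w2 x"
        using R_step[OF that(1), of y] * that(2) unfolding tight_arc_def by fastforce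
      ultimately show "v2 y \<le> v2 x" by (fastforce simp: v2_def)
    qed (use less.prems M2.locally_optimal_indep in blast)
    \<comment> \<open>Tight sources are reachable, so their \<open>w1\<close> rises; the other
      sources already exceed the minimum by at least one. Tight sinks are unreachable and keep their
      \<open>w2\<close>, and the other sinks can afford to lose one.\<close>
    have "?m1 + 1 \<le> v1 x" if "x \<in> src I" for x
    proof (cases "w1 x = ?m1")
      case True
      then have "x \<in> tight_src w1 I" using that m1 by (simp add: tight_src_def)
      then show ?thesis using R_src True by (simp add: v1_def)
    qed (use m1[OF that] in \<open>auto simp: v1_def\<close>)
    then have v1: "?m1 + 1 \<le> Min (v1 ` src I)"
      using fin ne by simp
    have "?m2 \<le> v2 x" if "x \<in> snk I" for x
    proof (cases "w2 x = ?m2")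
      case True
      then have "x \<in> tight_snk w2 I" using that m2 by (simp add: tight_snk_def)
      then show ?thesis using R_snk True by (simp add: v2_def)
    qed (use m2[OF that] in \<open>auto simp: v2_def\<close>)
    then have v2: "?m2 \<le> Min (v2 ` snk I)"
      using fin ne by simp
    have le1: "sum u I + Min (u ` src I) \<le> sum u J" if "M1.locally_optimal u I" for u
      using fin by (intro M1.locally_optimal_augment_le[OF that J(1,3)] Min_le) (auto simp: src_def)
    have le2: "sum u I + Min (u ` snk I) \<le> sum u J" if "M2.locally_optimal u I" for u
      using fin by (intro M2.locally_optimal_augment_le[OF that J(2,3)] Min_le) (auto simp: snk_def)
    have sums: "sum v1 K + sum v2 K = sum w1 K + sum w2 K" for K
      using sum by (simp flip: sum.distrib)
    have "\<exists>u1 u2. M1.locally_optimal u1 I \<and> M2.locally_optimal u2 I \<and>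
      (\<forall>x. u1 x + u2 x = v1 x + v2 x) \<and>
      (\<exists>p. is_walk (tight_arc u1 u2 I) (tight_src u1 I) (tight_snk u2 I) p)"
      by (rule less.hyps[OF _ opt1 opt2])
        (unfold zless_nat_conj, use sums[of I] sums[of J] v1 v2 le1[OF opt1] le2[OF opt2] in linarith)
    then show ?thesis using sum by simp
  qed
qed

text \<open>\<open>h\<close> is a potential: prolonging a walk by an arc adds the change of
  \<open>h\<close> plus the slack of the exchange inequality of that arc, and starting at a source
  adds the slack of that source. So the cost of a walk exceeds \<open>h\<close> at its end by the
  total slack, which vanishes exactly for tight walks. Walks may repeat elements, hence negative
  cycles do no harm.\<close>

lemma walk_cost:
  fixes w1 w2 :: "'a \<Rightarrow> int"
  assumes "M1.locally_optimal w1 I" "M2.locally_optimal w2 I"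
    and w: "\<And>x. w x = w1 x + w2 x"
  defines "h \<equiv> \<lambda>v. if v \<in> I then Min (w1 ` src I) - w1 v else Min (w1 ` src I) + w2 v"
  shows "is_walk (arc I) (src I) UNIV p \<Longrightarrow> h (hd p) \<le> cost w I p \<and>
      (cost w I p = h (hd p) \<longrightarrow> is_walk (tight_arc w1 w2 I) (tight_src w1 I) UNIV p)"
    and "is_walk (tight_arc w1 w2 I) (tight_src w1 I) UNIV p \<Longrightarrow>
      is_walk (arc I) (src I) UNIV p \<and> cost w I p = h (hd p)"
proof -
  let ?m1 = "Min (w1 ` src I)"
  let ?c = "\<lambda>v. if v \<in> I then - w v else w v"
  have fin: "finite (src I)"
    using M1.finite_E by (auto simp: src_def)
  have m1: "?m1 \<le> w1 x" if "x \<in> src I" for x using that fin by simp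
  have tsrc: "x \<in> tight_src w1 I \<longleftrightarrow> x \<in> src I \<and> w1 x = ?m1" for x
    using m1 Min_in[of "w1 ` src I"] fin by (fastforce simp: tight_src_def)
  have src_h: "h v \<le> ?c v \<and> (h v = ?c v \<longleftrightarrow> v \<in> tight_src w1 I)" if "v \<in> src I" for v
    using m1[OF that] that tsrc w by (auto simp: h_def src_def)
  have opt: "w1 y \<le> w1 x" if "y \<in> I" "x \<in> E - I" "indep1 (insert x (I - {y}))" for x y
    using assms(1) that unfolding M1.locally_optimal_def by blast
  have opt2: "w2 y \<le> w2 x" if "y \<in> I" "x \<in> E - I" "indep2 (insert x (I - {y}))" for x y
    using assms(2) that unfolding M2.locally_optimal_def by blast
  have arc_h: "h v \<le> ?c v + h u \<and> (h v = ?c v + h u \<longleftrightarrow> tight_arc w1 w2 I u v)" if "arc I u v" for u v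
    using that unfolding arc_def
  proof (elim disjE conjE)
    assume *: "u \<in> I" "v \<in> E - I" "indep1 (insert v (I - {u}))"
    show ?thesis using opt[OF *] * w[of v] by (auto simp: h_def tight_arc_def)
  next
    assume *: "u \<in> E - I" "v \<in> I" "indep2 (insert u (I - {v}))"
    show ?thesis using opt2[OF *(2,1,3)] * w[of v] by (auto simp: h_def tight_arc_def)
  qed
  have tight_arcD: "arc I u v" if "tight_arc w1 w2 I u v" for u v
    using that by (auto simp: arc_def tight_arc_def)
  show "is_walk (arc I) (src I) UNIV p \<Longrightarrow> h (hd p) \<le> cost w I p \<and>
      (cost w I p = h (hd p) \<longrightarrow> is_walk (tight_arc w1 w2 I) (tight_src w1 I) UNIV p)"
  proof (induction p)
    case (Cons v p)
    show ?case
    proof (cases "p = []")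
      case True
      then show ?thesis using Cons.prems src_h[of v] by (auto simp: is_walk_Cons_iff cost_def)
    next
      case False
      then have *: "arc I (hd p) v" "is_walk (arc I) (src I) UNIV p"
        using Cons.prems by (auto simp: is_walk_Cons_iff)
      have "cost w I (v # p) = ?c v + cost w I p" by (simp add: cost_def)
      then show ?thesis
        using Cons.IH[OF *(2)] arc_h[OF *(1)] False by (auto simp: is_walk_Cons_iff)
    qed
  qed (simp add: is_walk_def)
  show "is_walk (tight_arc w1 w2 I) (tight_src w1 I) UNIV p \<Longrightarrow>
      is_walk (arc I) (src I) UNIV p \<and> cost w I p = h (hd p)"
  proof (induction p)
    case (Cons v p)
    show ?case
    proof (cases "p = []")
      case True
      then show ?thesis using Cons.prems src_h[of v] tsrc by (auto simp: is_walk_Cons_iff cost_def)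
    next
      case False
      then have *: "tight_arc w1 w2 I (hd p) v" "is_walk (tight_arc w1 w2 I) (tight_src w1 I) UNIV p"
        using Cons.prems by (auto simp: is_walk_Cons_iff)
      have "cost w I (v # p) = ?c v + cost w I p" by (simp add: cost_def)
      then show ?thesis
        using Cons.IH[OF *(2)] arc_h[OF tight_arcD[OF *(1)]] *(1) tight_arcD[OF *(1)] False
        by (auto simp: is_walk_Cons_iff)
    qed
  qed (simp add: is_walk_def)
qed

text \<open>The augmentation lemma is applied once per matroid to the same symmetric difference,
  with the walk numbered from its end for the second matroid and from its start for the first. The
  forbidden arcs of that lemma would be shortcuts, and the forbidden sources and sinks would cut off
  an end of the walk.\<close>

lemma shortest_tight_walk_augment:
  assumes opt: "M1.locally_optimal w1 I" "M2.locally_optimal w2 I"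
    and p: "is_walk (tight_arc w1 w2 I) (tight_src w1 I) (tight_snk w2 I) p"
    and min: "\<And>q. is_walk (tight_arc w1 w2 I) (tight_src w1 I) (tight_snk w2 I) q \<Longrightarrow> length p \<le> length q"
  defines "I' \<equiv> (I - set p) \<union> (set p - I)"
  shows "M1.locally_optimal w1 I' \<and> M2.locally_optimal w2 I' \<and> card I' = Suc (card I)"
proof -
  let ?R = "tight_arc w1 w2 I"
  note shortcut = shortest_walk_no_shortcut[OF p min]
  note distinct = shortest_walk_distinct[OF p min]
  note start = shortest_walk_start_unique[OF p min]
  note end_ = shortest_walk_end_unique[OF p min]
  have p0: "p \<noteq> []" "hd p \<in> tight_snk w2 I" "last p \<in> tight_src w1 I" using p by (auto simp: is_walk_def)
  have step: "?R (p ! Suc k) (p ! k)" if "Suc k < length p" for k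
    using p that successively_nthD[of "\<lambda>v u. ?R u v" p k] by (simp add: is_walk_def)
  have alt: "p ! k \<in> (if even k then E - I else I)" if "k < length p" for k
    using that
  proof (induction k)
    case 0
    then show ?case using p0 by (auto simp: tight_snk_def snk_def hd_conv_nth)
  next
    case (Suc k)
    then show ?case using step[of k] by (auto simp: tight_arc_def split: if_splits)
  qed
  have "last p = p ! (length p - 1)" using p0 by (simp add: last_conv_nth)
  moreover have "last p \<in> E - I" using p0 by (auto simp: tight_src_def src_def)
  \<comment> \<open>Both ends lie outside \<open>I\<close> and membership alternates, so there are
    \<open>s\<close> elements of \<open>I\<close> and \<open>s + 1\<close> others.\<close>
  ultimately have "even (length p - 1)" using alt[of "length p - 1"] p0 by (auto split: if_splits)
  then obtain s where "length p - 1 = 2 * s" by (elim evenE)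
  then have s: "length p = 2 * s + 1" using p0 by (cases p) auto
  have nth_eq: "p ! i = p ! j \<longleftrightarrow> i = j" if "i < length p" "j < length p" for i j
    using distinct that by (simp add: nth_eq_iff_index_eq)
  have set_p: "set p = (\<lambda>k. p ! k) ` {..2 * s}"
    using s by (auto simp: set_conv_nth)
  have outer: "(\<lambda>j. p ! (2 * j)) ` {..s} = set p - I"
  proof (intro set_eqI iffI)
    fix z assume "z \<in> set p - I"
    then obtain k where k: "k < length p" "z = p ! k" "z \<notin> I" by (auto simp: in_set_conv_nth)
    then have "even k" using alt[of k] by (auto split: if_splits)
    then show "z \<in> (\<lambda>j. p ! (2 * j)) ` {..s}" using k s by (auto elim!: evenE)
  next
    fix z assume "z \<in> (\<lambda>j. p ! (2 * j)) ` {..s}"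
    then obtain j where j: "j \<le> s" "z = p ! (2 * j)" by auto
    then show "z \<in> set p - I" using alt[of "2 * j"] s by auto
  qed
  have inner: "(\<lambda>j. p ! (2 * j - 1)) ` {1..s} = set p \<inter> I"
  proof (intro set_eqI iffI)
    fix z assume "z \<in> set p \<inter> I"
    then obtain k where k: "k < length p" "z = p ! k" "z \<in> I" by (auto simp: in_set_conv_nth)
    then have "odd k" using alt[of k] by (auto split: if_splits)
    then obtain j where "k = 2 * j + 1" by (elim oddE)
    then show "z \<in> (\<lambda>j. p ! (2 * j - 1)) ` {1..s}" using k s by (intro image_eqI[of _ _ "Suc j"]) auto
  next
    fix z assume "z \<in> (\<lambda>j. p ! (2 * j - 1)) ` {1..s}"
    then obtain j where j: "j \<ge> 1" "j \<le> s" "z = p ! (2 * j - 1)" by auto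
    then show "z \<in> set p \<inter> I" using alt[of "2 * j - 1"] s by (auto split: if_splits)
  qed
  have outer': "(\<lambda>j. p ! (2 * (s - j))) ` {..s} = set p - I"
  proof -
    have "z \<in> (\<lambda>j. s - j) ` {..s}" if "z \<le> s" for z
      using that by (intro image_eqI[of _ _ "s - z"]) auto
    then have "(\<lambda>j. s - j) ` {..s} = {..s}" by auto
    then show ?thesis using outer image_image[of "\<lambda>j. p ! (2 * j)" "\<lambda>j. s - j" "{..s}"] by simp
  qed
  have inner': "(\<lambda>j. p ! (2 * (Suc s - j) - 1)) ` {1..s} = set p \<inter> I"
  proof -
    have "z \<in> (\<lambda>j. Suc s - j) ` {1..s}" if "z \<in> {1..s}" for z
      using that by (intro image_eqI[of _ _ "Suc s - z"]) auto
    then have "(\<lambda>j. Suc s - j) ` {1..s} = {1..s}" by auto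
    then show ?thesis using inner image_image[of "\<lambda>j. p ! (2 * j - 1)" "\<lambda>j. Suc s - j" "{1..s}"] by simp
  qed
  have I': "I' = (I - set p \<inter> I) \<union> (set p - I)" by (auto simp: I'_def)
  have arcD1: "indep1 (insert v (I - {u})) \<and> w1 v = w1 u" if "?R u v" "v \<notin> I" for u v
    using that by (auto simp: tight_arc_def)
  have arcD2: "indep2 (insert u (I - {v})) \<and> w2 u = w2 v" if "?R u v" "v \<in> I" for u v
    using that by (auto simp: tight_arc_def)
  have evenD: "p ! (2 * j) \<in> E - I" if "j \<le> s" for j
    using alt[of "2 * j"] s that by auto
  have oddD: "p ! (2 * j - 1) \<in> I" if "1 \<le> j" "j \<le> s" for j
    using alt[of "2 * j - 1"] s that by (auto split: if_splits)
  have hd: "p ! 0 \<in> tight_snk w2 I" using p0 by (simp add: hd_conv_nth)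
  have last: "p ! (2 * s) \<in> tight_src w1 I" using p0 s by (simp add: last_conv_nth)
  have 2: "M2.locally_optimal w2 I' \<and> card I' = Suc (card I)"
    unfolding I' outer[symmetric] inner[symmetric]
  proof (rule M2.augment[OF opt(2)])
    fix i j assume *: "i \<in> {1..s}" "j \<in> {1..s}" "i < j" "w2 (p ! (2 * j)) = w2 (p ! (2 * i - 1))"
    show "\<not> indep2 (insert (p ! (2 * j)) (I - {p ! (2 * i - 1)}))"
    proof
      assume "indep2 (insert (p ! (2 * j)) (I - {p ! (2 * i - 1)}))"
      then have "?R (p ! (2 * j)) (p ! (2 * i - 1))"
        using * evenD[of j] oddD[of i] by (auto simp: tight_arc_def)
      then have "2 * j = Suc (2 * i - 1)" using * s by (intro shortcut) auto
      then show False using * by simp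
    qed
  next
    fix j assume *: "j \<in> {1..s}" "w2 (p ! (2 * j)) = w2 (p ! (2 * 0))"
    show "\<not> indep2 (insert (p ! (2 * j)) I)"
    proof
      assume "indep2 (insert (p ! (2 * j)) I)"
      then have "p ! (2 * j) \<in> tight_snk w2 I"
        using * hd evenD[of j] by (auto simp: tight_snk_def snk_def)
      then show False using end_[of "2 * j"] * s by auto
    qed
  next
    fix i assume *: "i \<in> {1..s}"
    have "?R (p ! Suc (2 * i - 1)) (p ! (2 * i - 1))"
      using * s by (intro step) auto
    moreover have "Suc (2 * i - 1) = 2 * i" using * by auto
    ultimately show "indep2 (insert (p ! (2 * i)) (I - {p ! (2 * i - 1)})) \<and> w2 (p ! (2 * i)) = w2 (p ! (2 * i - 1))"
      using arcD2 oddD[of i] * by auto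
  next
    show "inj_on (\<lambda>j. p ! (2 * j)) {..s}" "inj_on (\<lambda>j. p ! (2 * j - 1)) {1..s}"
      using s by (auto intro!: inj_onI simp: nth_eq)
  qed (use hd evenD oddD in \<open>auto simp: tight_snk_def snk_def\<close>)
  \<comment> \<open>The pairing changes with the direction: the partner of an outer element is now
    the element that precedes it on the walk, at the next larger index.\<close>
  have 1: "M1.locally_optimal w1 I' \<and> card I' = Suc (card I)"
    unfolding I' outer'[symmetric] inner'[symmetric]
  proof (rule M1.augment[OF opt(1)])
    fix i j assume *: "i \<in> {1..s}" "j \<in> {1..s}" "i < j"
      "w1 (p ! (2 * (s - j))) = w1 (p ! (2 * (Suc s - i) - 1))"
    show "\<not> indep1 (insert (p ! (2 * (s - j))) (I - {p ! (2 * (Suc s - i) - 1)}))"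
    proof
      assume "indep1 (insert (p ! (2 * (s - j))) (I - {p ! (2 * (Suc s - i) - 1)}))"
      then have "?R (p ! (2 * (Suc s - i) - 1)) (p ! (2 * (s - j)))"
        using * evenD[of "s - j"] oddD[of "Suc s - i"] by (auto simp: tight_arc_def)
      then have "2 * (Suc s - i) - 1 = Suc (2 * (s - j))" using * s by (intro shortcut) auto
      then show False using * by auto
    qed
  next
    fix j assume *: "j \<in> {1..s}" "w1 (p ! (2 * (s - j))) = w1 (p ! (2 * (s - 0)))"
    show "\<not> indep1 (insert (p ! (2 * (s - j))) I)"
    proof
      assume "indep1 (insert (p ! (2 * (s - j))) I)"
      then have "p ! (2 * (s - j)) \<in> tight_src w1 I"
        using * last evenD[of "s - j"] by (auto simp: tight_src_def src_def)
      then show False using start[of "2 * (s - j)"] * s by auto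
    qed
  next
    fix i assume *: "i \<in> {1..s}"
    have "?R (p ! Suc (2 * (s - i))) (p ! (2 * (s - i)))"
      using * s by (intro step) auto
    moreover have "Suc (2 * (s - i)) = 2 * (Suc s - i) - 1" using * by auto
    ultimately show "indep1 (insert (p ! (2 * (s - i))) (I - {p ! (2 * (Suc s - i) - 1)})) \<and>
        w1 (p ! (2 * (s - i))) = w1 (p ! (2 * (Suc s - i) - 1))"
      using arcD1 evenD[of "s - i"] * by auto
  next
    show "inj_on (\<lambda>j. p ! (2 * (s - j))) {..s}" "inj_on (\<lambda>j. p ! (2 * (Suc s - j) - 1)) {1..s}"
      using s by (auto intro!: inj_onI simp: nth_eq)
  qed (use last evenD oddD in \<open>auto simp: tight_src_def src_def\<close>)
  show ?thesis using 1 2 by blast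
qed

text \<open>Links the search, which knows only \<open>w1 + w2\<close>, with the splitting. A
  shortest tight walk has no repetition, so it obeys the length bound, and its cost is the least
  possible for any walk from source to sink. Hence a cheapest walk within the bound is tight, and a
  shortest such walk is a shortest tight one.\<close>

lemma walk_exists:
  assumes "M1.locally_optimal w1 I" "M2.locally_optimal w2 I"
    and J: "indep1 J" "indep2 J" "card J = Suc (card I)"
  shows "\<exists>q. is_walk (arc I) (src I) (snk I) q \<and> length q \<le> card E"
    and "is_walk (arc I) (src I) (snk I) p \<Longrightarrow> card E \<le> N \<Longrightarrow> length p \<le> N \<Longrightarrow>
      (\<And>q. is_walk (arc I) (src I) (snk I) q \<Longrightarrow> length q \<le> N \<Longrightarrow>
         cost (\<lambda>x. w1 x + w2 x) I p \<le> cost (\<lambda>x. w1 x + w2 x) I q) \<Longrightarrow>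
      (\<And>q. is_walk (arc I) (src I) (snk I) q \<Longrightarrow> length q \<le> N \<Longrightarrow>
         cost (\<lambda>x. w1 x + w2 x) I p = cost (\<lambda>x. w1 x + w2 x) I q \<Longrightarrow> length p \<le> length q) \<Longrightarrow>
      \<exists>v1 v2. (\<forall>x. v1 x + v2 x = w1 x + w2 x) \<and> M1.locally_optimal v1 ((I - set p) \<union> (set p - I)) \<and>
        M2.locally_optimal v2 ((I - set p) \<union> (set p - I)) \<and>
        card ((I - set p) \<union> (set p - I)) = Suc (card I)"
proof -
  let ?w = "\<lambda>x. w1 x + w2 x"
  obtain v1 v2 q0 where v: "M1.locally_optimal v1 I" "M2.locally_optimal v2 I"
    and w: "\<And>x. w1 x + w2 x = v1 x + v2 x"
    and q0: "is_walk (tight_arc v1 v2 I) (tight_src v1 I) (tight_snk v2 I) q0"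
    using tight_walk_exists[OF assms] by metis
  let ?T = "is_walk (tight_arc v1 v2 I) (tight_src v1 I) (tight_snk v2 I)"
  let ?W = "is_walk (arc I) (src I) (snk I)"
  obtain q where q: "?T q" "\<And>q'. ?T q' \<Longrightarrow> length q \<le> length q'"
    using shortest_walk_exists[OF q0] by blast
  let ?m = "Min (v1 ` src I) + Min (v2 ` snk I)"
  note wc = walk_cost[OF v, of ?w, OF w]
  have fin: "finite (snk I)"
    using M1.finite_E by (auto simp: snk_def)
  have m2: "Min (v2 ` snk I) \<le> v2 x" if "x \<in> snk I" for x using that fin by simp
  have tsnk: "x \<in> tight_snk v2 I \<longleftrightarrow> x \<in> snk I \<and> v2 x = Min (v2 ` snk I)" for x
    using m2 Min_in[of "v2 ` snk I"] fin by (fastforce simp: tight_snk_def)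
  have walk_mono: "is_walk R A UNIV r" if "is_walk R A B r" for R A B and r :: "'a list"
    using that by (auto simp: is_walk_def)
  have T_W: "?W r \<and> cost ?w I r = ?m" if "?T r" for r
  proof -
    have "hd r \<in> tight_snk v2 I" using that by (simp add: is_walk_def)
    then have "hd r \<in> snk I" "v2 (hd r) = Min (v2 ` snk I)" "hd r \<notin> I"
      using tsnk by (auto simp: snk_def)
    then show ?thesis using wc(2)[OF walk_mono[OF that]] by (auto simp: is_walk_def)
  qed
  have W_T: "?m \<le> cost ?w I r \<and> (cost ?w I r = ?m \<longrightarrow> ?T r)" if "?W r" for r
  proof -
    have "hd r \<in> snk I" using that by (simp add: is_walk_def)
    then have "hd r \<in> snk I" "hd r \<notin> I" "Min (v2 ` snk I) \<le> v2 (hd r)"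
      using m2 by (auto simp: snk_def)
    then show ?thesis using wc(1)[OF walk_mono[OF that]] tsnk[of "hd r"] by (auto simp: is_walk_def)
  qed
  have "distinct q" by (rule shortest_walk_distinct[OF q])
  have "set q \<subseteq> E"
  proof -
    have IE: "I \<subseteq> E" using v M1.locally_optimal_indep M1.indep_subset by blast
    have "set r \<subseteq> E" if "successively (\<lambda>v u. tight_arc v1 v2 I u v) r" "last r \<in> E" for r
      using that IE
      by (induction r rule: induct_list012) (auto simp: tight_arc_def)
    then show ?thesis using q(1) by (auto simp: is_walk_def tight_src_def src_def)
  qed
  then have len: "length q \<le> card E"
    using \<open>distinct q\<close> distinct_card[of q] card_mono[OF M1.finite_E] by metis
  then show "\<exists>q. ?W q \<and> length q \<le> card E" using T_W[OF q(1)] by blast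
  assume p: "?W p" "card E \<le> N" "length p \<le> N"
      "\<And>q. ?W q \<Longrightarrow> length q \<le> N \<Longrightarrow> cost ?w I p \<le> cost ?w I q"
      "\<And>q. ?W q \<Longrightarrow> length q \<le> N \<Longrightarrow> cost ?w I p = cost ?w I q \<Longrightarrow> length p \<le> length q"
  have "cost ?w I p \<le> ?m" using p(4)[of q] T_W[OF q(1)] len p(2) by simp
  then have pT: "?T p" "cost ?w I p = ?m" using W_T[OF p(1)] by auto
  have "length p \<le> length q" using p(5)[of q] T_W[OF q(1)] len p(2) pT by simp
  then have "length p \<le> length q'" if "?T q'" for q' using q(2)[OF that] by simp
  then show "\<exists>v1 v2. (\<forall>x. v1 x + v2 x = w1 x + w2 x) \<and> M1.locally_optimal v1 ((I - set p) \<union> (set p - I)) \<and>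
        M2.locally_optimal v2 ((I - set p) \<union> (set p - I)) \<and>
        card ((I - set p) \<union> (set p - I)) = Suc (card I)"
    using shortest_tight_walk_augment[OF v pT(1)] w by metis
qed

end

section \<open>Forests as a linear matroid\<close>

interpretation fun_space: vector_space "\<lambda>(c :: real) (f :: int \<Rightarrow> real) x. c * f x"
  by unfold_locales (auto simp: fun_eq_iff algebra_simps)

definition diff_vec :: "int \<Rightarrow> int \<Rightarrow> int \<Rightarrow> real" where
  "diff_vec a b v = of_bool (v = a) - of_bool (v = b)"

definition edge_span :: "('a \<Rightarrow> int) \<Rightarrow> ('a \<Rightarrow> int) \<Rightarrow> 'a set \<Rightarrow> (int \<Rightarrow> real) set" where
  "edge_span g h F = fun_space.span ((\<lambda>x. diff_vec (g x) (h x)) ` F)"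

text \<open>A graph is a forest iff the columns of its oriented incidence matrix are independent.\<close>

definition forest :: "('a \<Rightarrow> int) \<Rightarrow> ('a \<Rightarrow> int) \<Rightarrow> 'a set \<Rightarrow> bool" where
  "forest g h F \<longleftrightarrow> inj_on (\<lambda>x. diff_vec (g x) (h x)) F \<and>
     fun_space.independent ((\<lambda>x. diff_vec (g x) (h x)) ` F)"

lemma forest_mono: "forest g h F \<Longrightarrow> F' \<subseteq> F \<Longrightarrow> forest g h F'"
  using fun_space.independent_mono[of "(\<lambda>x. diff_vec (g x) (h x)) ` F" "(\<lambda>x. diff_vec (g x) (h x)) ` F'"]
  unfolding forest_def by (auto intro: inj_on_subset)

lemma forest_empty: "forest g h {}"
  by (simp add: forest_def fun_space.independent_empty)

lemma edge_span_base: "x \<in> F \<Longrightarrow> diff_vec (g x) (h x) \<in> edge_span g h F"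
  unfolding edge_span_def by (auto intro: fun_space.span_base)

lemma forest_insert:
  assumes "forest g h F" "diff_vec (g x) (h x) \<notin> edge_span g h F"
  shows "forest g h (insert x F)"
  using assms unfolding forest_def edge_span_def
  by (auto simp: fun_space.independent_insert fun_space.span_base)

text \<open>This is the form that can be tested: no edge has its ends joined by the others.\<close>

lemma forest_iff:
  "forest g h F \<longleftrightarrow> (\<forall>x\<in>F. diff_vec (g x) (h x) \<notin> edge_span g h (F - {x}))"
proof
  let ?f = "\<lambda>x. diff_vec (g x) (h x)"
  assume F: "forest g h F"
  show "\<forall>x\<in>F. ?f x \<notin> edge_span g h (F - {x})"
  proof
    fix x assume x: "x \<in> F"
    have "?f ` (F - {x}) = ?f ` F - {?f x}"
      using F x unfolding forest_def inj_on_def by blast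
    then show "?f x \<notin> edge_span g h (F - {x})"
      using F x unfolding forest_def edge_span_def fun_space.dependent_def by auto
  qed
next
  let ?f = "\<lambda>x. diff_vec (g x) (h x)"
  assume *: "\<forall>x\<in>F. ?f x \<notin> edge_span g h (F - {x})"
  have "inj_on ?f F"
  proof (rule inj_onI, rule ccontr)
    fix x y assume xy: "x \<in> F" "y \<in> F" "?f x = ?f y" "x \<noteq> y"
    then have "?f y \<in> edge_span g h (F - {x})" by (intro edge_span_base) auto
    then show False using * xy by metis
  qed
  moreover have "\<not> fun_space.dependent (?f ` F)"
  proof
    assume "fun_space.dependent (?f ` F)"
    then obtain x where x: "x \<in> F" "?f x \<in> fun_space.span (?f ` F - {?f x})"
      unfolding fun_space.dependent_def by auto
    have "fun_space.span (?f ` F - {?f x}) \<subseteq> edge_span g h (F - {x})"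
      unfolding edge_span_def by (intro fun_space.span_mono) auto
    then show False using * x by blast
  qed
  ultimately show "forest g h F" by (simp add: forest_def)
qed

text \<open>The exchange property is the Steinitz bound: an independent family in the span of
  \<open>A\<close> has at most \<open>card A\<close> members.\<close>

lemma forest_matroid:
  assumes "finite E"
  shows "matroid E (\<lambda>F. F \<subseteq> E \<and> forest g h F)"
proof
  fix A B assume A: "A \<subseteq> E \<and> forest g h A" and B: "B \<subseteq> E \<and> forest g h B" and card: "card A < card B"
  let ?f = "\<lambda>x. diff_vec (g x) (h x)"
  have fin: "finite A" "finite B" using A B assms finite_subset by blast+
  show "\<exists>x\<in>B - A. insert x A \<subseteq> E \<and> forest g h (insert x A)"
  proof (rule ccontr)
    assume *: "\<not> ?thesis"
    have "?f x \<in> edge_span g h A" if "x \<in> B" for x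
    proof (cases "x \<in> A")
      case False
      then have "\<not> forest g h (insert x A)" using * that A B by blast
      then show ?thesis using forest_insert[of g h A x] A by argo
    qed (rule edge_span_base)
    then have "?f ` B \<subseteq> fun_space.span (?f ` A)"
      unfolding edge_span_def by (rule image_subsetI)
    moreover have "fun_space.independent (?f ` B)" using B by (simp add: forest_def)
    ultimately have "card (?f ` B) \<le> card (?f ` A)"
      by (intro conjunct2[OF fun_space.independent_span_bound]) (use fin in simp)
    then show False
      using A B card unfolding forest_def by (simp add: card_image)
  qed
qed (use assms forest_empty forest_mono in blast)+

lemma edge_span_subspace:
  assumes "fun_space.subspace S" "\<And>x. x \<in> F \<Longrightarrow> diff_vec (g x) (h x) \<in> S"
  shows "edge_span g h F \<subseteq> S"
  unfolding edge_span_def using assms by (intro fun_space.span_minimal) auto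

text \<open>Coordinate \<open>v\<close> vanishes on the span of \<open>F\<close>, but not on the
  vector of the new edge.\<close>

lemma forest_leaf:
  assumes "forest g h F" "g x \<noteq> h x" "v = g x \<or> v = h x"
    and "\<And>y. y \<in> F \<Longrightarrow> g y \<noteq> v \<and> h y \<noteq> v"
  shows "forest g h (insert x F)"
proof (rule forest_insert[OF assms(1)])
  have "edge_span g h F \<subseteq> {f. f v = 0}"
    using assms(4) by (intro edge_span_subspace) (auto simp: fun_space.subspace_def diff_vec_def)
  then show "diff_vec (g x) (h x) \<notin> edge_span g h F"
    using assms(2,3) by (auto simp: diff_vec_def)
qed

text \<open>\<open>\<rho>\<close> picks a representative that is constant along edges. Every edge
  vector is a difference of two vectors \<open>diff_vec a (\<rho> a)\<close>, so the forest lives in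
  a space spanned by one vector for each element of \<open>S\<close> that is not its own
  representative.\<close>

lemma forest_card:
  assumes F: "forest g h F" and S: "finite S"
    and ends: "\<And>y. y \<in> F \<Longrightarrow> g y \<in> S \<and> h y \<in> S \<and> \<rho> (g y) = \<rho> (h y)"
  shows "card F \<le> card {a \<in> S. \<rho> a \<noteq> a}"
proof -
  let ?f = "\<lambda>x. diff_vec (g x) (h x)"
  let ?T = "(\<lambda>a. diff_vec a (\<rho> a)) ` {a \<in> S. \<rho> a \<noteq> a}"
  have *: "diff_vec a (\<rho> a) \<in> fun_space.span ?T" if "a \<in> S" for a
  proof (cases "\<rho> a = a")
    case True
    then have "diff_vec a (\<rho> a) = 0" by (auto simp: diff_vec_def fun_eq_iff)
    then show ?thesis using fun_space.span_zero by simp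
  qed (use that in \<open>auto intro: fun_space.span_base\<close>)
  have "?f y \<in> fun_space.span ?T" if "y \<in> F" for y
  proof -
    have "?f y = diff_vec (g y) (\<rho> (g y)) - diff_vec (h y) (\<rho> (h y))"
      using ends[OF that] by (auto simp: diff_vec_def fun_eq_iff)
    also have "\<dots> \<in> fun_space.span ?T"
      using ends[OF that] by (intro fun_space.span_diff *) simp_all
    finally show ?thesis .
  qed
  then have "?f ` F \<subseteq> fun_space.span ?T" by (rule image_subsetI)
  moreover have "fun_space.independent (?f ` F)" using F by (simp add: forest_def)
  moreover have "finite ?T" using S by simp
  ultimately have "card (?f ` F) \<le> card ?T"
    by (intro conjunct2[OF fun_space.independent_span_bound])
  also have "\<dots> \<le> card {a \<in> S. \<rho> a \<noteq> a}" using S by (intro card_image_le) auto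
  finally show ?thesis using F by (simp add: forest_def card_image)
qed

lemma edge_span_step:
  assumes "diff_vec a u \<in> edge_span g h F" "y \<in> F" "(g y = u \<and> h y = w) \<or> (g y = w \<and> h y = u)"
  shows "diff_vec a w \<in> edge_span g h F"
proof -
  have "diff_vec a w = diff_vec a u + diff_vec (g y) (h y) \<or> diff_vec a w = diff_vec a u - diff_vec (g y) (h y)"
    using assms(3) by (auto simp: diff_vec_def fun_eq_iff)
  then show ?thesis
  proof (elim disjE)
    assume "diff_vec a w = diff_vec a u + diff_vec (g y) (h y)"
    also have "\<dots> \<in> edge_span g h F"
      using assms(1) edge_span_base[OF assms(2), of g h] unfolding edge_span_def
      by (rule fun_space.span_add)
    finally show ?thesis .
  next
    assume "diff_vec a w = diff_vec a u - diff_vec (g y) (h y)"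
    also have "\<dots> \<in> edge_span g h F"
      using assms(1) edge_span_base[OF assms(2), of g h] unfolding edge_span_def
      by (rule fun_space.span_diff)
    finally show ?thesis .
  qed
qed

lemma edge_span_refl: "diff_vec a a \<in> edge_span g h F"
proof -
  have "diff_vec a a = 0" by (auto simp: diff_vec_def fun_eq_iff)
  then show ?thesis unfolding edge_span_def by (simp add: fun_space.span_zero)
qed

text \<open>Summing the coordinates over \<open>R\<close> is a linear form that vanishes on all
  edges of \<open>F\<close> but takes the value 1 on the vector from \<open>a\<close> to
  \<open>b\<close>.\<close>

lemma edge_span_closed:
  assumes "finite R" "a \<in> R" "b \<notin> R" "\<And>y. y \<in> F \<Longrightarrow> g y \<in> R \<longleftrightarrow> h y \<in> R"
  shows "diff_vec a b \<notin> edge_span g h F"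
proof -
  have *: "(\<Sum>v\<in>R. diff_vec c d v) = of_bool (c \<in> R) - of_bool (d \<in> R)" for c d
    using assms(1) by (simp add: diff_vec_def sum_subtractf of_bool_def)
  have "edge_span g h F \<subseteq> {f. (\<Sum>v\<in>R. f v) = 0}"
    using assms(4) * by (intro edge_span_subspace)
      (auto simp: fun_space.subspace_def sum.distrib simp flip: sum_distrib_left)
  then show ?thesis using *[of a b] assms(2,3) by auto
qed

section \<open>The algorithm\<close>

named_theorems pt_intros
declare pt_id [pt_intros] pt_num [pt_intros] pt_hd [pt_intros] pt_tl [pt_intros] pt_Cell [pt_intros]
  pt_if [pt_intros] pt_list_if [pt_intros] pt_int_if [pt_intros] pt_bool_if [pt_intros] pt_bool [pt_intros]
  pt_conj [pt_intros] pt_disj [pt_intros] pt_not [pt_intros] pt_less [pt_intros] pt_le [pt_intros]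
  pt_eq [pt_intros] pt_numv [pt_intros] pt_add [pt_intros] pt_mult [pt_intros] pt_div [pt_intros]
  pt_minus [pt_intros] pt_list_dec [pt_intros] pt_map [pt_intros] pt_filter [pt_intros]
  pt_bex [pt_intros] pt_ball [pt_intros] pt_sum_list [pt_intros] pt_prod_list [pt_intros]
  pt_length [pt_intros] pt_Nil [pt_intros] pt_Cons [pt_intros] pt_concat_map [pt_intros]
  pt_is_Nil [pt_intros] pt_take_1 [pt_intros]

fun fld :: "nat \<Rightarrow> val \<Rightarrow> val" where
  "fld 0 u = hd_val u"
| "fld (Suc k) u = fld k (tl_val u)"

lemma pt_fld [pt_intros]: "pt f \<Longrightarrow> pt (\<lambda>c. fld k (f c))"
  by (induction k arbitrary: f) (auto intro: pt_hd pt_tl)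

text \<open>
  An element of the common ground set of the two matroids is an edge directed towards
  one of its ends and assigned to one of two copies of the graph; vertex \<open>v\<close> of copy
  \<open>i\<close> has number \<open>2 * v + i\<close>. An element is the list of its number, its edge, its two ends in
  its copy, the vertex to which it is directed, its weight, and whether it is safe.
\<close>

definition uid :: "val \<Rightarrow> int" where "uid u = numv (fld 0 u)"
definition end1 :: "val \<Rightarrow> int" where "end1 u = numv (fld 2 u)"
definition end2 :: "val \<Rightarrow> int" where "end2 u = numv (fld 3 u)"
definition target :: "val \<Rightarrow> int" where "target u = numv (fld 4 u)"
definition wt :: "val \<Rightarrow> int" where "wt u = numv (fld 5 u)"
definition is_safe :: "val \<Rightarrow> bool" where "is_safe u \<longleftrightarrow> numv (fld 6 u) = 1"

definition mem :: "val list \<Rightarrow> val \<Rightarrow> bool" where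
  "mem I u \<longleftrightarrow> (\<exists>z\<in>set I. uid z = uid u)"

definition del :: "val list \<Rightarrow> val \<Rightarrow> val list" where
  "del I u = filter (\<lambda>z. uid z \<noteq> uid u) I"

definition reach_step :: "val list \<Rightarrow> val list \<Rightarrow> val list \<Rightarrow> val list" where
  "reach_step W I R = filter (\<lambda>v. (\<exists>z\<in>set R. numv z = numv v) \<or>
     (\<exists>x\<in>set I. end2 x = numv v \<and> (\<exists>z\<in>set R. numv z = end1 x) \<or>
                end1 x = numv v \<and> (\<exists>z\<in>set R. numv z = end2 x))) W"

text \<open>One round per vertex reaches a fixed point. Every round filters \<open>W\<close>, which
  keeps the accumulator small.\<close>

definition reach :: "val list \<Rightarrow> val list \<Rightarrow> int \<Rightarrow> val list" where
  "reach W I a = dec_list (foldr (\<lambda>_ r. enc_list (reach_step W I (dec_list r))) W (enc_list [Num a]))"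

definition ind1 :: "val list \<Rightarrow> val list \<Rightarrow> bool" where
  "ind1 W I \<longleftrightarrow> (\<forall>x\<in>set I. \<not> (\<exists>z\<in>set (reach W (del I x) (end1 x)). numv z = end2 x))"

definition ind2 :: "val list \<Rightarrow> bool" where
  "ind2 I \<longleftrightarrow> (\<forall>x\<in>set I. int (length (filter (\<lambda>y. target y = target x) I)) \<le> 2 \<and>
     (is_safe x \<or> int (length (filter (\<lambda>y. uid y div 2 = uid x div 2) I)) \<le> 1))"

definition srcb :: "val list \<Rightarrow> val list \<Rightarrow> val \<Rightarrow> bool" where
  "srcb W I v \<longleftrightarrow> \<not> mem I v \<and> ind1 W (v # I)"

definition snkb :: "val list \<Rightarrow> val \<Rightarrow> bool" where
  "snkb I v \<longleftrightarrow> \<not> mem I v \<and> ind2 (v # I)"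

definition arcb :: "val list \<Rightarrow> val list \<Rightarrow> val \<Rightarrow> val \<Rightarrow> bool" where
  "arcb W I u v \<longleftrightarrow> (mem I u \<and> \<not> mem I v \<and> ind1 W (v # del I u)) \<or>
     (\<not> mem I u \<and> mem I v \<and> ind2 (u # del I v))"

definition walk_cost :: "val list \<Rightarrow> val \<Rightarrow> int" where
  "walk_cost I p = sum_list (map (\<lambda>u. if mem I u then - wt u else wt u) (dec_list p))"

text \<open>Comparing all pairs needs nothing but a filter and a bounded quantifier. All minimisers
  are kept, so that ties can afterwards be broken by length.\<close>

definition cheapest :: "val list \<Rightarrow> val list \<Rightarrow> val list" where
  "cheapest I C = filter (\<lambda>p. \<forall>q\<in>set C. walk_cost I p \<le> walk_cost I q) C"

definition shortest :: "val list \<Rightarrow> val list" where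
  "shortest C = filter (\<lambda>p. \<forall>q\<in>set C. int (length (dec_list p)) \<le> int (length (dec_list q))) C"

text \<open>One round in the manner of Bellman and Ford, sorted by the exact number of elements. A
  single walk is kept for each end \<open>v\<close>, without which the levels would grow
  exponentially.\<close>

definition extend_walks :: "val list \<Rightarrow> val list \<Rightarrow> val list \<Rightarrow> val list \<Rightarrow> val list" where
  "extend_walks W U I L = concat (map (\<lambda>v. take 1 (cheapest I
     (map (\<lambda>p. Cell v p) (filter (\<lambda>p. arcb W I (hd_val p) v) L)))) U)"

fun level :: "val list \<Rightarrow> val list \<Rightarrow> val list \<Rightarrow> nat \<Rightarrow> val list" where
  "level W U I 0 = map (\<lambda>v. Cell v (Num 0)) (filter (\<lambda>v. srcb W I v) U)"
| "level W U I (Suc k) = extend_walks W U I (level W U I k)"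

text \<open>The newest level stands in front, where the next round finds it. The levels from 0 to
  \<open>length U\<close> contain walks of up to \<open>length U + 1\<close> elements.\<close>

definition levels :: "val list \<Rightarrow> val list \<Rightarrow> val list \<Rightarrow> val list" where
  "levels W U I = dec_list (foldr (\<lambda>_ r. Cell (enc_list (extend_walks W U I (dec_list (hd_val r)))) r) U
     (enc_list [enc_list (level W U I 0)]))"

definition candidates :: "val list \<Rightarrow> val list \<Rightarrow> val list \<Rightarrow> val list" where
  "candidates W U I = concat (map (\<lambda>l. filter (\<lambda>p. snkb I (hd_val p)) (dec_list l)) (levels W U I))"

definition augmenting :: "val list \<Rightarrow> val list \<Rightarrow> val list \<Rightarrow> val list" where
  "augmenting W U I = shortest (cheapest I (candidates W U I))"

text \<open>The symmetric difference is formed by filtering \<open>U\<close>, which keeps the list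
  free of repetitions and no larger than \<open>U\<close>.\<close>

definition step :: "val list \<Rightarrow> val list \<Rightarrow> val list \<Rightarrow> val list" where
  "step W U I = filter (\<lambda>u.
     if augmenting W U I = [] then mem I u
     else mem I u \<and> \<not> mem (dec_list (hd_val (enc_list (augmenting W U I)))) u \<or>
          \<not> mem I u \<and> mem (dec_list (hd_val (enc_list (augmenting W U I)))) u) U"

definition solve :: "val list \<Rightarrow> val list \<Rightarrow> val list" where
  "solve W U = dec_list (foldr (\<lambda>_ r. enc_list (step W U (dec_list r))) U (Num 0))"

definition root :: "val \<Rightarrow> int" where
  "root x = numv (hd_val (hd_val x))"

definition doubled_verts :: "val \<Rightarrow> val list" where
  "doubled_verts x = concat (map (\<lambda>v. [Num (2 * numv v), Num (2 * numv v + 1)]) (dec_list (hd_val x)))"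

text \<open>A product suffices in place of a least common multiple: its bit length is at most the
  sum of those of the factors.\<close>

definition denominator :: "val \<Rightarrow> int" where
  "denominator x = prod_list (map (\<lambda>e. numv (fld 4 e)) (dec_list (tl_val x)))"

text \<open>The number \<open>4 * e + 2 * d + i\<close> determines edge, direction and copy, and
  halving it forgets the copy, so \<open>uid u div 2\<close> names the arc. The weight is multiplied
  by the common denominator \<open>D\<close> to become an integer.\<close>

definition element :: "int \<Rightarrow> val \<Rightarrow> int \<Rightarrow> int \<Rightarrow> val" where
  "element D e d i = enc_list
     [Num (4 * numv (fld 0 e) + 2 * d + i), fld 0 e,
      Num (2 * numv (fld 1 e) + i), Num (2 * numv (fld 2 e) + i),
      Num (numv (if d = 1 then fld 2 e else fld 1 e)),
      Num (numv (fld 3 e) * (D div numv (fld 4 e))), fld 5 e]"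

definition ground :: "val \<Rightarrow> val list" where
  "ground x = filter (\<lambda>u. \<not> target u = root x) (concat (map (\<lambda>e.
     [element (denominator x) e 0 0, element (denominator x) e 0 1,
      element (denominator x) e 1 0, element (denominator x) e 1 1]) (dec_list (tl_val x))))"

definition algorithm :: "val \<Rightarrow> val list" where
  "algorithm x = (if \<forall>e\<in>set (dec_list (tl_val x)). numv (fld 5 e) = 1 then []
     else map (\<lambda>u. fld 1 u) (solve (doubled_verts x) (ground x)))"

section \<open>Polynomial running time of the algorithm\<close>

lemma pt_fields [pt_intros]:
  assumes "pt f"
  shows "pt (\<lambda>c. Num (uid (f c)))" "pt (\<lambda>c. Num (end1 (f c)))" "pt (\<lambda>c. Num (end2 (f c)))"
    "pt (\<lambda>c. Num (target (f c)))" "pt (\<lambda>c. Num (wt (f c)))" "pt (\<lambda>c. bv (is_safe (f c)))"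
  unfolding uid_def end1_def end2_def target_def wt_def is_safe_def
  by (intro pt_intros assms)+

text \<open>Inside quantifiers and filters the context is only a component of a packed argument.
  Composing the hypotheses by \<open>pt_comp\<close> makes them usable there, here and in the lemmas
  that follow.\<close>

lemma pt_mem [pt_intros]:
  assumes "pt (\<lambda>c. enc_list (I c))" "pt f"
  shows "pt (\<lambda>c. bv (mem (I c) (f c)))"
  unfolding mem_def by (intro pt_intros assms pt_comp[OF assms(2)] pt_comp[OF assms(1)])

lemma pt_del [pt_intros]:
  assumes "pt (\<lambda>c. enc_list (I c))" "pt f"
  shows "pt (\<lambda>c. enc_list (del (I c) (f c)))"
  unfolding del_def by (intro pt_intros assms pt_comp[OF assms(2)] pt_comp[OF assms(1)])

lemma vsize_filter: "vsize (enc_list (filter P xs)) \<le> vsize (enc_list xs)"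
  by (induction xs) auto

lemma pt_reach_step [pt_intros]:
  assumes "pt (\<lambda>c. enc_list (W c))" "pt (\<lambda>c. enc_list (I c))" "pt (\<lambda>c. enc_list (R c))"
  shows "pt (\<lambda>c. enc_list (reach_step (W c) (I c) (R c)))"
  unfolding reach_step_def by (intro pt_intros assms assms[THEN pt_comp])

lemma pt_reach [pt_intros]:
  assumes "pt (\<lambda>c. enc_list (W c))" "pt (\<lambda>c. enc_list (I c))" "pt (\<lambda>c. Num (a c))"
  shows "pt (\<lambda>c. enc_list (reach (W c) (I c) (a c)))"
  unfolding reach_def
proof (intro pt_list_dec pt_foldr_abs)
  obtain q where "\<And>c. vsize (enc_list (W c)) \<le> poly q (vsize c)"
    using pt_vsize[OF assms(1)] by blast
  then show "\<exists>q. \<forall>x r c. vsize (enc_list (reach_step (W c) (I c) (dec_list r))) \<le> poly q (vsize c)"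
    unfolding reach_step_def by (meson le_trans vsize_filter)
qed (intro pt_intros assms assms[THEN pt_comp])+

lemma pt_ind1 [pt_intros]:
  assumes "pt (\<lambda>c. enc_list (W c))" "pt (\<lambda>c. enc_list (I c))"
  shows "pt (\<lambda>c. bv (ind1 (W c) (I c)))"
  unfolding ind1_def by (intro pt_intros assms assms[THEN pt_comp])

lemma pt_ind2 [pt_intros]:
  assumes "pt (\<lambda>c. enc_list (I c))"
  shows "pt (\<lambda>c. bv (ind2 (I c)))"
  unfolding ind2_def by (intro pt_intros assms assms[THEN pt_comp])

lemma pt_srcb [pt_intros]:
  assumes "pt (\<lambda>c. enc_list (W c))" "pt (\<lambda>c. enc_list (I c))" "pt f"
  shows "pt (\<lambda>c. bv (srcb (W c) (I c) (f c)))"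
  unfolding srcb_def by (intro pt_intros assms)

lemma pt_snkb [pt_intros]:
  assumes "pt (\<lambda>c. enc_list (I c))" "pt f"
  shows "pt (\<lambda>c. bv (snkb (I c) (f c)))"
  unfolding snkb_def by (intro pt_intros assms)

lemma pt_arcb [pt_intros]:
  assumes "pt (\<lambda>c. enc_list (W c))" "pt (\<lambda>c. enc_list (I c))" "pt f" "pt g"
  shows "pt (\<lambda>c. bv (arcb (W c) (I c) (f c) (g c)))"
  unfolding arcb_def by (intro pt_intros assms)

lemma pt_walk_cost [pt_intros]:
  assumes "pt (\<lambda>c. enc_list (I c))" "pt f"
  shows "pt (\<lambda>c. Num (walk_cost (I c) (f c)))"
  unfolding walk_cost_def by (intro pt_intros assms assms[THEN pt_comp])

lemma pt_cheapest [pt_intros]: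
  assumes "pt (\<lambda>c. enc_list (I c))" "pt (\<lambda>c. enc_list (C c))"
  shows "pt (\<lambda>c. enc_list (cheapest (I c) (C c)))"
  unfolding cheapest_def by (intro pt_intros assms assms[THEN pt_comp])

lemma pt_shortest [pt_intros]:
  assumes "pt (\<lambda>c. enc_list (C c))"
  shows "pt (\<lambda>c. enc_list (shortest (C c)))"
  unfolding shortest_def by (intro pt_intros assms assms[THEN pt_comp])

lemma pt_extend_walks [pt_intros]:
  assumes "pt (\<lambda>c. enc_list (W c))" "pt (\<lambda>c. enc_list (U c))" "pt (\<lambda>c. enc_list (I c))" "pt (\<lambda>c. enc_list (L c))"
  shows "pt (\<lambda>c. enc_list (extend_walks (W c) (U c) (I c) (L c)))"
  unfolding extend_walks_def by (intro pt_intros assms assms[THEN pt_comp])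

lemma levels_foldr:
  "foldr (\<lambda>_ r. Cell (enc_list (extend_walks W U I (dec_list (hd_val r)))) r) ys (enc_list [enc_list (level W U I 0)])
   = enc_list (map (\<lambda>k. enc_list (level W U I k)) (rev [0..<Suc (length ys)]))"
  by (induction ys) auto

lemma length_level: "length (level W U I k) \<le> length U"
proof (cases k)
  case (Suc j)
  have "length (concat (map (\<lambda>v. take 1 (f v)) U)) \<le> length U" for f :: "val \<Rightarrow> val list"
    by (induction U) (auto simp: min_def)
  then show ?thesis using Suc by (simp add: extend_walks_def)
qed simp

lemma vsize_level: "p \<in> set (level W U I k) \<Longrightarrow> vsize p \<le> Suc k * (vsize (enc_list U) + 2)"
proof (induction k arbitrary: p)
  case 0
  then show ?case using enc_list_vsize by fastforce
next
  case (Suc k)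
  then obtain v q where "v \<in> set U" "q \<in> set (level W U I k)" "p = Cell v q"
    by (fastforce simp: extend_walks_def cheapest_def dest: in_set_takeD)
  then show ?case using Suc.IH[of q] enc_list_vsize[of v U] by simp
qed

lemma vsize_enc_list_le:
  "(\<And>x. x \<in> set xs \<Longrightarrow> vsize x \<le> B) \<Longrightarrow> vsize (enc_list xs) \<le> 1 + length xs * (1 + B)"
  by (induction xs) fastforce+

text \<open>A round applied to an arbitrary accumulator has no useful size bound, so the actual
  accumulators are described. They consist of at most \<open>length U + 1\<close> levels, each with
  at most \<open>length U\<close> walks of at most \<open>length U + 1\<close> elements;
  \<open>?b\<close> multiplies these numbers.\<close>

lemma pt_levels [pt_intros]:
  assumes "pt (\<lambda>c. enc_list (W c))" "pt (\<lambda>c. enc_list (U c))" "pt (\<lambda>c. enc_list (I c))"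
  shows "pt (\<lambda>c. enc_list (levels (W c) (U c) (I c)))"
  unfolding levels_def
proof (intro pt_list_dec pt_foldr)
  obtain q where q: "\<And>c. vsize (enc_list (U c)) \<le> poly q (vsize c)"
    using pt_vsize[OF assms(2)] by blast
  let ?b = "[:1:] + ([:1:] + q) * ([:2:] + q * ([:1:] + ([:1:] + q) * (q + [:2:])))"
  have "vsize (enc_list (map (\<lambda>k. enc_list (level (W c) (U c) (I c) k)) (rev [0..<Suc (length ys)])))
    \<le> poly ?b (vsize c)" if ys: "U c = zs @ ys" for c zs ys
  proof -
    let ?u = "poly q (vsize c)"
    have len: "length (U c) \<le> ?u" using q enc_list_length le_trans by blast
    then have lys: "length ys \<le> ?u" using ys by simp
    have "vsize p \<le> (1 + ?u) * (?u + 2)" if "p \<in> set (level (W c) (U c) (I c) k)" "k \<le> length ys" for p k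
      using vsize_level[OF that(1)]
      by (rule le_trans) (intro mult_le_mono add_mono, use that(2) lys q in auto)
    then have "vsize (enc_list (level (W c) (U c) (I c) k)) \<le> 1 + ?u * (1 + (1 + ?u) * (?u + 2))"
      if "k \<le> length ys" for k
      using that vsize_enc_list_le[of "level (W c) (U c) (I c) k" "(1 + ?u) * (?u + 2)"]
        length_level[of "W c" "U c" "I c" k] len
      by (meson add_left_mono le_trans mult_le_mono1)
    then have "vsize (enc_list (map (\<lambda>k. enc_list (level (W c) (U c) (I c) k)) (rev [0..<Suc (length ys)])))
      \<le> 1 + Suc (length ys) * (1 + (1 + ?u * (1 + (1 + ?u) * (?u + 2))))"
      by (intro le_trans[OF vsize_enc_list_le[where B = "1 + ?u * (1 + (1 + ?u) * (?u + 2))"]]) auto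
    also have "\<dots> \<le> 1 + Suc ?u * (1 + (1 + ?u * (1 + (1 + ?u) * (?u + 2))))"
      using lys by (intro add_mono mult_le_mono) auto
    finally show ?thesis by simp
  qed
  then show "\<exists>pB. \<forall>c zs ys. U c = zs @ ys \<longrightarrow>
     vsize (foldr (\<lambda>x r. Cell (enc_list (extend_walks (W c) (U c) (I c) (dec_list (hd_val r)))) r) ys
       (enc_list [enc_list (level (W c) (U c) (I c) 0)])) \<le> poly pB (vsize c)"
    unfolding levels_foldr by blast
  show "pt (\<lambda>c. enc_list [enc_list (level (W c) (U c) (I c) 0)])"
    unfolding level.simps by (intro pt_intros assms assms[THEN pt_comp])
qed (intro pt_intros assms assms[THEN pt_comp])+

lemma pt_augmenting [pt_intros]:
  assumes "pt (\<lambda>c. enc_list (W c))" "pt (\<lambda>c. enc_list (U c))" "pt (\<lambda>c. enc_list (I c))"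
  shows "pt (\<lambda>c. enc_list (augmenting (W c) (U c) (I c)))"
  unfolding augmenting_def candidates_def by (intro pt_intros assms assms[THEN pt_comp])

lemma pt_step [pt_intros]:
  assumes "pt (\<lambda>c. enc_list (W c))" "pt (\<lambda>c. enc_list (U c))" "pt (\<lambda>c. enc_list (I c))"
  shows "pt (\<lambda>c. enc_list (step (W c) (U c) (I c)))"
  unfolding step_def by (intro pt_intros assms assms[THEN pt_comp])

lemma pt_solve [pt_intros]:
  assumes "pt (\<lambda>c. enc_list (W c))" "pt (\<lambda>c. enc_list (U c))"
  shows "pt (\<lambda>c. enc_list (solve (W c) (U c)))"
  unfolding solve_def
proof (intro pt_list_dec pt_foldr_abs)
  obtain q where "\<And>c. vsize (enc_list (U c)) \<le> poly q (vsize c)"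
    using pt_vsize[OF assms(2)] by blast
  then show "\<exists>q. \<forall>x r c. vsize (enc_list (step (W c) (U c) (dec_list r))) \<le> poly q (vsize c)"
    unfolding step_def by (meson le_trans vsize_filter)
qed (intro pt_intros assms assms[THEN pt_comp])+

lemma pt_element [pt_intros]:
  assumes "pt (\<lambda>c. Num (D c))" "pt e"
  shows "pt (\<lambda>c. element (D c) (e c) d i)"
  unfolding element_def by (intro pt_intros assms)

lemma pt_algorithm: "pt (\<lambda>x. enc_list (algorithm x))"
  unfolding algorithm_def doubled_verts_def ground_def denominator_def root_def
  by (intro pt_intros)

section \<open>Optimality of the computed common independent set\<close>

text \<open>Every round that is not stationary adds an element, so \<open>k\<close> such rounds
  leave at least \<open>k\<close> elements.\<close>

lemma iterate_fixpoint:
  assumes "finite N" and f: "\<And>X. X \<subseteq> N \<Longrightarrow> X \<subseteq> f X \<and> f X \<subseteq> N" and X: "X \<subseteq> N" and n: "card N \<le> n"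
  shows "f ((f ^^ n) X) = (f ^^ n) X"
proof -
  have sub: "(f ^^ k) X \<subseteq> N" for k
    using f X by (induction k) auto
  have "f ((f ^^ k) X) = (f ^^ k) X \<or> k \<le> card ((f ^^ k) X)" for k
  proof (induction k)
    case (Suc k)
    show ?case
    proof (cases "f ((f ^^ k) X) = (f ^^ k) X")
      case False
      then have "(f ^^ k) X \<subset> (f ^^ Suc k) X" using f[OF sub[of k]] by auto
      moreover have "finite ((f ^^ Suc k) X)" using sub \<open>finite N\<close> finite_subset by blast
      ultimately have "card ((f ^^ k) X) < card ((f ^^ Suc k) X)" by (rule psubset_card_mono[rotated])
      then show ?thesis using Suc False by simp
    qed simp
  qed simp
  then consider "f ((f ^^ n) X) = (f ^^ n) X" | "n \<le> card ((f ^^ n) X)" by blast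
  then show ?thesis
  proof cases
    case 2
    then have "(f ^^ n) X = N" using sub[of n] n \<open>finite N\<close> card_seteq by (metis le_trans)
    then show ?thesis using f[of N] by auto
  qed
qed

text \<open>Injectivity of this key says that an unsafe arc occurs in at most one copy. Keys of
  unsafe elements are odd and forget the copy; keys of safe elements are even and all
  different.\<close>

definition arc_key :: "val \<Rightarrow> int" where
  "arc_key u = (if is_safe u then 2 * uid u else 2 * (uid u div 2) + 1)"

definition graphic :: "val list \<Rightarrow> val set \<Rightarrow> bool" where
  "graphic U F \<longleftrightarrow> F \<subseteq> set U \<and> forest end1 end2 F"

definition indegree2 :: "val list \<Rightarrow> val set \<Rightarrow> bool" where
  "indegree2 U F \<longleftrightarrow> F \<subseteq> set U \<and> (\<forall>v. card {y \<in> F. target y = v} \<le> 2) \<and> inj_on arc_key F"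

locale ground_set =
  fixes W U :: "val list"
  assumes distinct_U: "distinct U"
    and inj_uid: "inj_on uid (set U)"
    and ends_U: "\<And>u. u \<in> set U \<Longrightarrow> end1 u \<in> numv ` set W \<and> end2 u \<in> numv ` set W"
    and arc_U: "\<And>u v. u \<in> set U \<Longrightarrow> v \<in> set U \<Longrightarrow> uid u div 2 = uid v div 2 \<Longrightarrow>
      is_safe u = is_safe v \<and> target u = target v"
begin

text \<open>The classes of equal key refine the classes of equal target. This nesting is what makes
  the second system a matroid.\<close>

lemma arc_key_target:
  assumes "u \<in> set U" "v \<in> set U" "arc_key u = arc_key v"
  shows "target u = target v"
proof -
  have "uid u div 2 = uid v div 2"
    using assms(3) by (auto simp: arc_key_def split: if_splits) presburger+
  then show ?thesis using arc_U assms by blast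
qed

text \<open>Some vertex \<open>v\<close> is entered by more elements of \<open>B\<close> than of
  \<open>A\<close>, and one of those elements of \<open>B\<close> has a key that is missing among
  the elements of \<open>A\<close> entering \<open>v\<close>. Equal keys force equal targets, so the
  key is missing in all of \<open>A\<close>.\<close>

lemma indegree2_exchange:
  assumes "indegree2 U A" "indegree2 U B" "card A < card B"
  shows "\<exists>x\<in>B - A. indegree2 U (insert x A)"
proof -
  have fin: "finite A" "finite B" using assms finite_subset unfolding indegree2_def by blast+
  let ?F = "\<lambda>F v. {y \<in> F. target y = v}"
  let ?T = "target ` (A \<union> B)"
  have card: "card F = (\<Sum>v\<in>?T. card (?F F v))" if "F = A \<or> F = B" for F
  proof -
    have "finite F" "F = (\<Union>v\<in>?T. ?F F v)" using fin that by auto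
    moreover have "card (\<Union>v\<in>?T. ?F F v) = (\<Sum>v\<in>?T. card (?F F v))"
      using fin that by (intro card_UN_disjoint) auto
    ultimately show ?thesis by simp
  qed
  have "\<exists>v\<in>?T. card (?F A v) < card (?F B v)"
  proof (rule ccontr)
    assume "\<not> ?thesis"
    then have "(\<Sum>v\<in>?T. card (?F B v)) \<le> (\<Sum>v\<in>?T. card (?F A v))"
      by (intro sum_mono) (auto simp: not_less)
    then have "card B \<le> card A" unfolding card[OF disjI1[OF refl]] card[OF disjI2[OF refl]] .
    then show False using assms(3) by simp
  qed
  then obtain v where v: "card (?F A v) < card (?F B v)" by blast
  have "inj_on arc_key A" "inj_on arc_key B" using assms by (simp_all add: indegree2_def)
  then have inj: "inj_on arc_key (?F A v)" "inj_on arc_key (?F B v)"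
    by (auto intro: inj_on_subset)
  have "\<not> arc_key ` ?F B v \<subseteq> arc_key ` ?F A v"
  proof
    assume "arc_key ` ?F B v \<subseteq> arc_key ` ?F A v"
    then have "card (arc_key ` ?F B v) \<le> card (arc_key ` ?F A v)"
      using fin by (intro card_mono) auto
    then show False using v inj by (simp add: card_image)
  qed
  then obtain x where x: "x \<in> B" "target x = v" "arc_key x \<notin> arc_key ` ?F A v" by auto
  have new: "arc_key x \<notin> arc_key ` A"
  proof
    assume "arc_key x \<in> arc_key ` A"
    then obtain y where "y \<in> A" "arc_key x = arc_key y" by auto
    moreover have "target x = target y"
      using calculation x(1) assms(1,2) by (intro arc_key_target) (auto simp: indegree2_def)
    ultimately show False using x by auto
  qed
  have "card {y \<in> insert x A. target y = u} \<le> 2" for u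
  proof (cases "u = v")
    case True
    then have "{y \<in> insert x A. target y = u} = insert x (?F A v)" using x by auto
    then have "card {y \<in> insert x A. target y = u} \<le> Suc (card (?F A v))"
      using fin by (simp add: card_insert_if)
    also have "\<dots> \<le> card (?F B v)" using v by simp
    finally show ?thesis using assms(2) by (auto simp: indegree2_def intro: le_trans)
  next
    case False
    then have "{y \<in> insert x A. target y = u} = ?F A u" using x by auto
    then show ?thesis using assms(1) by (simp add: indegree2_def)
  qed
  moreover have "x \<notin> A" using new by blast
  ultimately show ?thesis
    using x new assms(1,2) by (intro bexI[of _ x]) (auto simp: indegree2_def)
qed

lemma indegree2_mono: "indegree2 U B \<Longrightarrow> A \<subseteq> B \<Longrightarrow> indegree2 U A"
proof -
  assume B: "indegree2 U B" and "A \<subseteq> B"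
  have "card {y \<in> A. target y = v} \<le> card {y \<in> B. target y = v}" for v
    using B \<open>A \<subseteq> B\<close> finite_subset[of B "set U"] by (intro card_mono) (auto simp: indegree2_def)
  then show ?thesis
    using B \<open>A \<subseteq> B\<close> inj_on_subset unfolding indegree2_def by (meson le_trans order_trans)
qed

sublocale matroid_pair "set U" "graphic U" "indegree2 U"
proof -
  interpret M1: matroid "set U" "graphic U"
    unfolding graphic_def by (rule forest_matroid) simp
  interpret M2: matroid "set U" "indegree2 U"
  proof
    show "indegree2 U {}" by (simp add: indegree2_def)
    show "A \<subseteq> set U" if "indegree2 U A" for A using that by (simp add: indegree2_def)
  qed (use indegree2_exchange indegree2_mono in simp_all)
  show "matroid_pair (set U) (graphic U) (indegree2 U)" by unfold_locales
qed

section \<open>Correctness of the independence tests\<close>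

lemma reach_funpow:
  "reach W I a = (reach_step W I ^^ length W) [Num a]"
proof -
  have "foldr (\<lambda>_ r. enc_list (reach_step W I (dec_list r))) ys (enc_list [Num a]) =
    enc_list ((reach_step W I ^^ length ys) [Num a])" for ys :: "val list"
    by (induction ys) auto
  then show ?thesis by (simp add: reach_def)
qed

text \<open>Each vertex that is added arises from an earlier one by adding or subtracting an edge
  vector. Conversely, the fixed point is closed under edges, so \<open>edge_span_closed\<close>
  separates it from every other vertex.\<close>

lemma mem_reach:
  assumes I: "set I \<subseteq> set U" and a: "a \<in> numv ` set W" and b: "b \<in> numv ` set W"
  shows "(\<exists>z\<in>set (reach W I a). numv z = b) \<longleftrightarrow> diff_vec a b \<in> edge_span end1 end2 (set I)"
proof -
  define N where "N = numv ` set W"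
  define f where "f X = {v \<in> N. v \<in> X \<or> (\<exists>x\<in>set I. end2 x = v \<and> end1 x \<in> X \<or> end1 x = v \<and> end2 x \<in> X)}"
    for X
  have step: "numv ` set (reach_step W I R) = f (numv ` set R)" for R
    unfolding reach_step_def f_def N_def by (auto 4 4 simp: image_iff)
  have set_eq: "numv ` set ((reach_step W I ^^ k) [Num a]) = (f ^^ k) {a}" for k
    by (induction k) (auto simp: step)
  define X where "X = (f ^^ length W) {a}"
  have fN: "f Y \<subseteq> N" and infl: "Y \<subseteq> N \<Longrightarrow> Y \<subseteq> f Y" for Y by (auto simp: f_def)
  have XN: "(f ^^ k) {a} \<subseteq> N" for k using a fN by (cases k) (auto simp: N_def)
  have "card N \<le> length W"
    unfolding N_def by (metis card_image_le card_length le_trans List.finite_set)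
  then have fix_X: "f X = X"
    unfolding X_def using a fN infl by (intro iterate_fixpoint[of N]) (auto simp: N_def)
  have span: "c \<in> (f ^^ k) {a} \<Longrightarrow> diff_vec a c \<in> edge_span end1 end2 (set I)" for c k
  proof (induction k arbitrary: c)
    case 0
    then show ?case by (simp add: edge_span_refl)
  next
    case (Suc k)
    let ?Y = "(f ^^ k) {a}"
    have "c \<in> f ?Y" using Suc.prems by simp
    then consider "c \<in> ?Y" | x where "x \<in> set I" "end2 x = c" "end1 x \<in> ?Y"
      | x where "x \<in> set I" "end1 x = c" "end2 x \<in> ?Y"
      unfolding f_def[of ?Y] by blast
    then show ?case
      using Suc.IH by cases (blast intro: edge_span_step)+
  qed
  have aX: "a \<in> (f ^^ k) {a}" for k
  proof (induction k)
    case (Suc k)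
    then show ?case using infl[OF XN[of k]] by auto
  qed simp
  have closed: "end1 y \<in> X \<longleftrightarrow> end2 y \<in> X" if "y \<in> set I" for y
  proof -
    have "end1 y \<in> N" "end2 y \<in> N" using ends_U I that by (auto simp: N_def)
    then have "end1 y \<in> X \<Longrightarrow> end2 y \<in> f X" "end2 y \<in> X \<Longrightarrow> end1 y \<in> f X"
      using that unfolding f_def by blast+
    then show ?thesis using fix_X by auto
  qed
  have "b \<in> X \<longleftrightarrow> diff_vec a b \<in> edge_span end1 end2 (set I)"
  proof
    assume "diff_vec a b \<in> edge_span end1 end2 (set I)"
    moreover have "finite X" using XN finite_subset unfolding X_def N_def by blast
    ultimately show "b \<in> X"
      using edge_span_closed[of X a b "set I" end1 end2] aX closed unfolding X_def by blast
  qed (use span X_def in blast)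
  moreover have "(\<exists>z\<in>set (reach W I a). numv z = b) \<longleftrightarrow> b \<in> X"
    unfolding X_def set_eq[symmetric] reach_funpow by auto
  ultimately show ?thesis by simp
qed

lemma set_del: "set I \<subseteq> set U \<Longrightarrow> u \<in> set U \<Longrightarrow> set (del I u) = set I - {u}"
  using inj_uid unfolding del_def inj_on_def by auto

lemma mem_iff: "set I \<subseteq> set U \<Longrightarrow> u \<in> set U \<Longrightarrow> mem I u \<longleftrightarrow> u \<in> set I"
  using inj_uid unfolding mem_def inj_on_def by auto

lemma ind1_iff:
  assumes "set I \<subseteq> set U"
  shows "ind1 W I \<longleftrightarrow> graphic U (set I)"
proof -
  have "(\<exists>z\<in>set (reach W (del I x) (end1 x)). numv z = end2 x) \<longleftrightarrow>
      diff_vec (end1 x) (end2 x) \<in> edge_span end1 end2 (set I - {x})" if "x \<in> set I" for x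
  proof -
    have x: "x \<in> set U" using assms that by blast
    then have del: "set (del I x) = set I - {x}" using set_del assms by blast
    then have "set (del I x) \<subseteq> set U" using assms by auto
    from mem_reach[OF this conjunct1[OF ends_U[OF x]] conjunct2[OF ends_U[OF x]]] show ?thesis
      unfolding del .
  qed
  then show ?thesis
    using assms unfolding ind1_def graphic_def forest_iff by auto
qed

lemma ind2_iff:
  assumes I: "set I \<subseteq> set U" and d: "distinct I"
  shows "ind2 I \<longleftrightarrow> indegree2 U (set I)"
proof -
  have len: "length (filter P I) = card {y \<in> set I. P y}" for P
    using d distinct_card[of "filter P I"] by simp
  have "(\<forall>x\<in>set I. int (card {y \<in> set I. target y = target x}) \<le> 2) \<longleftrightarrow>
    (\<forall>v. card {y \<in> set I. target y = v} \<le> 2)" (is "?L \<longleftrightarrow> ?R")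
  proof
    assume L: ?L
    show ?R
    proof
      fix v
      show "card {y \<in> set I. target y = v} \<le> 2"
      proof (cases "{y \<in> set I. target y = v} = {}")
        case False
        then obtain x where "x \<in> set I" "target x = v" by blast
        then show ?thesis using L by fastforce
      qed (simp only: card.empty)
    qed
  qed fastforce
  moreover have "(\<forall>x\<in>set I. is_safe x \<or> int (card {y \<in> set I. uid y div 2 = uid x div 2}) \<le> 1) \<longleftrightarrow>
    inj_on arc_key (set I)" (is "?L \<longleftrightarrow> ?R")
  proof
    assume L: ?L
    show ?R
    proof (rule inj_onI, rule ccontr)
      fix x y assume xy: "x \<in> set I" "y \<in> set I" "arc_key x = arc_key y" "x \<noteq> y"
      have neq: "uid x \<noteq> uid y" using xy I inj_uid by (auto simp: inj_on_def)
      have "\<not> is_safe x \<and> \<not> is_safe y \<and> uid x div 2 = uid y div 2"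
        using xy(3) neq by (auto simp: arc_key_def split: if_splits) presburger+
      moreover have "card {x, y} \<le> card {z \<in> set I. uid z div 2 = uid x div 2}"
        using calculation xy by (intro card_mono) auto
      ultimately show False using L xy by fastforce
    qed
  next
    assume R: ?R
    show ?L
    proof
      fix x assume x: "x \<in> set I"
      show "is_safe x \<or> int (card {y \<in> set I. uid y div 2 = uid x div 2}) \<le> 1"
      proof (cases "is_safe x")
        case False
        have "y = x" if "y \<in> set I" "uid y div 2 = uid x div 2" for y
        proof -
          have "\<not> is_safe y" using arc_U[of y x] False that x I by auto
          then have "arc_key y = arc_key x" using False that(2) by (simp add: arc_key_def)
          then show ?thesis using R that(1) x by (auto dest: inj_onD)
        qed
        then have "{y \<in> set I. uid y div 2 = uid x div 2} \<subseteq> {x}" by auto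
        then show ?thesis using card_mono[of "{x}"] by fastforce
      qed simp
    qed
  qed
  ultimately show ?thesis
    using I unfolding ind2_def indegree2_def len by auto
qed

lemma srcb_iff: "set I \<subseteq> set U \<Longrightarrow> v \<in> set U \<Longrightarrow> srcb W I v \<longleftrightarrow> v \<in> src (set I)"
  unfolding srcb_def src_def using mem_iff[of I v] ind1_iff[of "v # I"] by auto

lemma snkb_iff: "set I \<subseteq> set U \<Longrightarrow> distinct I \<Longrightarrow> v \<in> set U \<Longrightarrow> snkb I v \<longleftrightarrow> v \<in> snk (set I)"
  unfolding snkb_def snk_def using mem_iff[of I v] ind2_iff[of "v # I"] by auto

lemma arcb_iff:
  assumes I: "set I \<subseteq> set U" "distinct I" and u: "u \<in> set U" and v: "v \<in> set U"
  shows "arcb W I u v \<longleftrightarrow> arc (set I) u v"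
proof -
  have "distinct (u # del I v)" if "u \<notin> set I"
    using that I(2) by (auto simp: del_def)
  then show ?thesis
    unfolding arcb_def arc_def
    using assms mem_iff[OF I(1) u] mem_iff[OF I(1) v] set_del[OF I(1) u] set_del[OF I(1) v]
      ind1_iff[of "v # del I u"] ind2_iff[of "u # del I v"] by auto
qed

section \<open>Correctness of the walk search\<close>

lemma walk_cost_eq:
  assumes "set I \<subseteq> set U" "set (dec_list p) \<subseteq> set U"
  shows "walk_cost I p = cost wt (set I) (dec_list p)"
proof -
  have "map (\<lambda>u. if mem I u then - wt u else wt u) (dec_list p) =
    map (\<lambda>u. if u \<in> set I then - wt u else wt u) (dec_list p)"
    using assms mem_iff by (intro map_cong) auto
  then show ?thesis unfolding walk_cost_def cost_def by (rule arg_cong)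
qed

lemma walk_subset: "set I \<subseteq> set U \<Longrightarrow> is_walk (arc (set I)) (src (set I)) UNIV p \<Longrightarrow> set p \<subseteq> set U"
  by (induction p) (auto simp: is_walk_Cons_iff src_def arc_def split: if_splits)

lemma cheapest_exists:
  assumes "c \<in> set C"
  shows "\<exists>p\<in>set (cheapest I C). walk_cost I p \<le> walk_cost I c"
proof -
  have ne: "C \<noteq> []" using assms by auto
  let ?p = "arg_min_on (walk_cost I) (set C)"
  have "?p \<in> set C" "\<And>q. q \<in> set C \<Longrightarrow> walk_cost I ?p \<le> walk_cost I q"
    using arg_min_if_finite[of "set C" "walk_cost I"] ne by (auto simp: not_less)
  then show ?thesis using assms by (intro bexI[of _ ?p]) (auto simp: cheapest_def)
qed

lemma shortest_exists: "C \<noteq> [] \<Longrightarrow> shortest C \<noteq> []"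
proof -
  assume "C \<noteq> []"
  let ?f = "\<lambda>p. length (dec_list p)"
  let ?p = "arg_min_on ?f (set C)"
  have "?p \<in> set C" "\<And>q. q \<in> set C \<Longrightarrow> ?f ?p \<le> ?f q"
    using arg_min_if_finite[of "set C" ?f] \<open>C \<noteq> []\<close> by (auto simp: not_less)
  then have "?p \<in> set (shortest C)" by (auto simp: shortest_def)
  then show ?thesis by (cases "shortest C") auto
qed

lemma extend_walks_iff:
  "p \<in> set (extend_walks W U I L) \<Longrightarrow> \<exists>v q. v \<in> set U \<and> q \<in> set L \<and> p = Cell v q \<and> arcb W I (hd_val q) v"
  by (fastforce simp: extend_walks_def cheapest_def dest: in_set_takeD)

lemma level_sound:
  assumes "set I \<subseteq> set U" "distinct I" "p \<in> set (level W U I k)"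
  shows "is_walk (arc (set I)) (src (set I)) UNIV (dec_list p) \<and> length (dec_list p) = Suc k \<and>
    hd_val p = hd (dec_list p)"
  using assms(3)
proof (induction k arbitrary: p)
  case 0
  then show ?case using srcb_iff[OF assms(1)] by (auto simp: is_walk_Cons_iff)
next
  case (Suc k)
  then obtain v q where q: "v \<in> set U" "q \<in> set (level W U I k)" "p = Cell v q" "arcb W I (hd_val q) v"
    using extend_walks_iff[of p I "level W U I k"] Suc.prems by auto
  note IH = Suc.IH[OF q(2)]
  then have "set (dec_list q) \<subseteq> set U" "dec_list q \<noteq> []" using walk_subset[OF assms(1)] by auto
  then have "hd (dec_list q) \<in> set U" using hd_in_set by blast
  then show ?case using IH q arcb_iff[OF assms(1,2)] by (auto simp: is_walk_Cons_iff)
qed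

text \<open>Walks need not be simple, so the tail of \<open>q\<close> may be replaced by the
  recorded walk with the same end, which costs no more.\<close>

lemma level_complete:
  assumes "set I \<subseteq> set U" "distinct I" "is_walk (arc (set I)) (src (set I)) UNIV q" "length q = Suc k"
  shows "\<exists>p\<in>set (level W U I k). hd (dec_list p) = hd q \<and> walk_cost I p \<le> cost wt (set I) q"
  using assms(3,4)
proof (induction k arbitrary: q)
  case 0
  then obtain v where v: "q = [v]" by (cases q) auto
  then have "v \<in> src (set I)" using 0 by (simp add: is_walk_Cons_iff)
  then show ?case
    using srcb_iff[OF assms(1), of v] mem_iff[OF assms(1), of v] v
    by (auto simp: src_def walk_cost_def cost_def)
next
  case (Suc k)
  then obtain v q' where v: "q = v # q'" "length q' = Suc k" by (cases q) auto
  then have ne: "q' \<noteq> []" by auto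
  then have q': "arc (set I) (hd q') v" "is_walk (arc (set I)) (src (set I)) UNIV q'"
    using Suc.prems v by (auto simp: is_walk_Cons_iff)
  have sub: "set q \<subseteq> set U" using walk_subset[OF assms(1) Suc.prems(1)] .
  obtain p where p: "p \<in> set (level W U I k)" "hd (dec_list p) = hd q'" "walk_cost I p \<le> cost wt (set I) q'"
    using Suc.IH[OF q'(2) v(2)] by blast
  have vU: "v \<in> set U" and hU: "hd q' \<in> set U" using sub v ne by auto
  let ?C = "map (\<lambda>p. Cell v p) (filter (\<lambda>p. arcb W I (hd_val p) v) (level W U I k))"
  have "hd_val p = hd q'" using level_sound[OF assms(1,2) p(1)] p(2) by simp
  then have "Cell v p \<in> set ?C"
    using p(1) q'(1) arcb_iff[OF assms(1,2) hU vU] by auto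
  then obtain r where r: "r \<in> set (cheapest I ?C)" using cheapest_exists by blast
  then have tk: "take 1 (cheapest I ?C) = [hd (cheapest I ?C)]" by (cases "cheapest I ?C") auto
  let ?h = "hd (cheapest I ?C)"
  have hC: "?h \<in> set (cheapest I ?C)" using r by (cases "cheapest I ?C") auto
  then have "walk_cost I ?h \<le> walk_cost I (Cell v p)"
    using \<open>Cell v p \<in> set ?C\<close> by (auto simp: cheapest_def)
  also have "\<dots> \<le> cost wt (set I) q"
    using p(3) v mem_iff[OF assms(1) vU] by (auto simp: walk_cost_def cost_def)
  finally have "walk_cost I ?h \<le> cost wt (set I) q" .
  moreover have "hd (dec_list ?h) = hd q" using hC v by (auto simp: cheapest_def)
  moreover have "?h \<in> set (level W U I (Suc k))"
    unfolding level.simps extend_walks_def set_concat set_map UN_iff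
    by (rule bexI[OF _ imageI[OF vU]]) (simp only: tk list.set insertI1)
  ultimately show ?case by blast
qed

lemma candidates_iff:
  "p \<in> set (candidates W U I) \<longleftrightarrow> (\<exists>k\<le>length U. p \<in> set (level W U I k) \<and> snkb I (hd_val p))"
proof -
  have "set (levels W U I) = (\<lambda>k. enc_list (level W U I k)) ` {..length U}"
    unfolding levels_def levels_foldr
    by (simp add: atLeast0LessThan lessThan_Suc_atMost del: upt_Suc)
  then show ?thesis unfolding candidates_def by auto
qed

lemma augmenting_spec:
  assumes I: "set I \<subseteq> set U" "distinct I"
  defines "N \<equiv> Suc (length U)" and "walk \<equiv> is_walk (arc (set I)) (src (set I)) (snk (set I))"
  shows "augmenting W U I \<noteq> [] \<longleftrightarrow> (\<exists>q. walk q \<and> length q \<le> N)"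
    and "p \<in> set (augmenting W U I) \<Longrightarrow> walk (dec_list p) \<and> length (dec_list p) \<le> N \<and>
      (\<forall>q. walk q \<longrightarrow> length q \<le> N \<longrightarrow> cost wt (set I) (dec_list p) \<le> cost wt (set I) q \<and>
        (cost wt (set I) (dec_list p) = cost wt (set I) q \<longrightarrow> length (dec_list p) \<le> length q))"
proof -
  have sound: "walk (dec_list p) \<and> length (dec_list p) \<le> N \<and> walk_cost I p = cost wt (set I) (dec_list p)"
    if cand: "p \<in> set (candidates W U I)" for p
  proof -
    obtain k where k: "k \<le> length U" "p \<in> set (level W U I k)" "snkb I (hd_val p)"
      using cand candidates_iff by blast
    note s = level_sound[OF I k(2)]
    then have sub: "set (dec_list p) \<subseteq> set U" using walk_subset[OF I(1)] by blast
    then have "hd (dec_list p) \<in> set U" using s by (cases "dec_list p") auto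
    then have "hd (dec_list p) \<in> snk (set I)" using snkb_iff[OF I] k(3) s by auto
    then have "walk (dec_list p)" using s by (simp add: walk_def is_walk_def)
    then show ?thesis using s k(1) walk_cost_eq[OF I(1) sub] by (simp add: N_def)
  qed
  have complete: "\<exists>p\<in>set (candidates W U I). length (dec_list p) = length q \<and> walk_cost I p \<le> cost wt (set I) q"
    if q: "walk q" "length q \<le> N" for q
  proof -
    obtain k where k: "length q = Suc k" using q(1) by (cases q) (auto simp: walk_def is_walk_def)
    have w: "is_walk (arc (set I)) (src (set I)) UNIV q" using q(1) by (simp add: walk_def is_walk_def)
    obtain p where p: "p \<in> set (level W U I k)" "hd (dec_list p) = hd q" "walk_cost I p \<le> cost wt (set I) q"
      using level_complete[OF I w k] by blast
    have "hd q \<in> snk (set I)" using q(1) by (simp add: walk_def is_walk_def)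
    moreover have "hd q \<in> set U" using calculation by (simp add: snk_def)
    ultimately have "snkb I (hd_val p)" using snkb_iff[OF I] level_sound[OF I p(1)] p(2) by simp
    then have "p \<in> set (candidates W U I)" using p(1) k q(2) by (auto simp: candidates_iff N_def)
    then show ?thesis using p level_sound[OF I p(1)] k by auto
  qed
  have aug: "p \<in> set (candidates W U I) \<and> (\<forall>q\<in>set (candidates W U I). walk_cost I p \<le> walk_cost I q) \<and>
     (\<forall>q\<in>set (candidates W U I). walk_cost I q \<le> walk_cost I p \<longrightarrow> length (dec_list p) \<le> length (dec_list q))"
    if "p \<in> set (augmenting W U I)" for p
    using that unfolding augmenting_def shortest_def cheapest_def by fastforce
  show "augmenting W U I \<noteq> [] \<longleftrightarrow> (\<exists>q. walk q \<and> length q \<le> N)"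
  proof
    assume "augmenting W U I \<noteq> []"
    then have "hd (augmenting W U I) \<in> set (augmenting W U I)" by simp
    then show "\<exists>q. walk q \<and> length q \<le> N" using aug sound by blast
  next
    assume "\<exists>q. walk q \<and> length q \<le> N"
    then obtain p where "p \<in> set (candidates W U I)" using complete by blast
    then have "cheapest I (candidates W U I) \<noteq> []" using cheapest_exists[of p "candidates W U I" I] by auto
    then show "augmenting W U I \<noteq> []" unfolding augmenting_def by (rule shortest_exists)
  qed
  assume p: "p \<in> set (augmenting W U I)"
  have "cost wt (set I) (dec_list p) \<le> cost wt (set I) q \<and>
        (cost wt (set I) (dec_list p) = cost wt (set I) q \<longrightarrow> length (dec_list p) \<le> length q)"
    if q: "walk q" "length q \<le> N" for q
  proof -
    obtain p' where p': "p' \<in> set (candidates W U I)" "length (dec_list p') = length q"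
      "walk_cost I p' \<le> cost wt (set I) q" using complete[OF q] by blast
    have "walk_cost I p \<le> walk_cost I p'" "walk_cost I p' \<le> walk_cost I p \<Longrightarrow> length (dec_list p) \<le> length q"
      using aug[OF p] p'(1,2) by auto
    moreover have "walk_cost I p = cost wt (set I) (dec_list p)" using aug[OF p] sound by blast
    ultimately show ?thesis using p'(3) by linarith
  qed
  then show "walk (dec_list p) \<and> length (dec_list p) \<le> N \<and>
      (\<forall>q. walk q \<longrightarrow> length q \<le> N \<longrightarrow> cost wt (set I) (dec_list p) \<le> cost wt (set I) q \<and>
        (cost wt (set I) (dec_list p) = cost wt (set I) q \<longrightarrow> length (dec_list p) \<le> length q))"
    using aug[OF p] sound by blast
qed

text \<open>The invariant of the main loop. The splitting certifies that \<open>I\<close> is a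
  cheapest common independent set of its size, but it is never computed.\<close>

definition split_optimal :: "val list \<Rightarrow> bool" where
  "split_optimal I \<longleftrightarrow> distinct I \<and> set I \<subseteq> set U \<and> (\<exists>w1 w2. (\<forall>x. w1 x + w2 x = wt x) \<and>
     M1.locally_optimal w1 (set I) \<and> M2.locally_optimal w2 (set I))"

lemma step_augments:
  assumes I: "split_optimal I" and J: "graphic U J" "indegree2 U J" "card J = Suc (card (set I))"
  shows "split_optimal (step W U I) \<and> card (set (step W U I)) = Suc (card (set I))"
proof -
  obtain w1 w2 where w: "\<And>x. w1 x + w2 x = wt x"
    and opt: "M1.locally_optimal w1 (set I)" "M2.locally_optimal w2 (set I)"
    and d: "distinct I" and s: "set I \<subseteq> set U" using I unfolding split_optimal_def by blast
  note ex = walk_exists[OF opt J, unfolded w]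
  have cardU: "card (set U) \<le> Suc (length U)" using card_length le_SucI by blast
  then have ne: "augmenting W U I \<noteq> []"
    using ex(1) augmenting_spec(1)[OF s d] le_trans by blast
  define p where "p = hd (augmenting W U I)"
  have p: "p \<in> set (augmenting W U I)" "p = hd_val (enc_list (augmenting W U I))"
    unfolding p_def using ne by (cases "augmenting W U I"; simp)+
  note spec = augmenting_spec(2)[OF s d p(1)]
  let ?I = "(set I - set (dec_list p)) \<union> (set (dec_list p) - set I)"
  have sub: "set (dec_list p) \<subseteq> set U"
    using spec walk_subset[OF s] by (auto simp: is_walk_def)
  have step: "set (step W U I) = ?I"
    using ne mem_iff[OF s] mem_iff[OF sub] s sub unfolding step_def p(2)[symmetric] by auto
  obtain v1 v2 where "\<And>x. v1 x + v2 x = wt x" "M1.locally_optimal v1 ?I" "M2.locally_optimal v2 ?I"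
    "card ?I = Suc (card (set I))"
    using ex(2)[of "dec_list p" "Suc (length U)"] spec cardU by blast
  moreover have "?I \<subseteq> set U" using s sub by blast
  moreover have "distinct (step W U I)" using distinct_U by (simp add: step_def)
  ultimately show ?thesis
    unfolding split_optimal_def step by blast
qed

lemma step_id:
  assumes "set I \<subseteq> set U" "distinct I" "snk (set I) = {}"
  shows "set (step W U I) = set I" "distinct (step W U I)"
proof -
  have "augmenting W U I = []"
    using augmenting_spec(1)[OF assms(1,2)] assms(3) by (auto simp: is_walk_def)
  then show "set (step W U I) = set I"
    using mem_iff[OF assms(1)] assms(1) unfolding step_def by auto
qed (simp add: step_def distinct_U)

text \<open>Optimality holds in both halves of the splitting and is added up. The bound
  \<open>max\<close> concerns the second matroid alone: once the size of \<open>J\<close> is reached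
  there is no sink left, so the remaining rounds change nothing and the final size is exactly
  \<open>card J\<close>.\<close>

theorem solve_optimal:
  assumes J: "graphic U J" "indegree2 U J"
    and max: "\<And>F. indegree2 U F \<Longrightarrow> card F \<le> card J"
  shows "distinct (solve W U)" "graphic U (set (solve W U))" "indegree2 U (set (solve W U))"
    "card (set (solve W U)) = card J" "sum wt (set (solve W U)) \<le> sum wt J"
proof -
  define S where "S k = ((step W U) ^^ k) []" for k
  have "foldr (\<lambda>_ r. enc_list (step W U (dec_list r))) ys (Num 0) = enc_list (S (length ys))" for ys :: "val list"
    by (induction ys) (auto simp: S_def)
  then have solve: "solve W U = S (length U)" by (simp add: solve_def)
  have inv: "split_optimal (S k) \<and> min k (card J) \<le> card (set (S k))" for k
  proof (induction k)
    case 0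
    \<comment> \<open>The initial splitting puts all the weight into the first matroid.\<close>
    have "M1.locally_optimal wt {}" "M2.locally_optimal (\<lambda>x. 0) {}"
      by (simp_all add: M1.locally_optimal_def M2.locally_optimal_def M1.indep_empty M2.indep_empty)
    then have "split_optimal []" unfolding split_optimal_def by force
    then show ?case by (simp add: S_def)
  next
    case (Suc k)
    let ?I = "set (S k)"
    have so: "split_optimal (S k)" using Suc by blast
    show ?case
    proof (cases "card ?I < card J")
      case True
      then obtain J' where J': "J' \<subseteq> J" "card J' = Suc (card ?I)"
        using obtain_subset_with_card_n[of "Suc (card ?I)" J] by auto
      have "split_optimal (S (Suc k)) \<and> card (set (S (Suc k))) = Suc (card ?I)"
        unfolding S_def funpow.simps o_def
        by (rule step_augments[OF so[unfolded S_def]])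
          (use J' J M1.indep_mono M2.indep_mono in \<open>auto simp: S_def\<close>)
      then show ?thesis using Suc by auto
    next
      case False
      have "snk ?I = {}"
      proof (rule ccontr)
        assume "snk ?I \<noteq> {}"
        then obtain x where "x \<notin> ?I" "indegree2 U (insert x ?I)" by (auto simp: snk_def)
        then show False using max[of "insert x ?I"] False by simp
      qed
      then have "set (S (Suc k)) = ?I" "distinct (S (Suc k))"
        using so step_id[of "S k"] by (auto simp: S_def split_optimal_def)
      then show ?thesis using so False unfolding split_optimal_def by auto
    qed
  qed
  have so: "split_optimal (solve W U)" using inv solve by simp
  then obtain w1 w2 where w: "\<And>x. w1 x + w2 x = wt x"
    and opt: "M1.locally_optimal w1 (set (solve W U))" "M2.locally_optimal w2 (set (solve W U))"
    unfolding split_optimal_def by blast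
  show "distinct (solve W U)" using so by (simp add: split_optimal_def)
  show ind: "graphic U (set (solve W U))" "indegree2 U (set (solve W U))"
    using opt M1.locally_optimal_indep M2.locally_optimal_indep by blast+
  have "card J \<le> length U"
    using J(1) card_mono[of "set U" J] card_length[of U] by (auto simp: graphic_def)
  then show card: "card (set (solve W U)) = card J"
    using inv[of "length U"] max[OF ind(2)] solve by simp
  have "sum w1 (set (solve W U)) \<le> sum w1 J" "sum w2 (set (solve W U)) \<le> sum w2 J"
    using M1.locally_optimal_le[OF opt(1) J(1)] M2.locally_optimal_le[OF opt(2) J(2)] card by auto
  then show "sum wt (set (solve W U)) \<le> sum wt J"
    by (simp flip: w add: sum.distrib)
qed

end

section \<open>Two trees in a feasible set\<close>

text \<open>The entry point has to come first, so position 0 holds a stub that calls the expression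
  stored at the end, and the remaining code is linked at position 1.\<close>

lemma pt_program:
  assumes "pt f"
  shows "\<exists>P p. \<forall>x. \<exists>t. runs P x (f x) t \<and> t \<le> poly p (vsize x)"
proof -
  obtain Q e p where l: "link 1 Q f e p" using assms pt_def by blast
  let ?P = "Call (Suc (length Q)) [Var 0] # Q @ [e]"
  have "\<exists>t. runs ?P x (f x) t \<and> t \<le> poly (p + p + [:2, 1:]) (vsize x)" for x
  proof -
    obtain t where t: "eval ?P [x] e (f x) t" "t \<le> poly p (vsize x)"
      using linkD[OF l, of "[Call (Suc (length Q)) [Var 0]]" "[e]" x] by auto
    have v: "eval ?P [x] (Var 0) x (Suc (vsize x))" using eval_Var[of 0 "[x]"] by simp
    have "eval ?P [x] (Call (Suc (length Q)) [Var 0]) (f x) (Suc (Suc (vsize x) + 0 + t + vsize (f x)))"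
      by (rule eval_Call[OF evals_Cons[OF v evals_Nil]]) (use t(1) in \<open>auto simp: nth_append\<close>)
    then have "runs ?P x (f x) (Suc (Suc (vsize x) + 0 + t + vsize (f x)))"
      by (simp add: runs_def)
    then show ?thesis using t(2) eval_vsize[OF t(1)] by (intro exI conjI) (assumption, simp)
  qed
  then show ?thesis by blast
qed

text \<open>Produces ears. Minimising the length over all end points in \<open>W\<close> at once
  keeps the interior outside \<open>W\<close> and free of repetitions.\<close>

lemma shortest_path_exit:
  assumes "(u, b) \<in> R\<^sup>*" "u \<notin> W" "b \<in> W"
  obtains n :: nat and q where "q 0 = u" "q n \<in> W" "0 < n" "\<And>i. i < n \<Longrightarrow> (q i, q (Suc i)) \<in> R"
    "\<And>i. i < n \<Longrightarrow> q i \<notin> W" "inj_on q {..<n}"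
proof -
  have ex: "\<exists>n. \<exists>b\<in>W. (u, b) \<in> R ^^ n" using assms by (meson rtrancl_imp_relpow)
  define n where "n = (LEAST n. \<exists>b\<in>W. (u, b) \<in> R ^^ n)"
  have "\<exists>b\<in>W. (u, b) \<in> R ^^ n" using LeastI_ex[OF ex] by (simp add: n_def)
  then obtain q where q: "q 0 = u" "q n \<in> W" "\<And>i. i < n \<Longrightarrow> (q i, q (Suc i)) \<in> R"
    by (auto simp: relpow_fun_conv)
  have min: "n \<le> m" if "(u, b) \<in> R ^^ m" "b \<in> W" for m b
    unfolding n_def using that by (intro Least_le) blast
  have prefix: "(u, q i) \<in> R ^^ i" if "i \<le> n" for i
    unfolding relpow_fun_conv by (rule exI[of _ q]) (use q that in auto)
  have suffix: "(q j, q n) \<in> R ^^ (n - j)" if "j \<le> n" for j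
    unfolding relpow_fun_conv by (rule exI[of _ "\<lambda>i. q (i + j)"]) (use q that in auto)
  have out: "q i \<notin> W" if "i < n" for i
    using min[OF prefix[of i]] that by auto
  have "q i \<noteq> q j" if "i < j" "j < n" for i j
  proof
    assume "q i = q j"
    then have "(u, q n) \<in> R ^^ (i + (n - j))"
      using prefix[of i] suffix[of j] that unfolding relpow_add by auto
    then show False using min q(2) that by fastforce
  qed
  then have "inj_on q {..<n}"
    by (intro inj_onI) (metis lessThan_iff linorder_neqE_nat)
  moreover have "0 < n" using q(1,2) assms(2) by (cases n) auto
  ultimately show thesis using that q out by blast
qed

lemma crossing_edge:
  assumes "(u, v) \<in> (adjacency I T)\<^sup>*" "u \<in> W" "v \<notin> W"
  shows "\<exists>e\<in>T. \<exists>a b. ends I e = {a, b} \<and> a \<in> W \<and> b \<notin> W"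
  using assms by (induction rule: rtrancl_induct) (auto simp: adjacency_def)

text \<open>A tree rooted at \<open>r\<close> that spans \<open>W\<close>, given by the edge
  \<open>\<alpha> v\<close> from each vertex \<open>v\<close> to its parent. The numbering
  \<open>ord\<close> decreases towards the root and thus rules out cycles.\<close>

definition parents :: "('v, 'e) fgc \<Rightarrow> 'e set \<Rightarrow> 'v \<Rightarrow> 'v set \<Rightarrow> ('v \<Rightarrow> 'e) \<Rightarrow> ('v \<Rightarrow> nat) \<Rightarrow> bool" where
  "parents I S r W \<alpha> ord \<longleftrightarrow>
     (\<forall>v\<in>W - {r}. \<alpha> v \<in> S \<and> (\<exists>u\<in>W. ends I (\<alpha> v) = {u, v} \<and> ord u < ord v))"

lemma parents_insert:
  assumes par: "parents I S r W \<alpha> ord"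
    and g: "g \<in> S" "ends I g = {a, p}" "a \<in> W" "p \<notin> W" and M: "ord a \<le> M"
  shows "parents I S r (insert p W) (\<alpha>(p := g)) (ord(p := Suc M))"
  unfolding parents_def
proof
  fix v assume v: "v \<in> insert p W - {r}"
  show "(\<alpha>(p := g)) v \<in> S \<and> (\<exists>u\<in>insert p W. ends I ((\<alpha>(p := g)) v) = {u, v} \<and>
    (ord(p := Suc M)) u < (ord(p := Suc M)) v)"
  proof (cases "v = p")
    case True
    then show ?thesis using g M by (intro conjI bexI[of _ a]) auto
  next
    case False
    then obtain u where "u \<in> W" "ends I (\<alpha> v) = {u, v}" "ord u < ord v" "\<alpha> v \<in> S"
      using par v unfolding parents_def by blast
    then show ?thesis using False g(4) by (intro conjI bexI[of _ u]) auto
  qed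
qed

text \<open>
  Grow the vertex set by ears. An ear is traversed in one direction by the first tree and in
  the other direction by the second, so that no edge is used twice in the same direction; a
  safe edge may be used twice.
\<close>

lemma disjoint_trees:
  assumes inst: "fgc_instance I" and feas: "feasible I S" and f0: "f0 \<in> unsafe I" and r: "r \<in> verts I"
  shows "\<exists>\<alpha> \<beta> o1 o2. parents I S r (verts I) \<alpha> o1 \<and> parents I S r (verts I) \<beta> o2 \<and>
    (\<forall>v\<in>verts I - {r}. \<alpha> v = \<beta> v \<longrightarrow> \<alpha> v \<in> safe I)"
proof -
  define P where "P W \<longleftrightarrow> r \<in> W \<and> W \<subseteq> verts I \<and> (\<exists>\<alpha> \<beta> o1 o2. parents I S r W \<alpha> o1 \<and>
    parents I S r W \<beta> o2 \<and> (\<forall>v\<in>W - {r}. \<alpha> v = \<beta> v \<longrightarrow> \<alpha> v \<in> safe I))" for W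
  have fin: "finite (verts I)" using inst by (simp add: fgc_instance_def)
  have SE: "S \<subseteq> edges I" using feas by (simp add: feasible_def)
  have grow: "\<exists>W'. W \<subset> W' \<and> P W'" if W: "P W" "W \<noteq> verts I" for W
  proof -
    obtain \<alpha> \<beta> o1 o2 where par: "parents I S r W \<alpha> o1" "parents I S r W \<beta> o2"
      and safe: "\<And>v. v \<in> W - {r} \<Longrightarrow> \<alpha> v = \<beta> v \<Longrightarrow> \<alpha> v \<in> safe I"
      using W(1) unfolding P_def by blast
    have rW: "r \<in> W" and WV: "W \<subseteq> verts I" using W by (auto simp: P_def)
    obtain z where z: "z \<in> verts I" "z \<notin> W" using W(2) WV by blast
    have conn: "(u, v) \<in> (adjacency I (S - {f}))\<^sup>*" if "f \<in> unsafe I" "u \<in> verts I" "v \<in> verts I" for f u v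
      using feas that by (auto simp: feasible_def connected_by_def)
    \<comment> \<open>Feasibility yields connectedness only by way of an unsafe edge;
      \<open>f0\<close> supplies it here.\<close>
    obtain g a p where g: "g \<in> S" "ends I g = {a, p}" "a \<in> W" "p \<notin> W"
      using crossing_edge[OF conn[OF f0 r z(1)] rW z(2)] by blast
    have endsV: "ends I e \<subseteq> verts I" if "e \<in> S" for e
      using inst SE that unfolding fgc_instance_def by blast
    have pV: "p \<in> verts I" using endsV[OF g(1)] g(2) by auto
    have finW: "finite W" using WV fin finite_subset by blast
    \<comment> \<open>A common upper bound of both numberings, after which the new vertices are
      numbered.\<close>
    define M where "M = Max (o1 ` W) + Max (o2 ` W)"
    have M: "o1 v \<le> M" "o2 v \<le> M" if "v \<in> W" for v
      unfolding M_def using that finW by (auto intro: trans_le_add1 trans_le_add2)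
    show ?thesis
    proof (cases "g \<in> safe I")
      case True
      have 1: "parents I S r (insert p W) (\<alpha>(p := g)) (o1(p := Suc M))"
        by (rule parents_insert[OF par(1) g M(1)[OF g(3)]])
      have 2: "parents I S r (insert p W) (\<beta>(p := g)) (o2(p := Suc M))"
        by (rule parents_insert[OF par(2) g M(2)[OF g(3)]])
      have "P (insert p W)"
        unfolding P_def using 1 2 rW WV pV safe True
        by (intro conjI exI[of _ "\<alpha>(p := g)"] exI[of _ "\<beta>(p := g)"] exI[of _ "o1(p := Suc M)"]
            exI[of _ "o2(p := Suc M)"]) auto
      then show ?thesis using g(4) by blast
    next
      case False
      then have "g \<in> unsafe I" using g(1) SE by (auto simp: unsafe_def)
      \<comment> \<open>Deleting the unsafe edge \<open>g\<close> leaves a way from \<open>p\<close>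
        back to \<open>W\<close>. Together with \<open>g\<close> it forms an ear whose inner
        vertices are \<open>q 0\<close>, ..., \<open>q (n - 1)\<close>.\<close>
      have "(p, a) \<in> (adjacency I (S - {g}))\<^sup>*"
        using conn[OF \<open>g \<in> unsafe I\<close> pV] g(3) WV by blast
      then obtain n q where q: "q 0 = p" "q n \<in> W" "0 < n"
        "\<And>i. i < n \<Longrightarrow> (q i, q (Suc i)) \<in> adjacency I (S - {g})"
        "\<And>i. i < n \<Longrightarrow> q i \<notin> W" "inj_on q {..<n}"
        using shortest_path_exit[OF _ g(4,3)] by blast
      have "\<forall>i. \<exists>e. i < n \<longrightarrow> e \<in> S - {g} \<and> ends I e = {q i, q (Suc i)}"
        using q(4) unfolding adjacency_def by blast
      then obtain c where c: "\<And>i. i < n \<Longrightarrow> c i \<in> S - {g} \<and> ends I (c i) = {q i, q (Suc i)}" by metis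
      define k where "k = inv_into {..<n} q"
      have k: "k (q i) = i" if "i < n" for i unfolding k_def using q(6) that by simp
      \<comment> \<open>The first tree enters the ear through \<open>g\<close>, so its parent edge
        is the one before the vertex; the second enters at \<open>q n\<close> and uses the edge
        after it. Hence \<open>o1'\<close> increases and \<open>o2'\<close> decreases along the
        ear.\<close>
      define \<alpha>' where "\<alpha>' v = (if v \<in> W then \<alpha> v else if k v = 0 then g else c (k v - 1))" for v
      define \<beta>' where "\<beta>' v = (if v \<in> W then \<beta> v else c (k v))" for v
      define o1' where "o1' v = (if v \<in> W then o1 v else Suc M + k v)" for v
      define o2' where "o2' v = (if v \<in> W then o2 v else Suc M + (n - k v))" for v
      define W' where "W' = W \<union> q ` {..<n}"
      have new: "\<exists>i<n. v = q i" if "v \<in> W'" "v \<notin> W" for v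
        using that by (auto simp: W'_def)
      have qW': "q i \<in> W'" if "i \<le> n" for i
        using that q(2) by (cases "i = n") (auto simp: W'_def)
      have 1: "parents I S r W' \<alpha>' o1'"
        unfolding parents_def
      proof
        fix v assume v: "v \<in> W' - {r}"
        show "\<alpha>' v \<in> S \<and> (\<exists>u\<in>W'. ends I (\<alpha>' v) = {u, v} \<and> o1' u < o1' v)"
        proof (cases "v \<in> W")
          case True
          then obtain u where "u \<in> W" "ends I (\<alpha> v) = {u, v}" "o1 u < o1 v" "\<alpha> v \<in> S"
            using par(1) v unfolding parents_def by blast
          then show ?thesis using True by (intro conjI bexI[of _ u]) (auto simp: \<alpha>'_def o1'_def W'_def)
        next
          case False
          then obtain i where i: "i < n" "v = q i" using new v by blast
          show ?thesis
          proof (cases i)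
            case 0
            then have "\<alpha>' v = g" using i k[of 0] False by (simp add: \<alpha>'_def)
            moreover have "o1' a < o1' v" using M(1)[OF g(3)] g(3) False by (simp add: o1'_def)
            ultimately show ?thesis using g q(1) 0 i by (auto simp: W'_def)
          next
            case (Suc j)
            then have "\<alpha>' v = c j" using i k[of i] False by (simp add: \<alpha>'_def)
            moreover have "o1' (q j) < o1' v" using k[of j] k[of i] i Suc q(5)[of j] False by (simp add: o1'_def)
            ultimately show ?thesis using c[of j] qW'[of j] i Suc by auto
          qed
        qed
      qed
      have 2: "parents I S r W' \<beta>' o2'"
        unfolding parents_def
      proof
        fix v assume v: "v \<in> W' - {r}"
        show "\<beta>' v \<in> S \<and> (\<exists>u\<in>W'. ends I (\<beta>' v) = {u, v} \<and> o2' u < o2' v)"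
        proof (cases "v \<in> W")
          case True
          then obtain u where "u \<in> W" "ends I (\<beta> v) = {u, v}" "o2 u < o2 v" "\<beta> v \<in> S"
            using par(2) v unfolding parents_def by blast
          then show ?thesis using True by (intro conjI bexI[of _ u]) (auto simp: \<beta>'_def o2'_def W'_def)
        next
          case False
          then obtain i where i: "i < n" "v = q i" using new v by blast
          then have \<beta>: "\<beta>' v = c i" using k[of i] False by (simp add: \<beta>'_def)
          have "o2' (q (Suc i)) < o2' v"
          proof (cases "Suc i = n")
            case True
            then show ?thesis using q(2) M(2)[of "q n"] False by (simp add: o2'_def)
          next
            case F: False
            then show ?thesis using k[of i] k[of "Suc i"] i q(5)[of "Suc i"] False by (simp add: o2'_def)
          qed
          then show ?thesis using \<beta> c[OF i(1)] qW'[of "Suc i"] i by (auto simp: insert_commute)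
        qed
      qed
      \<comment> \<open>On the ear the two parent edges differ: \<open>c 0\<close> avoids
        \<open>g\<close>, and equality of consecutive edges \<open>c j\<close> and
        \<open>c i\<close> would identify \<open>q j\<close> with \<open>q (Suc i)\<close>. The
        latter lies in \<open>W\<close> or is another inner vertex, whereas \<open>q j\<close> is
        outside \<open>W\<close>.\<close>
      have 3: "\<alpha>' v \<in> safe I" if v: "v \<in> W' - {r}" "\<alpha>' v = \<beta>' v" for v
      proof (cases "v \<in> W")
        case True
        then show ?thesis using v safe by (simp add: \<alpha>'_def \<beta>'_def)
      next
        case False
        then obtain i where i: "i < n" "v = q i" using new v by blast
        then have \<beta>: "\<beta>' v = c i" using k[of i] False by (simp add: \<beta>'_def)
        show ?thesis
        proof (cases i)
          case 0
          then have "\<alpha>' v = g" using i k[of 0] False by (simp add: \<alpha>'_def)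
          then show ?thesis using \<beta> c[OF i(1)] v(2) by auto
        next
          case (Suc j)
          then have "\<alpha>' v = c j" using i k[of i] False by (simp add: \<alpha>'_def)
          then have "{q j, q i} = {q i, q (Suc i)}" using \<beta> c[OF i(1)] c[of j] v(2) Suc i by simp
          then have "q j = q (Suc i)" using q(6) i Suc by (auto simp: doubleton_eq_iff inj_on_def)
          moreover have "q j \<notin> W" using q(5) Suc i by simp
          ultimately have "Suc i < n" using q(2) i(1) by (metis Suc_lessI)
          then have "j = Suc i" using inj_onD[OF q(6) \<open>q j = q (Suc i)\<close>] Suc i by auto
          then show ?thesis using Suc by simp
        qed
      qed
      have "W' \<subseteq> verts I"
      proof
        fix v assume v: "v \<in> W'"
        show "v \<in> verts I"
        proof (cases "v \<in> W")
          case False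
          then obtain i where i: "i < n" "v = q i" using new v by blast
          then show ?thesis using c[OF i(1)] endsV[of "c i"] by auto
        qed (use WV in blast)
      qed
      then have "P W'"
        unfolding P_def using 1 2 3 rW by (auto simp: W'_def)
      moreover have "p \<in> W'" using q(1,3) by (auto simp: W'_def)
      ultimately show ?thesis using g(4) by (intro exI[of _ W']) (auto simp: W'_def)
    qed
  qed
  have "P {r}" using r by (auto simp: P_def parents_def)
  define X where "X = arg_max card P"
  have bound: "card W \<le> card (verts I)" if "P W" for W
    using that fin card_mono by (auto simp: P_def)
  have X: "P X" "\<And>W. P W \<Longrightarrow> card W \<le> card X"
    using arg_max_nat_lemma[of P "{r}" card "Suc (card (verts I))"] \<open>P {r}\<close> bound
    unfolding X_def by (auto simp: less_Suc_eq_le)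
  have "X = verts I"
  proof (rule ccontr)
    assume "X \<noteq> verts I"
    then obtain W' where W': "X \<subset> W'" "P W'" using grow X(1) by blast
    then have "finite W'" using fin finite_subset unfolding P_def by blast
    then show False using psubset_card_mono[OF _ W'(1)] X(2)[OF W'(2)] by simp
  qed
  then show ?thesis using X(1) unfolding P_def by blast
qed

section \<open>The approximation guarantee\<close>

locale fgc_encoding =
  fixes I :: "(nat, nat) fgc"
  assumes inst: "fgc_instance I"
begin

abbreviation V where "V \<equiv> verts I"
abbreviation E where "E \<equiv> edges I"
abbreviation x where "x \<equiv> enc_fgc I"
abbreviation D where "D \<equiv> denominator x"
abbreviation el where "el e d i \<equiv> element D (enc_edge I e) d i"
abbreviation W where "W \<equiv> doubled_verts x"
abbreviation U where "U \<equiv> ground x"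

definition r where "r = hd (sorted_list_of_set V)"

definition name :: "val \<Rightarrow> nat" where "name u = nat (numv (fld 1 u))"

lemma fin: "finite V" "finite E" "V \<noteq> {}"
  using inst by (auto simp: fgc_instance_def)

lemma r_V: "r \<in> V"
proof -
  have "sorted_list_of_set V \<noteq> []" using fin by simp
  then have "hd (sorted_list_of_set V) \<in> set (sorted_list_of_set V)" by (rule hd_in_set)
  then show ?thesis using fin by (simp add: r_def)
qed

lemma root_eq: "root x = int r"
proof -
  obtain a l where "sorted_list_of_set V = a # l" using fin by (cases "sorted_list_of_set V") auto
  then show ?thesis by (simp add: root_def r_def enc_fgc_def enc_nats_def)
qed

lemma edges_list: "dec_list (tl_val x) = map (enc_edge I) (sorted_list_of_set E)"
  by (simp add: enc_fgc_def)

lemma numv_W: "numv ` set W = {2 * int v + i | v i. v \<in> V \<and> i \<in> {0, 1}}"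
proof -
  have "dec_list (hd_val x) = map (\<lambda>n. Num (int n)) (sorted_list_of_set V)"
    by (simp add: enc_fgc_def enc_nats_def)
  then have "set W = (\<Union>v\<in>V. {Num (2 * int v), Num (2 * int v + 1)})"
    using fin by (auto simp: doubled_verts_def)
  then have W: "numv ` set W = (\<Union>v\<in>V. {2 * int v, 2 * int v + 1})" by (simp add: image_UN)
  show ?thesis
  proof (intro set_eqI iffI)
    fix y assume "y \<in> numv ` set W"
    then obtain v where "v \<in> V" "y = 2 * int v + 0 \<or> y = 2 * int v + 1" unfolding W by auto
    then show "y \<in> {2 * int v + i | v i. v \<in> V \<and> i \<in> {0, 1}}" by blast
  qed (auto simp: W)
qed

lemma ends_eq:
  assumes "e \<in> E"
  shows "ends I e = {Min (ends I e), Max (ends I e)}" "Min (ends I e) \<noteq> Max (ends I e)"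
    "Min (ends I e) \<in> V" "Max (ends I e) \<in> V"
proof -
  have c: "card (ends I e) = 2" "ends I e \<subseteq> V" using inst assms by (auto simp: fgc_instance_def)
  then obtain a b where "ends I e = {a, b}" "a \<noteq> b" by (auto simp: card_2_iff)
  then show *: "ends I e = {Min (ends I e), Max (ends I e)}" "Min (ends I e) \<noteq> Max (ends I e)"
    by (auto simp: min_def max_def)
  then show "Min (ends I e) \<in> V" "Max (ends I e) \<in> V" using c by blast+
qed

lemma fld_numeral [simp]: "fld (numeral n) u = fld (pred_numeral n) (tl_val u)" "fld 1 u = fld 0 (tl_val u)"
  by (simp_all add: numeral_eq_Suc)

lemma el_fields [simp]:
  "uid (el e d i) = 4 * int e + 2 * d + i"
  "hd_val (tl_val (el e d i)) = Num (int e)"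
  "name (el e d i) = e"
  "end1 (el e d i) = 2 * int (Min (ends I e)) + i"
  "end2 (el e d i) = 2 * int (Max (ends I e)) + i"
  "target (el e d i) = int (if d = 1 then Max (ends I e) else Min (ends I e))"
  "is_safe (el e d i) \<longleftrightarrow> e \<in> safe I"
  "wt (el e d i) = fst (quotient_of (weight I e)) * (D div snd (quotient_of (weight I e)))"
  by (simp_all add: uid_def end1_def end2_def target_def is_safe_def wt_def name_def element_def enc_edge_def)

lemma D_dvd: "e \<in> E \<Longrightarrow> snd (quotient_of (weight I e)) dvd D"
  and D_pos: "D > 0"
proof -
  have D: "D = prod_list (map (\<lambda>e. snd (quotient_of (weight I e))) (sorted_list_of_set E))"
    unfolding denominator_def edges_list map_map by (intro arg_cong[where f = prod_list] map_cong)
      (simp_all add: enc_edge_def)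
  show "e \<in> E \<Longrightarrow> snd (quotient_of (weight I e)) dvd D"
    unfolding D using fin by (intro prod_list_dvd) auto
  have "prod_list (map (\<lambda>e. snd (quotient_of (weight I e))) es) > 0" for es
    by (induction es) (auto simp: quotient_of_denom_pos')
  then show "D > 0" unfolding D .
qed

lemma wt_el: "e \<in> E \<Longrightarrow> rat_of_int (wt (el e d i)) = weight I e * of_int D"
proof -
  assume e: "e \<in> E"
  obtain a b where q: "quotient_of (weight I e) = (a, b)" by fastforce
  then have b: "b > 0" "weight I e = of_int a / of_int b"
    using quotient_of_denom_pos quotient_of_div by blast+
  obtain m where m: "D = b * m" using D_dvd[OF e] q by auto
  have "D div b = m" using m b(1) by simp
  then have "wt (el e d i) = a * m" unfolding el_fields(8) q by simp
  moreover have "rat_of_int D = of_int b * of_int m" using m by simp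
  ultimately show ?thesis using b by simp
qed

lemma set_U: "u \<in> set U \<longleftrightarrow> (\<exists>e d i. u = el e d i \<and> e \<in> E \<and> d \<in> {0, 1} \<and> i \<in> {0, 1} \<and> target u \<noteq> int r)"
  unfolding ground_def root_eq edges_list using fin by auto

lemma set_UE:
  assumes "u \<in> set U"
  obtains e d i where "u = el e d i" "e \<in> E" "d \<in> {0, 1}" "i \<in> {0, 1}" "target u \<noteq> int r"
  using assms set_U by blast

sublocale ground_set W U
proof
  have "distinct (concat (map (\<lambda>e. [el e 0 0, el e 0 1, el e 1 0, el e 1 1]) es))" if "distinct es" for es
    using that
  proof (induction es)
    case (Cons e es)
    have neq: "el a d i \<noteq> el b d' i'" if "a \<noteq> b \<or> d \<noteq> d' \<or> i \<noteq> i'" "d \<in> {0, 1}" "d' \<in> {0, 1}" "i \<in> {0, 1}" "i' \<in> {0, 1}"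
      for a b d d' i i'
    proof
      assume eq: "el a d i = el b d' i'"
      then have "a = b" using el_fields(3) by metis
      moreover have "4 * int a + 2 * d + i = 4 * int b + 2 * d' + i'" using eq el_fields(1) by metis
      ultimately show False using that by auto
    qed
    let ?f = "\<lambda>e. [el e 0 0, el e 0 1, el e 1 0, el e 1 1]"
    have names: "name u = a" if "u \<in> set (?f a)" for u a
    proof -
      have "u = el a 0 0 \<or> u = el a 0 1 \<or> u = el a 1 0 \<or> u = el a 1 1" using that by simp
      then show ?thesis by (elim disjE) (simp_all only: el_fields)
    qed
    have "set (?f e) \<inter> set (concat (map ?f es)) = {}"
    proof (rule ccontr)
      assume "\<not> ?thesis"
      then obtain u e' where "u \<in> set (?f e)" "e' \<in> set es" "u \<in> set (?f e')"
        unfolding set_concat set_map by blast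
      then show False using names[of u e] names[of u e'] Cons.prems by (metis distinct.simps(2))
    qed
    moreover have "distinct (?f e)" by (simp add: neq)
    ultimately show ?case
      using Cons.IH Cons.prems unfolding list.map concat.simps distinct_append distinct.simps(2) by blast
  qed simp
  then have "distinct (concat (map (\<lambda>e. [el e 0 0, el e 0 1, el e 1 0, el e 1 1]) (sorted_list_of_set E)))"
    by simp
  then show "distinct U" unfolding ground_def edges_list map_map by (intro distinct_filter) (simp add: o_def)
  show "inj_on uid (set U)"
  proof (rule inj_onI)
    fix u v assume u: "u \<in> set U" and v: "v \<in> set U" and eq: "uid u = uid v"
    from u obtain e d i where 1: "u = el e d i" "d \<in> {0, 1}" "i \<in> {0, 1}" by (rule set_UE)
    from v obtain e' d' i' where 2: "v = el e' d' i'" "d' \<in> {0, 1}" "i' \<in> {0, 1}" by (rule set_UE)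
    have "4 * int e + 2 * d + i = 4 * int e' + 2 * d' + i'" using eq 1 2 by simp
    then have "e = e' \<and> d = d' \<and> i = i'" using 1 2 by auto presburger+
    then show "u = v" using 1 2 by simp
  qed
  show "end1 u \<in> numv ` set W \<and> end2 u \<in> numv ` set W" if u: "u \<in> set U" for u
    using u
  proof (rule set_UE)
    fix e d i assume *: "u = el e d i" "e \<in> E" "i \<in> {0, 1}"
    then show ?thesis unfolding numv_W using ends_eq(3,4)[OF *(2)] by auto
  qed
  show "is_safe u = is_safe v \<and> target u = target v"
    if u: "u \<in> set U" and v: "v \<in> set U" and eq: "uid u div 2 = uid v div 2" for u v
  proof -
    from u obtain e d i where 1: "u = el e d i" "d \<in> {0, 1}" "i \<in> {0, 1}" by (rule set_UE)
    from v obtain e' d' i' where 2: "v = el e' d' i'" "d' \<in> {0, 1}" "i' \<in> {0, 1}" by (rule set_UE)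
    have "(4 * int e + 2 * d + i) div 2 = (4 * int e' + 2 * d' + i') div 2" using eq 1 2 by simp
    moreover have "(4 * a + 2 * b + c) div 2 = 2 * a + b" if "c \<in> {0, 1}" for a b c :: int
      using that by auto
    ultimately have eq: "2 * int e + d = 2 * int e' + d'" using 1(3) 2(3) by metis
    then have "d mod 2 = d' mod 2" by presburger
    moreover have "d mod 2 = d" "d' mod 2 = d'" using 1(2) 2(2) by auto
    ultimately have "e = e' \<and> d = d'" using eq by simp
    then show ?thesis using 1 2 by simp
  qed
qed

section \<open>Feasibility of good sets of full size\<close>

lemma target_V:
  assumes "u \<in> set U"
  shows "\<exists>v\<in>V - {r}. target u = int v"
  using assms
proof (rule set_UE)
  fix e d i assume *: "u = el e d i" "e \<in> E" "target u \<noteq> int r"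
  then show ?thesis using ends_eq(3,4)[OF *(2)]
    by (intro bexI[of _ "if d = 1 then Max (ends I e) else Min (ends I e)"]) auto
qed

lemma card_target:
  assumes "indegree2 U F" "finite Z"
  shows "card {u \<in> F. target u \<in> int ` Z} \<le> 2 * card Z"
proof -
  have "{u \<in> F. target u \<in> int ` Z} = (\<Union>v\<in>Z. {u \<in> F. target u = int v})" by auto
  moreover have "card (\<Union>v\<in>Z. {u \<in> F. target u = int v}) \<le> (\<Sum>v\<in>Z. card {u \<in> F. target u = int v})"
    by (rule card_UN_le[OF assms(2)])
  moreover have "\<dots> \<le> (\<Sum>v\<in>Z. 2)" using assms(1) by (intro sum_mono) (simp add: indegree2_def)
  ultimately show ?thesis by simp
qed

text \<open>This bound by the second matroid alone is what the search needs in order to stop at the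
  size of the comparison set.\<close>

lemma card_indegree2:
  assumes "indegree2 U F"
  shows "card F \<le> 2 * card (V - {r})"
proof -
  have "{u \<in> F. target u \<in> int ` (V - {r})} = F"
    using assms target_V unfolding indegree2_def by blast
  then show ?thesis using card_target[OF assms, of "V - {r}"] fin by simp
qed

text \<open>\<open>\<rho>\<close> sends each copied vertex to the copy of a fixed \<open>z\<close>
  with the same parity. One vertex per copy is its own representative, which leaves
  \<open>card Z - 1\<close> in each of the two copies.\<close>

lemma card_inside:
  assumes F: "graphic U F" and Z: "Z \<subseteq> V" "Z \<noteq> {}"
  shows "card {u \<in> F. ends I (name u) \<subseteq> Z} + 2 \<le> 2 * card Z"
proof -
  obtain z where z: "z \<in> Z" using Z by blast
  have finZ: "finite Z" using Z fin finite_subset by blast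
  define S where "S = (\<lambda>(v, i). 2 * int v + i) ` (Z \<times> {0, 1})"
  define \<rho> where "\<rho> a = 2 * int z + a mod 2" for a :: int
  have "card {u \<in> F. ends I (name u) \<subseteq> Z} \<le> card {a \<in> S. \<rho> a \<noteq> a}"
  proof (rule forest_card[of end1 end2])
    show "forest end1 end2 {u \<in> F. ends I (name u) \<subseteq> Z}"
    proof (rule forest_mono)
      show "forest end1 end2 F" using F by (simp only: graphic_def)
    qed (rule Collect_restrict)
    show "finite S" using finZ by (simp add: S_def)
    fix u assume u: "u \<in> {u \<in> F. ends I (name u) \<subseteq> Z}"
    then have "u \<in> set U" using F by (auto simp: graphic_def)
    then obtain e d i where *: "u = el e d i" "e \<in> E" "i \<in> {0, 1}" by (rule set_UE)
    then have "Min (ends I e) \<in> Z" "Max (ends I e) \<in> Z" using u ends_eq(1)[OF *(2)] by auto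
    then show "end1 u \<in> S \<and> end2 u \<in> S \<and> \<rho> (end1 u) = \<rho> (end2 u)"
      using * by (auto simp: S_def \<rho>_def)
  qed
  also have "\<dots> \<le> card ((\<lambda>(v, i). 2 * int v + i) ` ((Z - {z}) \<times> {0, 1}))"
    using finZ by (intro card_mono) (auto simp: S_def \<rho>_def)
  also have "\<dots> \<le> card ((Z - {z}) \<times> {0, 1 :: int})"
    using finZ by (intro card_image_le) auto
  also have "\<dots> = 2 * card (Z - {z})" by (simp add: card_cartesian_product)
  finally show ?thesis using z finZ card_gt_0_iff[of Z] by (auto simp: card_Diff_singleton)
qed

lemma entering_edge:
  assumes B: "graphic U B" "indegree2 U B" "card B = 2 * card (V - {r})"
    and Z: "Z \<subseteq> V - {r}" "Z \<noteq> {}" and f: "f \<in> unsafe I"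
  shows "\<exists>e\<in>name ` B - {f}. \<exists>a b. ends I e = {a, b} \<and> a \<in> Z \<and> b \<in> V - Z"
proof -
  have finZ: "finite Z" and finB: "finite B"
    using Z B(1) fin finite_subset unfolding graphic_def by blast+
  let ?T = "{u \<in> B. target u \<in> int ` Z}" and ?N = "{u \<in> B. ends I (name u) \<subseteq> Z}"
  \<comment> \<open>At most two arcs point to each vertex other than \<open>r\<close> outside
    \<open>Z\<close>. As \<open>B\<close> has full size, at least \<open>2 * card Z\<close> arcs
    must point into \<open>Z\<close>.\<close>
  have "B = ?T \<union> {u \<in> B. target u \<in> int ` (V - {r} - Z)}"
    using B(1) target_V unfolding graphic_def by fastforce
  then have "card B \<le> card ?T + card {u \<in> B. target u \<in> int ` (V - {r} - Z)}"
    by (rule ord_eq_le_trans[OF arg_cong[where f = card] card_Un_le])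
  also have "\<dots> \<le> card ?T + 2 * card (V - {r} - Z)"
    using card_target[OF B(2), of "V - {r} - Z"] fin by simp
  also have "card (V - {r} - Z) = card (V - {r}) - card Z"
    using Z finZ by (intro card_Diff_subset) auto
  finally have "2 * card Z \<le> card ?T"
    using B(3) card_mono[OF _ Z(1)] fin by simp
  moreover have "card ?N + 2 \<le> 2 * card Z" using card_inside[OF B(1) _ Z(2)] Z(1) by blast
  ultimately have "card ?N + 2 \<le> card ?T" by simp
  moreover have "card ?T \<le> card (?T - ?N) + card ?N"
  proof -
    have "card ?T \<le> card ((?T - ?N) \<union> ?N)" using finB by (intro card_mono) auto
    also have "\<dots> \<le> card (?T - ?N) + card ?N" by (rule card_Un_le)
    finally show ?thesis .
  qed
  ultimately have "2 \<le> card (?T - ?N)" by simp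
  then obtain K where K: "K \<subseteq> ?T - ?N" "card K = 2" by (rule obtain_subset_with_card_n)
  from K(2) obtain u v where K': "K = {u, v}" "u \<noteq> v" unfolding card_2_iff by (elim exE conjE)
  have uvK: "u \<in> K" "v \<in> K" using K'(1) by simp_all
  note uv = subsetD[OF K(1) uvK(1)] subsetD[OF K(1) uvK(2)] K'(2)
  have cross: "\<exists>a b. ends I (name w) = {a, b} \<and> a \<in> Z \<and> b \<in> V - Z \<and> target w = int a"
    if w: "w \<in> ?T - ?N" for w
  proof -
    have "w \<in> set U" using w B(1) by (auto simp: graphic_def)
    then obtain e d i where *: "w = el e d i" "e \<in> E" by (rule set_UE)
    have e: "ends I e = {Min (ends I e), Max (ends I e)}" "ends I e = {Max (ends I e), Min (ends I e)}"
      using ends_eq(1)[OF *(2)] unfolding insert_commute[of "Max (ends I e)"] by this+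
    obtain a b where ab: "ends I e = {a, b}" "b \<in> V" "target w = int a"
    proof (cases "d = 1")
      case True
      show thesis by (rule that[OF e(2) ends_eq(3)[OF *(2)]]) (simp add: *(1) True)
    next
      case False
      show thesis by (rule that[OF e(1) ends_eq(4)[OF *(2)]]) (simp add: *(1) False)
    qed
    have n: "ends I (name w) = {a, b}" using * ab(1) by simp
    have "a \<in> Z" using w ab(3) by auto
    moreover have "b \<notin> Z" using w n \<open>a \<in> Z\<close> by auto
    ultimately show ?thesis using n ab(2,3) by blast
  qed
  \<comment> \<open>Two entering arcs of the same edge \<open>f\<close> have the same direction, so
    they differ only in the copy. For an unsafe edge this contradicts injectivity of
    \<open>arc_key\<close>.\<close>
  have "name u \<noteq> f \<or> name v \<noteq> f"
  proof (rule ccontr)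
    assume "\<not> ?thesis"
    then have names: "name u = f" "name v = f" by auto
    have UB: "u \<in> set U" "v \<in> set U" using uv B(1) by (auto simp: graphic_def)
    from UB(1) obtain e d i where 1: "u = el e d i" "e \<in> E" "d \<in> {0, 1}" "i \<in> {0, 1}" by (rule set_UE)
    from UB(2) obtain e' d' i' where 2: "v = el e' d' i'" "e' \<in> E" "d' \<in> {0, 1}" "i' \<in> {0, 1}" by (rule set_UE)
    have e: "e = f" "e' = f" using names 1 2 by simp_all
    obtain a b where ab: "ends I f = {a, b}" "a \<in> Z" "b \<in> V - Z" "target u = int a"
      using cross[OF uv(1)] names by auto
    obtain a' b' where ab': "ends I f = {a', b'}" "a' \<in> Z" "b' \<in> V - Z" "target v = int a'"
      using cross[OF uv(2)] names by auto
    have "a = a'" using ab ab' by (auto simp: doubleton_eq_iff)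
    then have "d = d'" using ab(4) ab'(4) 1 2 e ends_eq(2)[OF 1(2)] by (auto split: if_splits)
    moreover have "\<not> is_safe u" "\<not> is_safe v" using f e 1 2 by (auto simp: unsafe_def)
    moreover have "(4 * int f + 2 * d + i) div 2 = (4 * int f + 2 * d + i') div 2"
      using 1(3,4) 2(4) by auto
    ultimately have "arc_key u = arc_key v" using 1 2 e by (simp add: arc_key_def)
    then show False using B(2) uv by (auto simp: indegree2_def inj_on_def)
  qed
  then show ?thesis using cross uv by blast
qed

lemma output_feasible:
  assumes B: "graphic U B" "indegree2 U B" "card B = 2 * card (V - {r})"
  shows "feasible I (name ` B)"
  unfolding feasible_def
proof (intro conjI ballI)
  show "name ` B \<subseteq> E"
  proof
    fix e assume "e \<in> name ` B"
    then obtain u where u: "u \<in> set U" "e = name u" using B(1) by (auto simp: graphic_def)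
    from u(1) show "e \<in> E" by (rule set_UE) (use u(2) in simp)
  qed
  fix f assume f: "f \<in> unsafe I"
  let ?A = "adjacency I (name ` B - {f})"
  define Z where "Z = {v \<in> V. (r, v) \<notin> ?A\<^sup>*}"
  have sym: "sym (?A\<^sup>*)"
    by (intro sym_rtrancl symI) (auto simp: adjacency_def insert_commute)
  have "Z = {}"
  proof (rule ccontr)
    assume "Z \<noteq> {}"
    moreover have "Z \<subseteq> V - {r}" by (auto simp: Z_def)
    ultimately obtain e a b where e: "e \<in> name ` B - {f}" "ends I e = {a, b}" "a \<in> Z" "b \<in> V - Z"
      using entering_edge[OF B _ _ f, of Z] by blast
    then have "(b, a) \<in> ?A" by (auto simp: adjacency_def insert_commute)
    moreover have "(r, b) \<in> ?A\<^sup>*" using e(4) by (simp add: Z_def)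
    ultimately have "(r, a) \<in> ?A\<^sup>*" by (rule rtrancl_into_rtrancl[rotated])
    then show False using e(3) by (simp add: Z_def)
  qed
  then have "(r, v) \<in> ?A\<^sup>*" if "v \<in> V" for v using that by (auto simp: Z_def)
  then show "connected_by I (name ` B - {f})"
    unfolding connected_by_def using symD[OF sym] by (meson rtrancl_trans)
qed

section \<open>A cheap good set from two trees\<close>

definition toward :: "nat \<Rightarrow> nat \<Rightarrow> int \<Rightarrow> val" where
  "toward e v i = el e (if v = Max (ends I e) then 1 else 0) i"

lemma toward_el: "\<exists>d\<in>{0, 1}. toward e v i = el e d i"
  by (auto simp: toward_def)

lemma target_toward:
  assumes "e \<in> E" "v \<in> ends I e"
  shows "target (toward e v i) = int v"
proof -
  have "v \<in> {Min (ends I e), Max (ends I e)}"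
    using equalityD1[OF ends_eq(1)[OF assms(1)]] assms(2) by (rule subsetD)
  then show ?thesis using ends_eq(2)[OF assms(1)] by (auto simp: toward_def)
qed

lemma toward_in_U:
  assumes "e \<in> E" "v \<in> ends I e" "v \<noteq> r" "i \<in> {0, 1}"
  shows "toward e v i \<in> set U"
  using assms target_toward[OF assms(1,2), of i] toward_el[of e v i] set_U by force

text \<open>Remove a vertex \<open>v\<close> of \<open>A\<close> that is last in the numbering. It
  is not the parent of another vertex of \<open>A\<close>, so its copy is a leaf of what remains;
  \<open>F\<close> collects elements that avoid copy \<open>i\<close>.\<close>

lemma tree_forest:
  assumes par: "parents I S r V \<alpha> ord" and SE: "S \<subseteq> E" and i: "i \<in> {0, 1}" and A: "A \<subseteq> V - {r}"
    and F: "forest end1 end2 F" and ends: "\<And>y v. y \<in> F \<Longrightarrow> end1 y \<noteq> 2 * int v + i \<and> end2 y \<noteq> 2 * int v + i"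
  shows "forest end1 end2 ((\<lambda>v. toward (\<alpha> v) v i) ` A \<union> F)"
proof -
  have "finite A" using A fin finite_subset by blast
  then show ?thesis using A
  proof (induction "card A" arbitrary: A)
    case 0
    then show ?case using F by simp
  next
    case (Suc n)
    then have "A \<noteq> {}" by auto
    then obtain v where v: "v \<in> A" "\<And>z. z \<in> A \<Longrightarrow> ord z \<le> ord v"
      using Max_in[of "ord ` A"] Max_ge[of "ord ` A"] Suc.prems(1) by fastforce
    have IH: "forest end1 end2 ((\<lambda>v. toward (\<alpha> v) v i) ` (A - {v}) \<union> F)"
      using Suc v by (intro Suc.hyps(1)) auto
    have p: "\<alpha> z \<in> E \<and> (\<exists>u. ends I (\<alpha> z) = {u, z} \<and> ord u < ord z)" if "z \<in> A" for z
      using par SE Suc.prems(2) that unfolding parents_def by blast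
    have e: "\<exists>a b. end1 (toward (\<alpha> z) z i) = 2 * int a + i \<and> end2 (toward (\<alpha> z) z i) = 2 * int b + i \<and>
      ends I (\<alpha> z) = {a, b} \<and> a \<noteq> b" if "z \<in> A" for z
      using ends_eq[of "\<alpha> z"] p[OF that] by (auto simp: toward_def)
    have "forest end1 end2 (insert (toward (\<alpha> v) v i) ((\<lambda>v. toward (\<alpha> v) v i) ` (A - {v}) \<union> F))"
    proof (rule forest_leaf[OF IH, where v = "2 * int v + i"])
      show "end1 (toward (\<alpha> v) v i) \<noteq> end2 (toward (\<alpha> v) v i)" using e[OF v(1)] by auto
      show "2 * int v + i = end1 (toward (\<alpha> v) v i) \<or> 2 * int v + i = end2 (toward (\<alpha> v) v i)"
        using e[OF v(1)] p[OF v(1)] by (auto simp: doubleton_eq_iff)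
      fix y assume "y \<in> (\<lambda>v. toward (\<alpha> v) v i) ` (A - {v}) \<union> F"
      then show "end1 y \<noteq> 2 * int v + i \<and> end2 y \<noteq> 2 * int v + i"
      proof
        assume "y \<in> (\<lambda>v. toward (\<alpha> v) v i) ` (A - {v})"
        then obtain z where z: "z \<in> A" "z \<noteq> v" "y = toward (\<alpha> z) z i" by blast
        have "v \<notin> ends I (\<alpha> z)" using p[OF z(1)] v(2)[OF z(1)] z(2) by auto
        moreover obtain a b where "end1 y = 2 * int a + i" "end2 y = 2 * int b + i" "ends I (\<alpha> z) = {a, b}"
          using e[OF z(1)] unfolding z(3) by blast
        ultimately show ?thesis by simp
      qed (rule ends)
    qed
    moreover have "(\<lambda>v. toward (\<alpha> v) v i) ` A = insert (toward (\<alpha> v) v i) ((\<lambda>v. toward (\<alpha> v) v i) ` (A - {v}))"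
      using v(1) by blast
    ultimately show ?case by simp
  qed
qed

text \<open>If two vertices shared a parent edge, each would be the parent of the other, and the
  numbering would decrease in both directions.\<close>

lemma parents_inj:
  assumes "parents I S r V \<alpha> ord"
  shows "inj_on \<alpha> (V - {r})"
proof (rule inj_onI)
  fix v z assume v: "v \<in> V - {r}" and z: "z \<in> V - {r}" and eq: "\<alpha> v = \<alpha> z"
  obtain u where "ends I (\<alpha> v) = {u, v}" "ord u < ord v" using assms v unfolding parents_def by blast
  moreover obtain u' where "ends I (\<alpha> z) = {u', z}" "ord u' < ord z" using assms z unfolding parents_def by blast
  ultimately show "v = z" using eq by (auto simp: doubleton_eq_iff)
qed

text \<open>A tree uses every edge of \<open>S\<close> at most once and so weighs at most as much as
  \<open>S\<close>. The two trees give the factor 2.\<close>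

lemma parents_weight:
  assumes par: "parents I S r V \<alpha> ord" and SE: "S \<subseteq> E" and i: "i \<in> {0, 1}"
  shows "rat_of_int (\<Sum>v\<in>V - {r}. wt (toward (\<alpha> v) v i)) \<le> total_weight I S * of_int D"
proof -
  have \<alpha>S: "\<alpha> v \<in> S" if "v \<in> V - {r}" for v using par that unfolding parents_def by blast
  have wt_tow: "rat_of_int (wt (toward (\<alpha> v) v i)) = weight I (\<alpha> v) * of_int D" if "v \<in> V - {r}" for v
    using wt_el[of "\<alpha> v"] \<alpha>S[OF that] SE unfolding toward_def by blast
  have "rat_of_int (\<Sum>v\<in>V - {r}. wt (toward (\<alpha> v) v i)) = (\<Sum>v\<in>V - {r}. weight I (\<alpha> v)) * of_int D"
    unfolding of_int_sum sum_distrib_right by (intro sum.cong wt_tow refl)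
  also have "(\<Sum>v\<in>V - {r}. weight I (\<alpha> v)) = (\<Sum>e\<in>\<alpha> ` (V - {r}). weight I e)"
    by (simp add: sum.reindex[OF parents_inj[OF par]])
  also have "\<dots> \<le> total_weight I S"
    unfolding total_weight_def
    using \<alpha>S SE inst fin finite_subset[of S E] by (intro sum_mono2) (auto simp: fgc_instance_def)
  finally show ?thesis using D_pos by (simp add: mult_right_mono)
qed

lemma comparison_set:
  assumes feas: "feasible I S" and f: "f \<in> unsafe I"
  shows "\<exists>J. graphic U J \<and> indegree2 U J \<and> card J = 2 * card (V - {r}) \<and>
    rat_of_int (sum wt J) \<le> 2 * total_weight I S * of_int D"
proof -
  obtain \<alpha> \<beta> o1 o2 where par: "parents I S r V \<alpha> o1" "parents I S r V \<beta> o2"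
    and safe: "\<And>v. v \<in> V - {r} \<Longrightarrow> \<alpha> v = \<beta> v \<Longrightarrow> \<alpha> v \<in> safe I"
    using disjoint_trees[OF inst feas f r_V] by blast
  have SE: "S \<subseteq> E" using feas by (simp add: feasible_def)
  let ?a = "\<lambda>v. toward (\<alpha> v) v 0" and ?b = "\<lambda>v. toward (\<beta> v) v 1"
  let ?V = "V - {r}"
  define J where "J = ?a ` ?V \<union> ?b ` ?V"
  have a: "\<alpha> v \<in> E \<and> v \<in> ends I (\<alpha> v)" if "v \<in> ?V" for v
    using par(1) SE that unfolding parents_def by blast
  have b: "\<beta> v \<in> E \<and> v \<in> ends I (\<beta> v)" if "v \<in> ?V" for v
    using par(2) SE that unfolding parents_def by blast
  have tgt: "target (?a v) = int v" "target (?b v) = int v" if "v \<in> ?V" for v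
    using target_toward a[OF that] b[OF that] by blast+
  have sub: "J \<subseteq> set U"
  proof -
    have "?a v \<in> set U" "?b v \<in> set U" if "v \<in> ?V" for v
      using toward_in_U[of "\<alpha> v" v 0] toward_in_U[of "\<beta> v" v 1] a[OF that] b[OF that] that by simp_all
    then show ?thesis by (auto simp: J_def)
  qed
  have ends_b: "end1 y \<noteq> 2 * int v + 0 \<and> end2 y \<noteq> 2 * int v + 0" if y: "y \<in> ?b ` ?V \<union> {}" for y v
  proof -
    obtain z where "y = ?b z" using y by blast
    moreover have "2 * int c + 1 \<noteq> 2 * int v" for c by presburger
    ultimately show ?thesis by (simp add: toward_def)
  qed
  have fb: "forest end1 end2 (?b ` ?V \<union> {})"
    by (rule tree_forest[OF par(2) SE]) (auto intro: forest_empty)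
  have "forest end1 end2 (?a ` ?V \<union> (?b ` ?V \<union> {}))"
    by (rule tree_forest[OF par(1) SE _ order_refl fb]) (rule insertI1, rule ends_b)
  then have 1: "graphic U J" using sub by (simp add: graphic_def J_def)
  \<comment> \<open>The parity of the number of an element is its copy, so the two trees are
    disjoint as sets of elements.\<close>
  have uid_ab: "uid (?a v) mod 2 = 0" "uid (?b v) mod 2 = 1" for v
    by (auto simp: toward_def) presburger+
  have inj: "inj_on ?a ?V" "inj_on ?b ?V"
    using tgt by (auto intro!: inj_onI) (metis Diff_iff of_nat_eq_iff insertE singletonD)+
  have disj: "?a ` ?V \<inter> ?b ` ?V = {}"
  proof (rule ccontr)
    assume "\<not> ?thesis"
    then obtain v z where "?a v = ?b z" by blast
    then show False using uid_ab[of v] uid_ab[of z] by simp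
  qed
  have finV: "finite ?V" using fin by simp
  have card: "card J = 2 * card ?V"
    unfolding J_def using card_Un_disjoint[OF _ _ disj] finV inj by (simp add: card_image)
  have "card {y \<in> J. target y = v} \<le> 2" for v
  proof (cases "\<exists>z\<in>?V. v = int z")
    case True
    then obtain z where z: "z \<in> ?V" "v = int z" by blast
    have "{y \<in> J. target y = v} \<subseteq> {?a z, ?b z}"
    proof
      fix y assume "y \<in> {y \<in> J. target y = v}"
      then have y: "y \<in> J" "target y = v" by simp_all
      obtain z' where z': "z' \<in> ?V" "y = ?a z' \<or> y = ?b z'" using y(1) unfolding J_def by blast
      have "int z' = int z" using tgt[OF z'(1)] z'(2) y(2) z(2) by auto
      then show "y \<in> {?a z, ?b z}" using z'(2) by auto
    qed
    then have "card {y \<in> J. target y = v} \<le> card {?a z, ?b z}" by (intro card_mono) auto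
    also have "\<dots> \<le> 2" by (simp add: card_insert_if)
    finally show ?thesis .
  next
    case False
    have "target y \<noteq> v" if y: "y \<in> J" for y
    proof -
      obtain z where z: "z \<in> ?V" "y = ?a z \<or> y = ?b z" using y unfolding J_def by blast
      then have "target y = int z" using tgt[OF z(1)] by auto
      then show ?thesis using False z(1) by blast
    qed
    then have "{y \<in> J. target y = v} = {}" by blast
    then show ?thesis by (simp only: card.empty)
  qed
  moreover have "inj_on arc_key J"
  proof (rule inj_onI)
    fix y z assume y: "y \<in> J" and z: "z \<in> J" and eq: "arc_key y = arc_key z"
    have tz: "target y = target z" using arc_key_target[OF _ _ eq] y z sub by blast
    obtain v where v: "v \<in> ?V" "y = ?a v \<or> y = ?b v" using y by (auto simp: J_def)
    obtain v' where v': "v' \<in> ?V" "z = ?a v' \<or> z = ?b v'" using z by (auto simp: J_def)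
    have vv: "v' = v" using tz v v' tgt by auto
    show "y = z"
    proof (rule ccontr)
      assume "y \<noteq> z"
      then have ab: "arc_key (?a v) = arc_key (?b v)" using v v' vv eq by auto
      obtain d where d: "?a v = el (\<alpha> v) d 0" "d \<in> {0, 1}" using toward_el by blast
      obtain d' where d': "?b v = el (\<beta> v) d' 1" "d' \<in> {0, 1}" using toward_el by blast
      \<comment> \<open>Safe keys keep the copy and therefore differ. A coincidence means that both
        trees enter \<open>v\<close> by the same unsafe edge.\<close>
      have "\<alpha> v = \<beta> v \<and> \<alpha> v \<notin> safe I"
        using ab d(2) d'(2) unfolding arc_key_def d(1) d'(1) el_fields
        by (auto split: if_splits) presburger+
      then show False using safe[OF v(1)] by blast
    qed
  qed
  ultimately have 2: "indegree2 U J" using sub by (simp add: indegree2_def)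
  have "sum wt J = (\<Sum>v\<in>?V. wt (?a v)) + (\<Sum>v\<in>?V. wt (?b v))"
    unfolding J_def using finV disj by (simp add: sum.union_disjoint sum.reindex[OF inj(1)] sum.reindex[OF inj(2)])
  then have "rat_of_int (sum wt J) \<le> 2 * total_weight I S * of_int D"
    using parents_weight[OF par(1) SE, of 0] parents_weight[OF par(2) SE, of 1] by simp
  then show ?thesis using 1 2 card by blast
qed

text \<open>Several elements may name the same edge, which the output pays only once; weights are
  non-negative, so passing to the set of names cannot increase the total.\<close>

lemma output_weight:
  assumes "B \<subseteq> set U"
  shows "total_weight I (name ` B) * of_int D \<le> rat_of_int (sum wt B)"
proof -
  have fB: "finite B" using assms finite_subset by blast
  have w: "0 \<le> weight I (name u) \<and> weight I (name u) * of_int D = of_int (wt u)" if u: "u \<in> B" for u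
  proof -
    have "u \<in> set U" using u assms by blast
    then obtain e d i where "u = el e d i" "e \<in> E" by (rule set_UE)
    then show ?thesis using wt_el[of e d i] inst by (simp add: fgc_instance_def del: el_fields(8))
  qed
  have "total_weight I (name ` B) \<le> (\<Sum>u\<in>B. weight I (name u))"
    unfolding total_weight_def using sum_image_le[OF fB, of "weight I" name] w by (simp add: o_def)
  then have "total_weight I (name ` B) * of_int D \<le> (\<Sum>u\<in>B. weight I (name u)) * of_int D"
    using D_pos by (simp add: mult_right_mono)
  also have "\<dots> = rat_of_int (sum wt B)"
    unfolding sum_distrib_right of_int_sum using w by (intro sum.cong) auto
  finally show ?thesis .
qed

lemma algorithm_correct:
  assumes S: "feasible I S"
  shows "\<exists>es. enc_list (algorithm x) = enc_nats es \<and> feasible I (set es) \<and>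
    total_weight I (set es) \<le> 2 * total_weight I S"
proof (cases "unsafe I = {}")
  case True
  then have "\<forall>e\<in>set (dec_list (tl_val x)). numv (fld 5 e) = 1"
    using fin unfolding edges_list by (auto simp: enc_edge_def unsafe_def)
  then have "algorithm x = []" by (simp add: algorithm_def)
  moreover have "0 \<le> total_weight I S"
    unfolding total_weight_def using S inst by (intro sum_nonneg) (auto simp: feasible_def fgc_instance_def)
  ultimately show ?thesis
    using True by (intro exI[of _ "[]"]) (auto simp: enc_nats_def feasible_def total_weight_def)
next
  case False
  then obtain f where f: "f \<in> unsafe I" by blast
  obtain J where J: "graphic U J" "indegree2 U J" "card J = 2 * card (V - {r})"
    "rat_of_int (sum wt J) \<le> 2 * total_weight I S * of_int D"
    using comparison_set[OF S f] by blast
  let ?B = "solve W U"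
  have max: "card F \<le> card J" if "indegree2 U F" for F using card_indegree2[OF that] J(3) by simp
  note B = solve_optimal[OF J(1,2) max]
  have "\<not> (\<forall>e\<in>set (dec_list (tl_val x)). numv (fld 5 e) = 1)"
    using f fin unfolding edges_list by (auto simp: enc_edge_def unsafe_def)
  then have "algorithm x = map (\<lambda>u. fld 1 u) ?B" unfolding algorithm_def by (rule if_not_P)
  also have "\<dots> = map (\<lambda>n. Num (int n)) (map name ?B)"
  proof -
    have "fld 1 u = Num (int (name u))" if u: "u \<in> set ?B" for u
    proof -
      have "u \<in> set U" using u B(2) by (auto simp: graphic_def)
      then show ?thesis by (rule set_UE) simp
    qed
    then show ?thesis by simp
  qed
  finally have "enc_list (algorithm x) = enc_nats (map name ?B)" by (simp add: enc_nats_def)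
  moreover have "feasible I (set (map name ?B))"
    using output_feasible[OF B(2,3)] B(4) J(3) by simp
  moreover have "total_weight I (set (map name ?B)) \<le> 2 * total_weight I S"
  proof -
    have "total_weight I (name ` set ?B) * of_int D \<le> rat_of_int (sum wt (set ?B))"
      using B(2) by (intro output_weight) (simp add: graphic_def)
    also have "\<dots> \<le> rat_of_int (sum wt J)" using B(5) by (simp only: of_int_le_iff)
    also have "\<dots> \<le> 2 * total_weight I S * of_int D" by (rule J(4))
    finally show ?thesis using D_pos by simp
  qed
  ultimately show ?thesis by blast
qed

end

theorem theorem1:
  "\<exists>P :: program.
     poly_time_on {enc_fgc I | I. fgc_instance I} P \<and>
     (\<forall>I :: (nat, nat) fgc. fgc_instance I \<and> (\<exists>S. feasible I S) \<longrightarrow>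
        (\<exists>es t. runs P (enc_fgc I) (enc_nats es) t \<and>
                feasible I (set es) \<and>
                total_weight I (set es) \<le> 2523 / 1000 * OPT I))"
proof -
  obtain P p where P: "\<And>x. \<exists>t. runs P x (enc_list (algorithm x)) t \<and> t \<le> poly p (vsize x)"
    using pt_program[OF pt_algorithm] by blast
  have "\<exists>es t. runs P (enc_fgc I) (enc_nats es) t \<and> feasible I (set es) \<and>
      total_weight I (set es) \<le> 2523 / 1000 * OPT I"
    if inst: "fgc_instance I" and ex: "\<exists>S. feasible I S" for I :: "(nat, nat) fgc"
  proof -
    interpret fgc_encoding I by unfold_locales (rule inst)
    have "{S. feasible I S} \<subseteq> Pow (edges I)" by (auto simp: feasible_def)
    then have "finite {S. feasible I S}" using fin by (meson finite_Pow_iff finite_subset)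
    then have "OPT I \<in> total_weight I ` {S. feasible I S}"
      unfolding OPT_def using ex by (intro Min_in) auto
    then obtain S where S: "feasible I S" "total_weight I S = OPT I" by auto
    \<comment> \<open>Non-negativity allows the factor 2 to be weakened to
      \<open>2523 / 1000\<close>.\<close>
    have "0 \<le> OPT I"
      unfolding S(2)[symmetric] total_weight_def
      using S(1) inst by (intro sum_nonneg) (auto simp: feasible_def fgc_instance_def)
    then show ?thesis
      using algorithm_correct[OF S(1)] P[of "enc_fgc I"] S(2) by fastforce
  qed
  \<comment> \<open>Functions in \<open>pt\<close> are total with a bound for every input value, so
    instances without a feasible set are covered as well.\<close>
  moreover have "poly_time_on {enc_fgc I | I. fgc_instance I} P"
    unfolding poly_time_on_def using P by blast
  ultimately show ?thesis by blast
qed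

end
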